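(* Let $\mathbb{F}$ be an algebraically closed field of prime characteristic $p>2$, and let $L$ be the root lattice of type $A_n$ with $n+1\equiv 0\pmod p$. Write $n+1=ap^r$ with $a,r$ positive integers and $\gcd(a,p)=1$, let $\Pi=\{\alpha_1,\dots,\alpha_n\}$ be the simple roots, $\eta=\alpha_1+2\alpha_2+\cdots+n\alpha_n$, and let $I_L\subset V_{L,\mathbb F}$ be the $\mathbb F$-span of all elements $$s_{\alpha^1,m_1}\cdots s_{\alpha^k,m_k}s_{\eta,m}\iota(e_\alpha),\qquad \alpha\in L,\ k\in\mathbb N,\ \alpha^i\in\Pi,\ m_i\in\mathbb Z_+,\ m\in\mathbb Z_+\text{ with }p^r\nmid m.$$ Then $\operatorname{Rad}(\cdot,\cdot)_{V_{L,\mathbb F}}=I_L$.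
   Context: $\mathbb N=\{0,1,2,\dots\}$, $\mathbb Z_+=\{1,2,\dots\}$. **Lattice vertex algebra.** $L=\bigoplus_{i=1}^n\mathbb Z\alpha_i$ with $\langle\alpha_i,\alpha_i\rangle=2$, $\langle\alpha_i,\alpha_{i\pm1}\rangle=-1$, and $\langle\alpha_i,\alpha_j\rangle=0$ otherwise. Let $\mathfrak h_{\mathbb C}=\mathbb C\otimes_{\mathbb Z}L$. Over $\mathbb C$, $V_L=S(t^{-1}\mathfrak h_{\mathbb C}[t^{-1}])\otimes\mathbb C\{L\}$, where $\mathbb C\{L\}$ has basis $\{\iota(e_\alpha)\mid\alpha\in L\}$ and $\mathbf 1=1\otimes\iota(e_0)$. For $h\in\mathfrak h_{\mathbb C}$, $m>0$: $h(-m)$ is multiplication by $h\otimes t^{-m}$; $h(m)$ acts as the derivation of $S(t^{-1}\mathfrak h_{\mathbb C}[t^{-1}])$ with $h(m)\cdot h'(-k)=m\langle h,h'\rangle\delta_{m,k}$. For $\alpha\in L$, define operators $s_{\alpha,m},r_{\alpha,m}$ by $E^-(-\alpha,x)=\exp\left(\sum_{m\ge1}\frac{\alpha(-m)}{m}x^m\right)=\sum_{m\ge0}s_{\alpha,m}x^m$, $E^+(-\alpha,x)=\exp\left(\sum_{m\ge1}\frac{-\alpha(m)}{m}x^{-m}\right)=\sum_{m\ge0}r_{\alpha,m}x^{-m}$; write $s_{\alpha,m}$ also for $s_{\alpha,m}\mathbf 1$. The $\mathbb Z$-span $V_{L,\mathbb Z}$ of the elements $s_{\alpha^1,m_1}\cdots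 s_{\alpha^k,m_k}\iota(e_\alpha)$ ($k\in\mathbb N$, $\alpha^i\in\Pi$, $m_i\in\mathbb Z_+$, $\alpha\in L$) has these elements as a $\mathbb Z$-basis, is an integral form of the lattice vertex algebra $V_L$, and is preserved by all $s_{\alpha,m},r_{\alpha,m}$ ($\alpha\in L$). Put $V_{L,\mathbb F}=V_{L,\mathbb Z}\otimes_{\mathbb Z}\mathbb F$. **Bilinear form.** $(\cdot,\cdot)_{V_{L,\mathbb F}}$ is the symmetric bilinear form on $V_{L,\mathbb F}$ determined by $(\iota(e_\alpha),\iota(e_\beta))_{V_{L,\mathbb F}}=\delta_{\alpha,-\beta}$ for $\alpha,\beta\in L$ and $(s_{\alpha,m}u,v)_{V_{L,\mathbb F}}=(u,r_{\alpha,m}v)_{V_{L,\mathbb F}}$ for $u,v\in V_{L,\mathbb F}$, $\alpha\in L$, $m\in\mathbb N$. Its radical is $\operatorname{Rad}(\cdot,\cdot)_{V_{L,\mathbb F}}=\{v\in V_{L,\mathbb F}\mid(v,u)_{V_{L,\mathbb F}}=0\text{ for all }u\in V_{L,\mathbb F}\}$. *)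

theory Defs
  imports
    Complex_Main
    "HOL-Library.Poly_Mapping"
    "HOL-Computational_Algebra.Group_Closure"
    "HOL-Computational_Algebra.Polynomial"
    "HOL-Algebra.Coset"
    "HOL-Algebra.Generated_Groups"
    "HOL-Algebra.Free_Abelian_Groups"
begin

section \<open>The root lattice of type A\<close>

text \<open>
  An element of the lattice is the finitely supported family of its coefficients with respect
  to the simple roots. The root lattice of type \<open>A\<^sub>n\<close> uses the indices \<open>1, \<dots>, n\<close>; the type
  itself is larger, so that \<open>n\<close> can stay an ordinary variable.
\<close>

type_synonym lattice = "nat \<Rightarrow>\<^sub>0 int"

definition root_lattice :: "nat \<Rightarrow> lattice set" where
  "root_lattice n = {\<alpha>. Poly_Mapping.keys \<alpha> \<subseteq> {1..n}}"

definition simple_root :: "nat \<Rightarrow> lattice" where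
  "simple_root i = Poly_Mapping.single i 1"

definition cartan :: "nat \<Rightarrow> nat \<Rightarrow> int" where
  "cartan i j = (if i = j then 2 else if i = j + 1 \<or> j = i + 1 then - 1 else 0)"

definition lattice_form :: "lattice \<Rightarrow> lattice \<Rightarrow> int" where
  "lattice_form \<alpha> \<beta> =
     (\<Sum>i\<in>Poly_Mapping.keys \<alpha>. \<Sum>j\<in>Poly_Mapping.keys \<beta>.
        Poly_Mapping.lookup \<alpha> i * Poly_Mapping.lookup \<beta> j * cartan i j)"

definition eta :: "nat \<Rightarrow> lattice" where
  "eta n = (\<Sum>i=1..n. Poly_Mapping.single i (int i))"


section \<open>The complex space \<open>V\<^sub>L\<close> and its Heisenberg operators\<close>

text \<open>
  The symmetric algebra \<open>S(t\<^sup>-\<^sup>1 \<hh>[t\<^sup>-\<^sup>1])\<close> is the complex polynomial algebra in the variables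
  \<open>\<alpha>\<^sub>i \<otimes> t\<^sup>-\<^sup>k\<close>, \<open>k \<ge> 1\<close>, written here as pairs \<open>(i, k)\<close>; a monomial is its family of exponents, and
  the product of \<open>Poly_Mapping\<close> is the product of polynomials. An element of \<open>V\<^sub>L\<close> is a finite sum
  of terms \<open>f \<otimes> \<iota>(e\<^sub>\<alpha>)\<close>, represented by the family of its coefficients \<open>f\<close>, indexed by \<open>\<alpha>\<close>.
\<close>

type_synonym monom = "(nat \<times> nat) \<Rightarrow>\<^sub>0 nat"
type_synonym symalg = "monom \<Rightarrow>\<^sub>0 complex"
type_synonym voa = "lattice \<Rightarrow>\<^sub>0 symalg"

definition const :: "complex \<Rightarrow> symalg" where
  "const c = Poly_Mapping.single 0 c"

definition gen :: "nat \<Rightarrow> nat \<Rightarrow> symalg" where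
  "gen i k = Poly_Mapping.single (Poly_Mapping.single (i, k) 1) 1"

text \<open>\<open>creation \<alpha> m\<close> is \<open>\<alpha>(-m)\<close> for \<open>m > 0\<close>: multiplication by \<open>\<alpha> \<otimes> t\<^sup>-\<^sup>m\<close>.\<close>

definition creation :: "lattice \<Rightarrow> nat \<Rightarrow> symalg \<Rightarrow> symalg" where
  "creation \<alpha> m f =
     (\<Sum>i\<in>Poly_Mapping.keys \<alpha>. const (of_int (Poly_Mapping.lookup \<alpha> i)) * gen i m) * f"

text \<open>
  The derivation with prescribed values \<open>d\<close> on the variables, i.e. the sum over the variables
  \<open>v\<close> of \<open>d v\<close> times the partial derivative with respect to \<open>v\<close>.
\<close>

definition derivation :: "(nat \<times> nat \<Rightarrow> symalg) \<Rightarrow> symalg \<Rightarrow> symalg" where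
  "derivation d f =
     (\<Sum>\<mu>\<in>Poly_Mapping.keys f. \<Sum>v\<in>Poly_Mapping.keys \<mu>.
        d v * Poly_Mapping.single (\<mu> - Poly_Mapping.single v 1)
                (of_nat (Poly_Mapping.lookup \<mu> v) * Poly_Mapping.lookup f \<mu>))"

text \<open>\<open>annihilation \<alpha> m\<close> is \<open>\<alpha>(m)\<close> for \<open>m > 0\<close>.\<close>

definition annihilation :: "lattice \<Rightarrow> nat \<Rightarrow> symalg \<Rightarrow> symalg" where
  "annihilation \<alpha> m =
     derivation (\<lambda>(j, k). if k = m
                  then const (of_nat m * of_int (lattice_form \<alpha> (simple_root j))) else 0)"

text \<open>
  \<open>pow_coeff A k m\<close> is the coefficient of \<open>x\<^sup>m\<close> in the \<open>k\<close>-th power of the operator-valued series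
  \<open>\<Sum>j\<ge>1. A\<^sub>j x\<^sup>j\<close>, and \<open>exp_coeff A m\<close> is the coefficient of \<open>x\<^sup>m\<close> in its exponential. The series
  has no constant term, so only the powers with \<open>k \<le> m\<close> contribute.
\<close>

primrec pow_coeff :: "(nat \<Rightarrow> symalg \<Rightarrow> symalg) \<Rightarrow> nat \<Rightarrow> nat \<Rightarrow> symalg \<Rightarrow> symalg" where
  "pow_coeff A 0 m f = (if m = 0 then f else 0)"
| "pow_coeff A (Suc k) m f = (\<Sum>j=1..m. A j (pow_coeff A k (m - j) f))"

definition exp_coeff :: "(nat \<Rightarrow> symalg \<Rightarrow> symalg) \<Rightarrow> nat \<Rightarrow> symalg \<Rightarrow> symalg" where
  "exp_coeff A m f = (\<Sum>k\<le>m. const (1 / fact k) * pow_coeff A k m f)"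

text \<open>
  The operators \<open>s\<^bsub>\<alpha>,m\<^esub>\<close> and \<open>r\<^bsub>\<alpha>,m\<^esub>\<close> on \<open>V\<^sub>L\<close>; they act on the symmetric algebra factor only.
  In \<open>r\<close> the power series variable is \<open>x\<^sup>-\<^sup>1\<close>.
\<close>

definition s_op :: "lattice \<Rightarrow> nat \<Rightarrow> voa \<Rightarrow> voa" where
  "s_op \<alpha> m = Poly_Mapping.map
     (exp_coeff (\<lambda>j f. const (1 / of_nat j) * creation \<alpha> j f) m)"

definition r_op :: "lattice \<Rightarrow> nat \<Rightarrow> voa \<Rightarrow> voa" where
  "r_op \<alpha> m = Poly_Mapping.map
     (exp_coeff (\<lambda>j f. const (- 1 / of_nat j) * annihilation \<alpha> j f) m)"

definition iota :: "lattice \<Rightarrow> voa" where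
  "iota \<alpha> = Poly_Mapping.single \<alpha> 1"


section \<open>The integral form\<close>

text \<open>\<open>s_word [(i\<^sub>1,m\<^sub>1), \<dots>, (i\<^sub>k,m\<^sub>k)]\<close> is \<open>s\<^bsub>\<alpha>\<^sub>i\<^sub>1,m\<^sub>1\<^esub> \<cdots> s\<^bsub>\<alpha>\<^sub>i\<^sub>k,m\<^sub>k\<^esub>\<close>, for a family of operators \<open>s\<close>.\<close>

definition s_word :: "(lattice \<Rightarrow> nat \<Rightarrow> 'v \<Rightarrow> 'v) \<Rightarrow> (nat \<times> nat) list \<Rightarrow> 'v \<Rightarrow> 'v" where
  "s_word s w v = foldr (\<lambda>(i, m). s (simple_root i) m) w v"

definition VZ :: "nat \<Rightarrow> voa set" where
  "VZ n = group_closure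
     {s_word s_op w (iota \<alpha>) |w \<alpha>. set w \<subseteq> {1..n} \<times> {1..} \<and> \<alpha> \<in> root_lattice n}"


section \<open>Extension of scalars from the integers to a field\<close>

text \<open>
  The tensor product of an additive subgroup \<open>A\<close> with a field over the integers: the free abelian
  group on the pairs \<open>(v, c)\<close> modulo the relations of biadditivity. It is an abelian group of
  cosets, written multiplicatively as always in \<open>HOL-Algebra\<close>: the sum of \<open>X\<close> and \<open>Y\<close> is
  \<open>X \<otimes>\<^bsub>tensor A\<^esub> Y\<close>.
\<close>

type_synonym ('v, 'f) tens = "(('v \<times> 'f) \<Rightarrow>\<^sub>0 int) set"

definition tensor_rels :: "'v::ab_group_add set \<Rightarrow> (('v \<times> 'f::field) \<Rightarrow>\<^sub>0 int) set" where
  "tensor_rels A =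
     {frag_of (u + v, c) - frag_of (u, c) - frag_of (v, c) |u v c. u \<in> A \<and> v \<in> A} \<union>
     {frag_of (v, c + d) - frag_of (v, c) - frag_of (v, d) |v c d. v \<in> A}"

definition tensor_free :: "'v::ab_group_add set \<Rightarrow> (('v \<times> 'f::field) \<Rightarrow>\<^sub>0 int) monoid" where
  "tensor_free A = free_Abelian_group (A \<times> UNIV)"

definition tensor_null :: "'v::ab_group_add set \<Rightarrow> ('v, 'f::field) tens" where
  "tensor_null A = generate (tensor_free A) (tensor_rels A)"

definition tensor :: "'v::ab_group_add set \<Rightarrow> ('v, 'f::field) tens monoid" where
  "tensor A = tensor_free A Mod tensor_null A"

definition pure_tensor :: "'v::ab_group_add set \<Rightarrow> 'v \<Rightarrow> 'f::field \<Rightarrow> ('v, 'f) tens" where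
  "pure_tensor A v c = tensor_null A #>\<^bsub>tensor_free A\<^esub> frag_of (v, c)"

text \<open>
  The map of the tensor product induced by a map of pairs \<open>\<phi>\<close> that is compatible with the
  relations; the union is over cosets which then all coincide.
\<close>

definition tensor_induced ::
    "'v::ab_group_add set \<Rightarrow> ('v \<times> 'f \<Rightarrow> 'v \<times> 'f) \<Rightarrow> ('v, 'f::field) tens \<Rightarrow> ('v, 'f) tens" where
  "tensor_induced A \<phi> X =
     (\<Union>x\<in>X. tensor_null A #>\<^bsub>tensor_free A\<^esub> frag_extend (\<lambda>y. frag_of (\<phi> y)) x)"

definition tensor_scale ::
    "'v::ab_group_add set \<Rightarrow> 'f::field \<Rightarrow> ('v, 'f) tens \<Rightarrow> ('v, 'f) tens" where
  "tensor_scale A c = tensor_induced A (\<lambda>(v, d). (v, c * d))"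

definition tensor_map ::
    "'v::ab_group_add set \<Rightarrow> ('v \<Rightarrow> 'v) \<Rightarrow> ('v, 'f::field) tens \<Rightarrow> ('v, 'f) tens" where
  "tensor_map A T = tensor_induced A (\<lambda>(v, d). (T v, d))"

definition tensor_span ::
    "'v::ab_group_add set \<Rightarrow> ('v, 'f::field) tens set \<Rightarrow> ('v, 'f) tens set" where
  "tensor_span A S = generate (tensor A) {tensor_scale A c X |c X. X \<in> S}"


section \<open>The space \<open>V\<^bsub>L,F\<^esub>\<close>, its bilinear form and the subspace \<open>I\<^sub>L\<close>\<close>

definition VF :: "nat \<Rightarrow> (voa, 'f::field) tens monoid" where
  "VF n = tensor (VZ n)"

definition iotaF :: "nat \<Rightarrow> lattice \<Rightarrow> (voa, 'f::field) tens" where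
  "iotaF n \<alpha> = pure_tensor (VZ n) (iota \<alpha>) 1"

definition sF :: "nat \<Rightarrow> lattice \<Rightarrow> nat \<Rightarrow> (voa, 'f::field) tens \<Rightarrow> (voa, 'f) tens" where
  "sF n \<alpha> m = tensor_map (VZ n) (s_op \<alpha> m)"

definition rF :: "nat \<Rightarrow> lattice \<Rightarrow> nat \<Rightarrow> (voa, 'f::field) tens \<Rightarrow> (voa, 'f) tens" where
  "rF n \<alpha> m = tensor_map (VZ n) (r_op \<alpha> m)"

definition symmetric_bilinear ::
    "nat \<Rightarrow> ((voa, 'f::field) tens \<Rightarrow> (voa, 'f) tens \<Rightarrow> 'f) \<Rightarrow> bool" where
  "symmetric_bilinear n B \<longleftrightarrow>
     (\<forall>u\<in>carrier (VF n). \<forall>v\<in>carrier (VF n). B u v = B v u) \<and>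
     (\<forall>u\<in>carrier (VF n). \<forall>v\<in>carrier (VF n). \<forall>w\<in>carrier (VF n).
        B (u \<otimes>\<^bsub>VF n\<^esub> v) w = B u w + B v w) \<and>
     (\<forall>c. \<forall>u\<in>carrier (VF n). \<forall>v\<in>carrier (VF n).
        B (tensor_scale (VZ n) c u) v = c * B u v)"

text \<open>These conditions determine the values of \<open>B\<close> on \<open>carrier (VF n)\<close>.\<close>

definition is_VF_form ::
    "nat \<Rightarrow> ((voa, 'f::field) tens \<Rightarrow> (voa, 'f) tens \<Rightarrow> 'f) \<Rightarrow> bool" where
  "is_VF_form n B \<longleftrightarrow>
     symmetric_bilinear n B \<and>
     (\<forall>\<alpha>\<in>root_lattice n. \<forall>\<beta>\<in>root_lattice n.
        B (iotaF n \<alpha>) (iotaF n \<beta>) = (if \<alpha> = - \<beta> then 1 else 0)) \<and>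
     (\<forall>u\<in>carrier (VF n). \<forall>v\<in>carrier (VF n). \<forall>\<alpha>\<in>root_lattice n. \<forall>m.
        B (sF n \<alpha> m u) v = B u (rF n \<alpha> m v))"

definition Rad ::
    "nat \<Rightarrow> ((voa, 'f::field) tens \<Rightarrow> (voa, 'f) tens \<Rightarrow> 'f) \<Rightarrow> (voa, 'f) tens set" where
  "Rad n B = {v \<in> carrier (VF n). \<forall>u\<in>carrier (VF n). B v u = 0}"

definition IL :: "nat \<Rightarrow> nat \<Rightarrow> nat \<Rightarrow> (voa, 'f::field) tens set" where
  "IL n p r = tensor_span (VZ n)
     {s_word (sF n) w (sF n (eta n) m (iotaF n \<alpha>)) |w m \<alpha>.
        set w \<subseteq> {1..n} \<times> {1..} \<and> m \<ge> 1 \<and> \<not> p ^ r dvd m \<and> \<alpha> \<in> root_lattice n}"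

end

(*
  Everything reduces to the commutation relation
    r_alpha(x) s_beta(y) = (1 - y/x)^<alpha,beta> s_beta(y) r_alpha(x)
  together with the fact that r_alpha(x) is an algebra homomorphism on the symmetric algebra.

  All values <alpha,eta> are multiples of n + 1 = a p^r, and (1 - z)^(p^r c) is a series in z^(p^r)
  modulo p. Hence the ideal generated by the s_(eta,m) with p^r not dividing m is stable under all
  r_(alpha,k), and it pairs to 0 with every iota(e_beta). By adjointness it lies in the radical.

  Conversely, use the basis eta, alpha_2, ..., alpha_n of the lattice. Modulo I_L every vector is a
  combination of monomials in the s_(eta,p^r m) and the s_(alpha_i,m) with i >= 2. For each of these n
  colours there is a beta whose commutation factor with the other colours is trivial and with this
  colour is 1 - z, respectively 1 - z^(p^r), modulo p and up to any prescribed degree. If k is the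
  largest number of factors of this colour in a nonzero combination of monomials, then r_(beta,k),
  respectively r_(beta,p^r k), kills the monomials with fewer factors and lowers the index of each of
  the k factors by one in the others. This is injective on monomials, so that the result is again
  nonzero and of smaller weight. After finitely many steps only vectors iota(e_alpha) remain, on which
  the form is nondegenerate.
*)
theory Submission
  imports
    Defs
    "HOL-Computational_Algebra.Formal_Power_Series"
    "HOL-Library.Multiset"
    "HOL-Number_Theory.Cong"
begin

unbundle fps_syntax


section \<open>Exponentials of commuting operators\<close>

text \<open>Reduction modulo p needs integral coefficients, whereas exponentials and uniqueness
  arguments divide by m. Identities are therefore proved in the complex polynomial algebra, from the
  recursion for m times the m-th coefficient that characterises an exponential; integrality is
  recorded in the ring \<open>SA\<close>; congruences modulo p in \<open>SA\<close> then become
  equalities of pure tensors, because p crosses the tensor sign and becomes the scalar 0. The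
  obstacle in colour 0: every <beta, eta> is a multiple of a p^r, so the exponent p^r itself is in
  general out of reach. An inverse of a modulo p^N yields an exponent p^r + p^(N+r) e, and the extra
  factor is 1 modulo p below degree p^(N+r). Hence the degree, and with it the weight of the
  monomials, must be bounded in advance. The lowering argument treats formal combinations, whose
  coefficients are attached to indices. It thus proves the linear independence of the reduced
  monomials modulo the radical together with nondegeneracy.\<close>

lemma const_0 [simp]: "const 0 = 0" by (simp add: const_def)
lemma const_1 [simp]: "const 1 = 1" by (simp add: const_def)
lemma const_add: "const (a + b) = const a + const b" by (simp add: const_def single_add)
lemma const_mult: "const (a * b) = const a * const b" by (simp add: const_def mult_single)
lemma const_uminus: "const (- a) = - const a" by (simp add: const_def single_uminus)
lemma const_of_nat: "const (of_nat k) = of_nat k" by (simp add: const_def)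
lemma const_of_int: "const (of_int k) = of_int k" by (simp add: const_def)
lemma const_inverse_mult: "k \<noteq> 0 \<Longrightarrow> const (1 / of_nat k) * (of_nat k * f) = f"
  by (simp flip: const_of_nat const_mult mult.assoc)

lemma of_nat_mult_const_inverse: "k \<noteq> 0 \<Longrightarrow> of_nat k * (const (1 / of_nat k) * f) = f"
  by (metis const_inverse_mult mult.left_commute)

lemma of_nat_mult_cancel_symalg:
  assumes "k \<noteq> 0" "of_nat k * f = of_nat k * (g :: symalg)"
  shows "f = g"
  using assms const_inverse_mult by metis

locale const_linear =
  fixes T :: "symalg \<Rightarrow> symalg"
  assumes add: "T (f + g) = T f + T g"
    and scale: "T (const c * f) = const c * T f"
begin

unbundle fps_syntax


lemma zero [simp]: "T 0 = 0"
  using scale [of 0 0] by simp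

lemma sum: "T (\<Sum>i\<in>I. f i) = (\<Sum>i\<in>I. T (f i))"
  by (induction I rule: infinite_finite_induct) (simp_all add: add)

lemma of_nat: "T (of_nat k * f) = of_nat k * T f"
  using scale [of "of_nat k" f] by (simp add: const_of_nat)

end

text \<open>Covers both exponents, sum alpha(-m) x^m / m and sum -alpha(m) x^-m / m. Commutation of
  the coefficients lets the exponential satisfy a first-order differential equation.\<close>

locale commuting_family =
  fixes A :: "nat \<Rightarrow> symalg \<Rightarrow> symalg"
  assumes linear: "const_linear (A j)"
    and commute: "A i (A j f) = A j (A i f)"
begin

unbundle fps_syntax


sublocale const_linear "A j" for j by (rule linear)

lemma pow_coeff_eq_0: "m < k \<Longrightarrow> pow_coeff A k m f = 0"
proof (induction k arbitrary: m)
  case (Suc k)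
  have "A j (pow_coeff A k (m - j) f) = 0" if "j \<in> {1..m}" for j
    using that Suc by (subst Suc.IH) auto
  then show ?case by simp
qed simp

lemma triangle_swap:
  fixes h :: "nat \<Rightarrow> nat \<Rightarrow> 'b::comm_monoid_add"
  shows "(\<Sum>j=1..m. \<Sum>i=1..m - j. h i j) = (\<Sum>i=1..m. \<Sum>j=1..m - i. h i j)"
  unfolding sum.Sigma [OF finite_atLeastAtMost ballI [OF finite_atLeastAtMost]]
  by (rule sum.reindex_bij_witness [where i = prod.swap and j = prod.swap]) auto

text \<open>Coefficient of x^m in x d/dx A^(k+1) = (k+1) (x dA/dx) A^k, which relies on the
  coefficients of A commuting.\<close>

lemma of_nat_mult_pow_coeff_Suc:
  "of_nat m * pow_coeff A (Suc k) m f =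
   of_nat (Suc k) * (\<Sum>j=1..m. of_nat j * A j (pow_coeff A k (m - j) f))"
proof (induction k arbitrary: m)
  case 0
  have "(\<Sum>j=1..m. of_nat m * A j (pow_coeff A 0 (m - j) f)) =
        (\<Sum>j=1..m. of_nat j * A j (pow_coeff A 0 (m - j) f))"
    by (intro sum.cong) auto
  then show ?case by (simp add: sum_distrib_left)
next
  case (Suc k)
  let ?P = "\<lambda>k m. pow_coeff A k m f"
  have "of_nat m * ?P (Suc (Suc k)) m = (\<Sum>j=1..m. of_nat m * A j (?P (Suc k) (m - j)))"
    by (simp add: sum_distrib_left)
  \<comment> \<open>The splitting m = j + (m - j) is the Leibniz rule: the first part differentiates
    the outer factor, the second the inner power.\<close>
  also have "\<dots> = (\<Sum>j=1..m. of_nat j * A j (?P (Suc k) (m - j)) + A j (of_nat (m - j) * ?P (Suc k) (m - j)))"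
  proof (intro sum.cong refl)
    fix j assume "j \<in> {1..m}"
    then have "of_nat m = (of_nat j + of_nat (m - j) :: symalg)" by (simp flip: of_nat_add)
    then show "of_nat m * A j (?P (Suc k) (m - j)) =
        of_nat j * A j (?P (Suc k) (m - j)) + A j (of_nat (m - j) * ?P (Suc k) (m - j))"
      by (simp only: of_nat distrib_right)
  qed
  also have "\<dots> = (\<Sum>j=1..m. of_nat j * A j (?P (Suc k) (m - j))) +
      of_nat (Suc k) * (\<Sum>j=1..m. \<Sum>i=1..m-j. A j (of_nat i * A i (?P k (m - j - i))))"
    unfolding Suc.IH of_nat sum by (simp only: sum.distrib sum_distrib_left)
  also have "(\<Sum>j=1..m. \<Sum>i=1..m-j. A j (of_nat i * A i (?P k (m - j - i)))) =
      (\<Sum>i=1..m. \<Sum>j=1..m-i. A j (of_nat i * A i (?P k (m - j - i))))"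
    by (rule triangle_swap)
  also have "\<dots> = (\<Sum>i=1..m. of_nat i * A i (?P (Suc k) (m - i)))"
    by (intro sum.cong refl)
       (simp add: of_nat sum sum_distrib_left commute add.commute)
  finally show ?case by (simp add: algebra_simps)
qed

lemma exp_coeff_0 [simp]: "exp_coeff A 0 f = f"
  by (simp add: exp_coeff_def)

text \<open>Coefficient of x^m in x d/dx exp A = (x dA/dx) exp A.\<close>

lemma of_nat_mult_exp_coeff:
  "of_nat m * exp_coeff A m f = (\<Sum>j=1..m. of_nat j * A j (exp_coeff A (m - j) f))"
proof (cases m)
  case (Suc m')
  let ?P = "\<lambda>k m. pow_coeff A k m f"
  have fact: "const (1 / fact (Suc k)) * (of_nat (Suc k) * g) = const (1 / fact k) * g" for k g
  proof -
    have "const (1 / fact (Suc k)) * (of_nat (Suc k) * g) = const (1 / fact (Suc k) * of_nat (Suc k)) * g"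
      by (simp only: const_mult const_of_nat mult.assoc)
    also have "1 / fact (Suc k) * of_nat (Suc k) = (1 / fact k :: complex)"
      by (simp add: field_simps del: of_nat_Suc)
    finally show ?thesis .
  qed
  have "of_nat m * exp_coeff A m f = (\<Sum>k\<le>Suc m'. const (1 / fact k) * (of_nat m * ?P k m))"
    by (simp add: exp_coeff_def Suc sum_distrib_left mult.left_commute del: sum.atMost_Suc)
  also have "\<dots> = (\<Sum>k\<le>m'. const (1 / fact k) * (\<Sum>j=1..m. of_nat j * A j (?P k (m - j))))"
    by (subst sum.atMost_Suc_shift) (simp only: of_nat_mult_pow_coeff_Suc fact, simp add: Suc)
  also have "\<dots> = (\<Sum>j=1..m. \<Sum>k\<le>m'. const (1 / fact k) * (of_nat j * A j (?P k (m - j))))"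
    by (simp only: sum_distrib_left sum.swap [of _ "{..m'}"])
  \<comment> \<open>Powers with k > m - j have no coefficient in degree m - j, so the sum can be cut
    to the range used in \<open>exp_coeff\<close>.\<close>
  also have "\<dots> = (\<Sum>j=1..m. \<Sum>k\<le>m - j. const (1 / fact k) * (of_nat j * A j (?P k (m - j))))"
    by (intro sum.cong refl sum.mono_neutral_right) (auto simp: Suc pow_coeff_eq_0)
  also have "\<dots> = (\<Sum>j=1..m. of_nat j * A j (exp_coeff A (m - j) f))"
    by (intro sum.cong refl)
       (simp add: exp_coeff_def sum scale sum_distrib_left mult.left_commute)
  finally show ?thesis .
qed simp

text \<open>Over the complex numbers the factor m can be cancelled, so the recursion has one
  solution. This is the tool behind \<open>spoly_unique\<close> and
  \<open>rmap_unique\<close>.\<close>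

lemma exp_coeff_unique:
  assumes "F 0 = f" "\<And>m. m > 0 \<Longrightarrow> of_nat m * F m = (\<Sum>j=1..m. of_nat j * A j (F (m - j)))"
  shows "exp_coeff A m f = F m"
proof (induction m rule: less_induct)
  case (less m)
  show ?case
  proof (cases "m = 0")
    case False
    have "of_nat m * exp_coeff A m f = of_nat m * F m"
      unfolding of_nat_mult_exp_coeff using False less assms(2) [of m] by (auto intro!: sum.cong)
    then show ?thesis using of_nat_mult_cancel_symalg False by blast
  qed (simp add: assms)
qed

lemma exp_coeff_linear: "const_linear (exp_coeff A m)"
proof
  fix f g c
  show "exp_coeff A m (f + g) = exp_coeff A m f + exp_coeff A m g"
    by (rule exp_coeff_unique)
       (auto simp: add ring_distribs of_nat_mult_exp_coeff sum.distrib)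
  show "exp_coeff A m (const c * f) = const c * exp_coeff A m f"
    by (rule exp_coeff_unique)
       (auto simp: scale of_nat_mult_exp_coeff sum_distrib_left mult.left_commute [of _ "const c"])
qed

end

section \<open>Creation operators\<close>

text \<open>The polynomial representing alpha tensor t^-m; by \<open>creation_eq\<close>, alpha(-m)
  is multiplication by it.\<close>

definition acoef :: "lattice \<Rightarrow> nat \<Rightarrow> symalg" where
  "acoef \<alpha> m = (\<Sum>i\<in>Poly_Mapping.keys \<alpha>. const (of_int (Poly_Mapping.lookup \<alpha> i)) * gen i m)"

lemma creation_eq: "creation \<alpha> m f = acoef \<alpha> m * f"
  by (simp add: creation_def acoef_def)

lemma acoef_superset:
  assumes "finite I" "Poly_Mapping.keys \<alpha> \<subseteq> I"
  shows "acoef \<alpha> m = (\<Sum>i\<in>I. const (of_int (Poly_Mapping.lookup \<alpha> i)) * gen i m)"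
  unfolding acoef_def using assms
  by (intro sum.mono_neutral_left) (auto simp: in_keys_iff)

lemma acoef_add: "acoef (\<alpha> + \<beta>) m = acoef \<alpha> m + acoef \<beta> m"
proof -
  let ?I = "Poly_Mapping.keys \<alpha> \<union> Poly_Mapping.keys \<beta>"
  show ?thesis
    using keys_add [of \<alpha> \<beta>]
    by (simp add: acoef_superset [of ?I] lookup_add const_add distrib_right sum.distrib)
qed

definition spoly :: "lattice \<Rightarrow> nat \<Rightarrow> symalg" where
  "spoly \<alpha> m = exp_coeff (\<lambda>j f. const (1 / of_nat j) * creation \<alpha> j f) m 1"

lemma commuting_creation: "commuting_family (\<lambda>j f. const (1 / of_nat j) * creation \<alpha> j f)"
  by unfold_locales (simp_all add: creation_eq algebra_simps)

lemma exp_coeff_creation_eqI: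
  assumes "F 0 = f" "\<And>m. m > 0 \<Longrightarrow> of_nat m * F m = (\<Sum>j=1..m. acoef \<alpha> j * F (m - j))"
  shows "exp_coeff (\<lambda>j f. const (1 / of_nat j) * creation \<alpha> j f) m f = F m"
proof -
  interpret commuting_family "\<lambda>j f. const (1 / of_nat j) * creation \<alpha> j f"
    by (rule commuting_creation)
  show ?thesis
  proof (rule exp_coeff_unique)
    fix m :: nat
    assume "m > 0"
    show "of_nat m * F m =
        (\<Sum>j=1..m. of_nat j * (const (1 / of_nat j) * creation \<alpha> j (F (m - j))))"
      unfolding assms(2) [OF \<open>m > 0\<close>]
      by (rule sum.cong) (auto simp: creation_eq of_nat_mult_const_inverse)
  qed fact
qed

lemma spoly_0 [simp]: "spoly \<alpha> 0 = 1"
  by (simp add: spoly_def exp_coeff_def)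

lemma of_nat_mult_spoly: "of_nat m * spoly \<alpha> m = (\<Sum>j=1..m. acoef \<alpha> j * spoly \<alpha> (m - j))"
proof -
  interpret commuting_family "\<lambda>j f. const (1 / of_nat j) * creation \<alpha> j f"
    by (rule commuting_creation)
  show ?thesis
    unfolding spoly_def of_nat_mult_exp_coeff
    by (rule sum.cong) (auto simp: creation_eq of_nat_mult_const_inverse)
qed

lemma spoly_unique:
  assumes "F 0 = 1" "\<And>m. m > 0 \<Longrightarrow> of_nat m * F m = (\<Sum>j=1..m. acoef \<alpha> j * F (m - j))"
  shows "spoly \<alpha> m = F m"
  unfolding spoly_def using assms by (rule exp_coeff_creation_eqI)

lemma exp_coeff_creation:
  "exp_coeff (\<lambda>j f. const (1 / of_nat j) * creation \<alpha> j f) m f = spoly \<alpha> m * f"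
  by (rule exp_coeff_creation_eqI) (auto simp: of_nat_mult_spoly sum_distrib_right mult.assoc simp flip: mult.assoc[of "of_nat _"])

definition Sfps :: "lattice \<Rightarrow> symalg fps" where
  "Sfps \<alpha> = Abs_fps (spoly \<alpha>)"

text \<open>Derivative of the exponent sum_(j>=1) alpha(-j) x^j / j, hence the shift of the
  index.\<close>

definition afps :: "lattice \<Rightarrow> symalg fps" where
  "afps \<alpha> = Abs_fps (\<lambda>j. acoef \<alpha> (Suc j))"

lemma fps_deriv_eq_iff:
  "fps_deriv (F :: symalg fps) = afps \<alpha> * F \<longleftrightarrow>
   (\<forall>m>0. of_nat m * F $ m = (\<Sum>j=1..m. acoef \<alpha> j * F $ (m - j)))"
proof -
  have "(afps \<alpha> * F) $ m = (\<Sum>j=1..Suc m. acoef \<alpha> j * F $ (Suc m - j))" for m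
    by (simp add: fps_mult_nth afps_def sum.shift_bounds_cl_Suc_ivl del: sum.cl_ivl_Suc)
  then show ?thesis
    by (auto simp: fps_eq_iff gr0_conv_Suc simp del: of_nat_Suc sum.cl_ivl_Suc)
qed

lemma Sfps_deriv: "fps_deriv (Sfps \<alpha>) = afps \<alpha> * Sfps \<alpha>"
  unfolding fps_deriv_eq_iff Sfps_def by (simp add: of_nat_mult_spoly)

lemma Sfps_unique:
  assumes "fps_deriv F = afps \<alpha> * F" "F $ 0 = 1"
  shows "Sfps \<alpha> = F"
proof -
  have "spoly \<alpha> m = F $ m" for m
    using assms by (intro spoly_unique) (auto simp only: fps_deriv_eq_iff)
  then show ?thesis by (simp add: Sfps_def fps_eq_iff)
qed

text \<open>Both sides have constant term 1 and logarithmic derivative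
  \<open>afps \<alpha> + afps \<beta>\<close>, since creation operators are additive in the
  root.\<close>

lemma Sfps_add: "Sfps (\<alpha> + \<beta>) = Sfps \<alpha> * Sfps \<beta>"
proof (rule Sfps_unique)
  have "afps (\<alpha> + \<beta>) = afps \<alpha> + afps \<beta>" by (simp add: afps_def acoef_add fps_eq_iff)
  then show "fps_deriv (Sfps \<alpha> * Sfps \<beta>) = afps (\<alpha> + \<beta>) * (Sfps \<alpha> * Sfps \<beta>)"
    by (simp add: Sfps_deriv algebra_simps)
qed (simp add: Sfps_def)

lemma spoly_add: "spoly (\<alpha> + \<beta>) m = (\<Sum>j\<le>m. spoly \<alpha> j * spoly \<beta> (m - j))"
  using arg_cong [OF Sfps_add, of "\<lambda>F. F $ m"] by (simp add: Sfps_def fps_mult_nth atLeast0AtMost)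

lemma spoly_zero: "spoly 0 m = (if m = 0 then 1 else 0)"
  by (rule spoly_unique) (auto simp: acoef_def)

text \<open>The series of -alpha is inverse to that of alpha, and a series with constant term 1 is
  inverted without division. This keeps negatives of lattice elements integral.\<close>

lemma spoly_uminus: "m > 0 \<Longrightarrow> spoly (- \<alpha>) m = - (\<Sum>j=1..m. spoly \<alpha> j * spoly (- \<alpha>) (m - j))"
  using spoly_add [of \<alpha> "- \<alpha>" m]
  by (simp add: spoly_zero sum.atLeast_Suc_atMost add_eq_0_iff2 flip: atLeast0AtMost)

section \<open>Derivations\<close>

lemma poly_mapping_sum_singles:
  fixes f :: "'a \<Rightarrow>\<^sub>0 'b::comm_monoid_add"
  shows "f = (\<Sum>x\<in>Poly_Mapping.keys f. Poly_Mapping.single x (Poly_Mapping.lookup f x))"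
  by (rule poly_mapping_eqI)
     (auto simp: lookup_sum lookup_single when_def in_keys_iff sum.delta')

lemma const_mult_single: "const c * Poly_Mapping.single \<mu> d = Poly_Mapping.single \<mu> (c * d)"
  by (simp add: const_def mult_single)

lemma single_one_eq_prod_gen:
  "Poly_Mapping.single \<mu> 1 =
   (\<Prod>v\<in>Poly_Mapping.keys \<mu>. gen (fst v) (snd v) ^ Poly_Mapping.lookup \<mu> v)"
proof -
  have power: "Poly_Mapping.single (Poly_Mapping.single v k) 1 = gen (fst v) (snd v) ^ k" for v k
  proof (induction k)
    case (Suc k)
    have "Poly_Mapping.single v (Suc k) = Poly_Mapping.single v 1 + Poly_Mapping.single v k"
      by (simp flip: single_add)
    then have "Poly_Mapping.single (Poly_Mapping.single v (Suc k)) 1 =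
        gen (fst v) (snd v) * Poly_Mapping.single (Poly_Mapping.single v k) 1"
      by (simp add: gen_def mult_single)
    with Suc show ?case by simp
  qed simp
  have "Poly_Mapping.single (\<Sum>v\<in>V. Poly_Mapping.single v (g v)) 1 =
        (\<Prod>v\<in>V. gen (fst v) (snd v) ^ g v)" if "finite V" for V g
    using that
  proof induction
    case (insert x V)
    have "Poly_Mapping.single (\<Sum>v\<in>insert x V. Poly_Mapping.single v (g v)) (1 :: complex) =
        Poly_Mapping.single (Poly_Mapping.single x (g x)) 1 *
        Poly_Mapping.single (\<Sum>v\<in>V. Poly_Mapping.single v (g v)) 1"
      using insert.hyps by (simp add: mult_single)
    then show ?case using insert by (simp add: power)
  qed simp
  then show ?thesis by (subst poly_mapping_sum_singles) simp
qed

text \<open>Reduces additive and multiplicative identities, such as those for derivations and their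
  exponentials, to constants and variables.\<close>

lemma symalg_induct [case_names const gen add mult]:
  assumes const: "\<And>c. P (const c)" and gen: "\<And>i k. P (gen i k)"
    and add: "\<And>f g. P f \<Longrightarrow> P g \<Longrightarrow> P (f + g)"
    and mult: "\<And>f g. P f \<Longrightarrow> P g \<Longrightarrow> P (f * g)"
  shows "P f"
proof -
  have "P 0" "P 1" using const [of 0] const [of 1] by simp_all
  have sum: "(\<And>x. P (h x)) \<Longrightarrow> P (\<Sum>x\<in>I. h x)" for h :: "monom \<Rightarrow> symalg" and I
    using \<open>P 0\<close> add by (induction I rule: infinite_finite_induct) auto
  have power: "P g \<Longrightarrow> P (g ^ k)" for g k
    using \<open>P 1\<close> mult by (induction k) auto
  have prod: "(\<And>x. P (h x)) \<Longrightarrow> P (\<Prod>x\<in>I. h x)" for h :: "nat \<times> nat \<Rightarrow> symalg" and I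
    using \<open>P 1\<close> mult by (induction I rule: infinite_finite_induct) auto
  have "P (Poly_Mapping.single \<mu> 1)" for \<mu>
    unfolding single_one_eq_prod_gen by (intro prod power gen)
  then have "P (Poly_Mapping.single \<mu> c)" for \<mu> c
    using mult [OF const [of c], of "Poly_Mapping.single \<mu> 1"] by (simp add: const_mult_single)
  then show ?thesis by (subst poly_mapping_sum_singles) (intro sum)
qed

definition derivation_monom :: "(nat \<times> nat \<Rightarrow> symalg) \<Rightarrow> monom \<Rightarrow> symalg" where
  "derivation_monom d \<mu> = (\<Sum>v\<in>Poly_Mapping.keys \<mu>. d v *
     Poly_Mapping.single (\<mu> - Poly_Mapping.single v 1) (of_nat (Poly_Mapping.lookup \<mu> v)))"

lemma derivation_eq:
  "derivation d f =
   (\<Sum>\<mu>\<in>Poly_Mapping.keys f. const (Poly_Mapping.lookup f \<mu>) * derivation_monom d \<mu>)"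
  unfolding derivation_def derivation_monom_def sum_distrib_left
  by (intro sum.cong refl) (simp add: const_mult_single mult.left_commute [of "const _"] mult.commute)

lemma derivation_superset:
  assumes "finite M" "Poly_Mapping.keys f \<subseteq> M"
  shows "derivation d f = (\<Sum>\<mu>\<in>M. const (Poly_Mapping.lookup f \<mu>) * derivation_monom d \<mu>)"
  unfolding derivation_eq using assms by (intro sum.mono_neutral_left) (auto simp: in_keys_iff)

lemma derivation_monom_superset:
  assumes "finite V" "Poly_Mapping.keys \<mu> \<subseteq> V"
  shows "derivation_monom d \<mu> = (\<Sum>v\<in>V. d v *
     Poly_Mapping.single (\<mu> - Poly_Mapping.single v 1) (of_nat (Poly_Mapping.lookup \<mu> v)))"
  unfolding derivation_monom_def
  using assms by (intro sum.mono_neutral_left) (auto simp: in_keys_iff)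

lemma derivation_linear: "const_linear (derivation d)"
proof
  fix f g :: symalg and c
  let ?M = "Poly_Mapping.keys f \<union> Poly_Mapping.keys g"
  show "derivation d (f + g) = derivation d f + derivation d g"
    using keys_add [of f g]
    by (simp add: derivation_superset [of ?M] lookup_add const_add distrib_right sum.distrib)
  have lookup: "Poly_Mapping.lookup (const c * f) \<mu> = c * Poly_Mapping.lookup f \<mu>" for \<mu>
    by (simp add: const_def flip: mult_map_scale_conv_mult) (simp add: Poly_Mapping.map.rep_eq when_def)
  have "Poly_Mapping.keys (const c * f) \<subseteq> Poly_Mapping.keys f"
    by (auto simp: in_keys_iff lookup)
  then show "derivation d (const c * f) = const c * derivation d f"
    by (subst derivation_superset [of "Poly_Mapping.keys f"])
       (simp_all add: derivation_eq lookup const_mult sum_distrib_left mult.assoc)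
qed

lemma derivation_single: "derivation d (Poly_Mapping.single \<mu> c) = const c * derivation_monom d \<mu>"
  by (subst derivation_superset [of "{\<mu>}"]) auto

lemma derivation_monom_add:
  "derivation_monom d (\<mu> + \<nu>) =
   Poly_Mapping.single \<nu> 1 * derivation_monom d \<mu> + Poly_Mapping.single \<mu> 1 * derivation_monom d \<nu>"
proof -
  let ?V = "Poly_Mapping.keys \<mu> \<union> Poly_Mapping.keys \<nu>"
  let ?t = "\<lambda>\<mu> v. Poly_Mapping.single (\<mu> - Poly_Mapping.single v 1) (of_nat (Poly_Mapping.lookup \<mu> v)) :: symalg"
  have shift: "Poly_Mapping.single (\<mu> + \<nu> - Poly_Mapping.single v 1) (of_nat (Poly_Mapping.lookup \<mu> v)) =
      Poly_Mapping.single \<nu> 1 * ?t \<mu> v" for v and \<mu> \<nu> :: monom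
  \<comment> \<open>Subtraction of exponents is truncated. It fails to be exact only when v does not
    occur in \<open>\<mu>\<close>, and then the coefficient is 0 on both sides.\<close>
  proof (cases "Poly_Mapping.lookup \<mu> v = 0")
    case False
    then have "\<mu> + \<nu> - Poly_Mapping.single v 1 = \<nu> + (\<mu> - Poly_Mapping.single v 1)"
      by (intro poly_mapping_eqI) (auto simp: lookup_add lookup_minus lookup_single when_def)
    then show ?thesis by (simp add: mult_single)
  qed simp
  have "?t (\<mu> + \<nu>) v = Poly_Mapping.single \<nu> 1 * ?t \<mu> v + Poly_Mapping.single \<mu> 1 * ?t \<nu> v" for v
    using shift [of \<mu> \<nu> v] shift [of \<nu> \<mu> v] by (simp add: lookup_add single_add add.commute)
  then show ?thesis
    using keys_add [of \<mu> \<nu>]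
    by (simp add: derivation_monom_superset [of ?V] sum_distrib_left sum.distrib algebra_simps)
qed

text \<open>Both sides are bilinear, so two monomials suffice. \<open>left\<close> extends the rule
  to sums in the first argument, and \<open>sym\<close> lets the same step serve the second.\<close>

lemma derivation_mult: "derivation d (f * g) = derivation d f * g + f * derivation d g"
proof -
  interpret const_linear "derivation d" by (rule derivation_linear)
  have monom: "derivation d (Poly_Mapping.single \<mu> a * Poly_Mapping.single \<nu> b) =
      derivation d (Poly_Mapping.single \<mu> a) * Poly_Mapping.single \<nu> b +
      Poly_Mapping.single \<mu> a * derivation d (Poly_Mapping.single \<nu> b)" for \<mu> \<nu> a b
  proof -
    have unit: "derivation d (Poly_Mapping.single (\<mu> + \<nu>) 1) =
        derivation d (Poly_Mapping.single \<mu> 1) * Poly_Mapping.single \<nu> 1 +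
        Poly_Mapping.single \<mu> 1 * derivation d (Poly_Mapping.single \<nu> 1)"
      by (simp add: derivation_single derivation_monom_add algebra_simps)
    have "Poly_Mapping.single \<mu> a * Poly_Mapping.single \<nu> b = const a * (const b * Poly_Mapping.single (\<mu> + \<nu>) 1)"
      "Poly_Mapping.single \<mu> a = const a * Poly_Mapping.single \<mu> 1"
      "Poly_Mapping.single \<nu> b = const b * Poly_Mapping.single \<nu> 1"
      by (simp_all add: mult_single const_mult_single)
    then show ?thesis by (simp only: scale unit) (simp add: algebra_simps)
  qed
  let ?leibniz = "\<lambda>f g. derivation d (f * g) = derivation d f * g + f * derivation d g"
  have left: "?leibniz (\<Sum>x\<in>I. h x) g" if "\<And>x. ?leibniz (h x) g" for h :: "monom \<Rightarrow> symalg" and I g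
    by (simp add: sum_distrib_right sum that sum.distrib)
  have sym: "?leibniz f g" if "?leibniz g f" for f g
    using that by (simp add: mult.commute add.commute)
  have "?leibniz (\<Sum>\<mu>\<in>Poly_Mapping.keys f. Poly_Mapping.single \<mu> (Poly_Mapping.lookup f \<mu>)) (Poly_Mapping.single \<nu> b)" for \<nu> b
    by (rule left [OF monom])
  then have "?leibniz f (Poly_Mapping.single \<nu> b)" for \<nu> b
    by (simp only: poly_mapping_sum_singles [of f, symmetric])
  then have "?leibniz (\<Sum>\<nu>\<in>Poly_Mapping.keys g. Poly_Mapping.single \<nu> (Poly_Mapping.lookup g \<nu>)) f"
    by (rule left [OF sym])
  then have "?leibniz g f"
    by (simp only: poly_mapping_sum_singles [of g, symmetric])
  then show ?thesis by (rule sym)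
qed

lemma derivation_const [simp]: "derivation d (const c) = 0"
  by (simp add: const_def derivation_single derivation_monom_def)

lemma derivation_gen [simp]: "derivation d (gen i k) = d (i, k)"
  by (simp add: gen_def derivation_single derivation_monom_def)

section \<open>Annihilation operators\<close>

lemma annihilation_linear: "const_linear (annihilation \<alpha> m)"
  unfolding annihilation_def by (rule derivation_linear)

lemma annihilation_mult:
  "annihilation \<alpha> m (f * g) = annihilation \<alpha> m f * g + f * annihilation \<alpha> m g"
  unfolding annihilation_def by (rule derivation_mult)

lemma annihilation_const [simp]: "annihilation \<alpha> m (const c) = 0"
  by (simp add: annihilation_def)

lemma annihilation_gen:
  "annihilation \<alpha> m (gen i k) =
   (if k = m then const (of_nat m * of_int (lattice_form \<alpha> (simple_root i))) else 0)"
  by (simp add: annihilation_def)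

text \<open>On a variable each operator gives a constant, so both compositions vanish there; on a
  product the twice applied Leibniz rule is symmetric in i and j.\<close>

lemma annihilation_commute: "annihilation \<alpha> i (annihilation \<alpha> j f) = annihilation \<alpha> j (annihilation \<alpha> i f)"
proof (induction f rule: symalg_induct)
  case (add f g)
  then show ?case by (simp add: const_linear.add [OF annihilation_linear])
next
  case (mult f g)
  then show ?case
    by (simp add: const_linear.add [OF annihilation_linear] annihilation_mult algebra_simps)
qed (auto simp: annihilation_gen const_linear.zero [OF annihilation_linear])

lemma commuting_annihilation:
  "commuting_family (\<lambda>j f. const (- 1 / of_nat j) * annihilation \<alpha> j f)"
  by unfold_locales
     (simp_all add: const_linear.add [OF annihilation_linear] const_linear.scale [OF annihilation_linear]
       distrib_left mult.left_commute annihilation_commute)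

definition rmap :: "lattice \<Rightarrow> nat \<Rightarrow> symalg \<Rightarrow> symalg" where
  "rmap \<alpha> = exp_coeff (\<lambda>j f. const (- 1 / of_nat j) * annihilation \<alpha> j f)"

lemma rmap_linear: "const_linear (rmap \<alpha> m)"
  unfolding rmap_def by (rule commuting_family.exp_coeff_linear [OF commuting_annihilation])

lemma rmap_0 [simp]: "rmap \<alpha> 0 f = f"
  by (simp add: rmap_def exp_coeff_def)

lemma of_nat_mult_annihilation_term:
  "j > 0 \<Longrightarrow> of_nat j * (const (- (1 / of_nat j)) * f) = - f"
  using of_nat_mult_const_inverse [of j f] by (simp add: const_uminus)

lemma of_nat_mult_rmap: "of_nat m * rmap \<alpha> m f = - (\<Sum>j=1..m. annihilation \<alpha> j (rmap \<alpha> (m - j) f))"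
  unfolding rmap_def commuting_family.of_nat_mult_exp_coeff [OF commuting_annihilation] sum_negf [symmetric]
  by (rule sum.cong) (auto simp: of_nat_mult_annihilation_term)

lemma rmap_unique:
  assumes "F 0 = f" "\<And>m. m > 0 \<Longrightarrow> of_nat m * F m = - (\<Sum>j=1..m. annihilation \<alpha> j (F (m - j)))"
  shows "rmap \<alpha> m f = F m"
  unfolding rmap_def
proof (rule commuting_family.exp_coeff_unique [OF commuting_annihilation])
  fix m :: nat
  assume "m > 0"
  show "of_nat m * F m =
      (\<Sum>j=1..m. of_nat j * (const (- 1 / of_nat j) * annihilation \<alpha> j (F (m - j))))"
    unfolding assms(2) [OF \<open>m > 0\<close>] sum_negf [symmetric]
    by (rule sum.cong) (auto simp: of_nat_mult_annihilation_term)
qed fact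

text \<open>The exponent of E^+(-alpha, x) has the scalar bracket -<alpha, alpha_i> x^-k with
  alpha_i(-k), so conjugation by the exponential shifts alpha_i(-k) by this scalar. The proof
  verifies that the right-hand side satisfies the recursion for r.\<close>

lemma rmap_gen_mult:
  "rmap \<alpha> m (gen i k * g) = gen i k * rmap \<alpha> m g -
     of_int (lattice_form \<alpha> (simple_root i)) * (if 0 < k \<and> k \<le> m then rmap \<alpha> (m - k) g else 0)"
proof -
  define l :: symalg where "l = of_int (lattice_form \<alpha> (simple_root i))"
  \<comment> \<open>The value is 0 also for k = 0: the polynomial ring contains variables
    \<open>gen i 0\<close>, which no annihilation operator of positive index moves.\<close>
  define G where "G m = (if 0 < k \<and> k \<le> m then rmap \<alpha> (m - k) g else 0)" for m
  interpret d: const_linear "annihilation \<alpha> j" for j by (rule annihilation_linear)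
  have l: "l = const (of_int (lattice_form \<alpha> (simple_root i)))" by (simp add: l_def const_of_int)
  have diff: "annihilation \<alpha> j (f - h) = annihilation \<alpha> j f - annihilation \<alpha> j h" for j f h
    using d.add [of j "f - h" h] by (simp add: algebra_simps)
  have "rmap \<alpha> m (gen i k * g) = gen i k * rmap \<alpha> m g - l * G m"
  proof (rule rmap_unique)
    show "gen i k * rmap \<alpha> 0 g - l * G 0 = gen i k * g" by (auto simp: G_def)
  next
    fix m :: nat
    assume "m > 0"
    have ann_gen: "annihilation \<alpha> j (gen i k) = (if j = k then of_nat k * l else 0)" for j
      by (simp add: annihilation_gen l const_mult const_of_nat)
    have ann_G: "(\<Sum>j=1..m. annihilation \<alpha> j (G (m - j))) = - (of_nat (m - k) * G m)"
    proof (cases "0 < k \<and> k \<le> m")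
      case True
      have "(\<Sum>j=1..m. annihilation \<alpha> j (G (m - j))) = (\<Sum>j=1..m - k. annihilation \<alpha> j (G (m - j)))"
        using True by (intro sum.mono_neutral_right) (auto simp: G_def)
      also have "\<dots> = (\<Sum>j=1..m - k. annihilation \<alpha> j (rmap \<alpha> (m - k - j) g))"
        using True by (intro sum.cong) (auto simp: G_def add.commute)
      also have "\<dots> = - (of_nat (m - k) * G m)"
      proof -
        have "G m = rmap \<alpha> (m - k) g" using True by (simp add: G_def)
        then show ?thesis by (simp only: of_nat_mult_rmap minus_minus)
      qed
      finally show ?thesis .
    next
      case False
      then have "G (m - j) = 0" "G m = 0" for j by (auto simp: G_def)
      then show ?thesis by simp
    qed
    have "annihilation \<alpha> j (gen i k * rmap \<alpha> (m - j) g - l * G (m - j)) =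
        gen i k * annihilation \<alpha> j (rmap \<alpha> (m - j) g) +
        (if j = k then of_nat k * l * rmap \<alpha> (m - j) g else 0) -
        l * annihilation \<alpha> j (G (m - j))" for j
      by (simp add: diff annihilation_mult ann_gen) (simp add: l d.scale)
    then have "(\<Sum>j=1..m. annihilation \<alpha> j (gen i k * rmap \<alpha> (m - j) g - l * G (m - j))) =
        gen i k * (\<Sum>j=1..m. annihilation \<alpha> j (rmap \<alpha> (m - j) g)) +
        (\<Sum>j=1..m. if j = k then of_nat k * l * rmap \<alpha> (m - j) g else 0) -
        l * (\<Sum>j=1..m. annihilation \<alpha> j (G (m - j)))"
      by (simp add: sum.distrib sum_subtractf sum_distrib_left)
    also have "(\<Sum>j=1..m. if j = k then of_nat k * l * rmap \<alpha> (m - j) g else 0) = of_nat k * l * G m"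
      by (auto simp: G_def)
    also have "(\<Sum>j=1..m. annihilation \<alpha> j (rmap \<alpha> (m - j) g)) = - (of_nat m * rmap \<alpha> m g)"
      by (simp add: of_nat_mult_rmap)
    also note ann_G
    finally have *: "- (\<Sum>j=1..m. annihilation \<alpha> j (gen i k * rmap \<alpha> (m - j) g - l * G (m - j))) =
        of_nat m * (gen i k * rmap \<alpha> m g) - (of_nat k + of_nat (m - k)) * (l * G m)"
      by (simp add: algebra_simps)
    have "(of_nat k + of_nat (m - k)) * (l * G m) = of_nat m * (l * G m)"
      by (cases "k \<le> m") (auto simp: G_def simp flip: of_nat_add)
    then show "of_nat m * (gen i k * rmap \<alpha> m g - l * G m) =
        - (\<Sum>j=1..m. annihilation \<alpha> j (gen i k * rmap \<alpha> (m - j) g - l * G (m - j)))"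
      unfolding * by (simp add: right_diff_distrib)
  qed
  then show ?thesis by (simp add: l_def G_def)
qed

text \<open>The formal variable stands for x^-1.\<close>

definition Rfps :: "lattice \<Rightarrow> symalg \<Rightarrow> symalg fps" where
  "Rfps \<alpha> f = Abs_fps (\<lambda>m. rmap \<alpha> m f)"

lemma Rfps_nth [simp]: "Rfps \<alpha> f $ m = rmap \<alpha> m f"
  by (simp add: Rfps_def)

lemma Rfps_add: "Rfps \<alpha> (f + g) = Rfps \<alpha> f + Rfps \<alpha> g"
  by (simp add: fps_eq_iff const_linear.add [OF rmap_linear])

lemma rmap_1: "rmap \<alpha> m 1 = (if m = 0 then 1 else 0)"
proof (rule rmap_unique)
  fix m :: nat
  assume "m > 0"
  have "annihilation \<alpha> j (if m - j = 0 then 1 else 0) = 0" for j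
    using annihilation_const [of \<alpha> j 1] by (simp add: const_linear.zero [OF annihilation_linear])
  then show "of_nat m * (if m = 0 then 1 else 0) =
      - (\<Sum>j=1..m. annihilation \<alpha> j (if m - j = 0 then 1 else 0))"
    using \<open>m > 0\<close> by simp
qed simp

lemma Rfps_1 [simp]: "Rfps \<alpha> 1 = 1"
  by (simp add: fps_eq_iff rmap_1)

lemma Rfps_const_mult: "Rfps \<alpha> (const c * f) = fps_const (const c) * Rfps \<alpha> f"
  by (simp add: fps_eq_iff const_linear.scale [OF rmap_linear])

lemma Rfps_gen_mult:
  "Rfps \<alpha> (gen i k * g) = (fps_const (gen i k) -
     fps_const (of_int (lattice_form \<alpha> (simple_root i))) * (if k = 0 then 0 else fps_X ^ k)) * Rfps \<alpha> g"
  by (auto simp: fps_eq_iff rmap_gen_mult left_diff_distrib fps_X_power_mult_nth mult.assoc)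

text \<open>The exponential of a derivation is an algebra homomorphism. For a variable as first
  factor, \<open>Rfps_gen_mult\<close> turns the product into multiplication by a series that does
  not depend on g; the other generators are immediate.\<close>

lemma Rfps_mult: "Rfps \<alpha> (f * g) = Rfps \<alpha> f * Rfps \<alpha> g"
proof (induction f arbitrary: g rule: symalg_induct)
  case (const c)
  show ?case using Rfps_const_mult [of \<alpha> c] Rfps_const_mult [of \<alpha> c 1] by simp
next
  case (gen i k)
  show ?case using Rfps_gen_mult [of \<alpha> i k] Rfps_gen_mult [of \<alpha> i k 1] by simp
next
  case (add f g)
  then show ?case by (simp add: distrib_right Rfps_add)
next
  case (mult f1 f2)
  then show ?case by (simp add: mult.assoc)
qed

lemma rmap_mult: "rmap \<alpha> m (f * g) = (\<Sum>j\<le>m. rmap \<alpha> j f * rmap \<alpha> (m - j) g)"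
  using arg_cong [OF Rfps_mult, of "\<lambda>F. F $ m"] by (simp add: fps_mult_nth atLeast0AtMost)

section \<open>Commutation relations\<close>

text \<open>The coefficient of \<open>z\<^sup>k\<close> in the expansion of \<open>(1 - z)\<^sup>m\<close>, for every integer \<open>m\<close>.\<close>

definition comm_coeff :: "int \<Rightarrow> nat \<Rightarrow> int" where
  "comm_coeff m k = (if 0 \<le> m then (- 1) ^ k * int (nat m choose k) else int ((k + nat (- m) - 1) choose k))"

lemma comm_coeff_0 [simp]: "comm_coeff m 0 = 1"
  by (simp add: comm_coeff_def)

text \<open>Coefficientwise form of (1 - z) y' = -m y for y = (1 - z)^m.\<close>

lemma comm_coeff_Suc: "int (Suc k) * comm_coeff m (Suc k) = (int k - m) * comm_coeff m k"
proof (cases "0 \<le> m")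
  case True
  define n where "n = nat m"
  have m: "m = int n" using True by (simp add: n_def)
  have "int (Suc k) * int (n choose Suc k) = (int n - int k) * int (n choose k)"
  proof (cases "k \<le> n")
    case True
    have "Suc k * (n choose Suc k) = (n - k) * (n choose k)"
      using binomial_absorb_comp [of n k] binomial_absorption [of k n] by simp
    then have "int (Suc k * (n choose Suc k)) = int ((n - k) * (n choose k))" by simp
    then show ?thesis using True by (simp only: of_nat_mult of_nat_diff)
  qed (simp add: binomial_eq_0)
  then have "(- 1) ^ Suc k * (int (Suc k) * int (n choose Suc k)) = (- 1) ^ Suc k * ((int n - int k) * int (n choose k))"
    by (simp only:)
  then show ?thesis by (simp add: comm_coeff_def m algebra_simps)
next
  case False
  define n where "n = nat (- m) - 1"
  have m: "m = - int n - 1" using False by (simp add: n_def)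
  have "Suc k * (Suc (k + n) choose Suc k) = (k + n + 1) * ((k + n) choose k)"
    using Suc_times_binomial [of k "k + n"] by simp
  then have "int (Suc k * (Suc (k + n) choose Suc k)) = int ((k + n + 1) * ((k + n) choose k))" by (simp only:)
  moreover have "k + nat (- m) - 1 = k + n" "Suc k + nat (- m) - 1 = Suc (k + n)" using m by auto
  ultimately show ?thesis using False unfolding comm_coeff_def by (simp only: if_False) (simp add: m algebra_simps)
qed

text \<open>Coefficientwise form of z y' = -m (z / (1 - z)) y, the shape in which the recursion of
  \<open>spoly\<close> produces these coefficients.\<close>

lemma sum_comm_coeff: "m * (\<Sum>j=1..k. comm_coeff m (k - j)) = - int k * comm_coeff m k"
proof -
  have "m * (\<Sum>i<k. comm_coeff m i) = - int k * comm_coeff m k"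
  proof (induction k)
    case (Suc k)
    then show ?case using comm_coeff_Suc [of k m] by (simp add: algebra_simps)
  qed simp
  moreover have "(\<Sum>j=1..k. comm_coeff m (k - j)) = (\<Sum>i<k. comm_coeff m i)"
    by (rule sum.reindex_bij_witness [where i = "\<lambda>i. k - i" and j = "\<lambda>j. k - j"]) auto
  ultimately show ?thesis by simp
qed

section \<open>Expansions of the lattice form and the action of r on s\<close>

lemma lattice_form_sum:
  assumes "finite I" "Poly_Mapping.keys \<alpha> \<subseteq> I" "finite rad_ideal" "Poly_Mapping.keys \<beta> \<subseteq> rad_ideal"
  shows "lattice_form \<alpha> \<beta> = (\<Sum>i\<in>I. \<Sum>j\<in>rad_ideal. Poly_Mapping.lookup \<alpha> i * Poly_Mapping.lookup \<beta> j * cartan i j)"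
proof -
  have "lattice_form \<alpha> \<beta> = (\<Sum>i\<in>Poly_Mapping.keys \<alpha>. \<Sum>j\<in>rad_ideal. Poly_Mapping.lookup \<alpha> i * Poly_Mapping.lookup \<beta> j * cartan i j)"
    unfolding lattice_form_def using assms
    by (intro sum.cong sum.mono_neutral_left) (auto simp: in_keys_iff)
  also have "\<dots> = (\<Sum>i\<in>I. \<Sum>j\<in>rad_ideal. Poly_Mapping.lookup \<alpha> i * Poly_Mapping.lookup \<beta> j * cartan i j)"
    using assms by (intro sum.mono_neutral_left) (auto simp: in_keys_iff)
  finally show ?thesis .
qed

lemma lattice_form_simple_root:
  assumes "finite I" "Poly_Mapping.keys \<alpha> \<subseteq> I"
  shows "lattice_form \<alpha> (simple_root j) = (\<Sum>i\<in>I. Poly_Mapping.lookup \<alpha> i * cartan i j)"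
  using assms by (subst lattice_form_sum [of I _ "{j}"]) (auto simp: simple_root_def)

lemma lattice_form_sum_right:
  "lattice_form \<alpha> \<beta> = (\<Sum>j\<in>Poly_Mapping.keys \<beta>. Poly_Mapping.lookup \<beta> j * lattice_form \<alpha> (simple_root j))"
proof -
  have "lattice_form \<alpha> \<beta> = (\<Sum>j\<in>Poly_Mapping.keys \<beta>. \<Sum>i\<in>Poly_Mapping.keys \<alpha>.
      Poly_Mapping.lookup \<alpha> i * Poly_Mapping.lookup \<beta> j * cartan i j)"
    unfolding lattice_form_def by (rule sum.swap)
  also have "\<dots> = (\<Sum>j\<in>Poly_Mapping.keys \<beta>. Poly_Mapping.lookup \<beta> j * lattice_form \<alpha> (simple_root j))"
    by (intro sum.cong refl)
       (simp add: lattice_form_simple_root [OF finite_keys order.refl] sum_distrib_left mult_ac)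
  finally show ?thesis .
qed

lemma rmap_acoef_mult:
  assumes "j > 0"
  shows "rmap \<alpha> m (acoef \<beta> j * g) = acoef \<beta> j * rmap \<alpha> m g -
     of_int (lattice_form \<alpha> \<beta>) * (if j \<le> m then rmap \<alpha> (m - j) g else 0)"
proof -
  let ?b = "Poly_Mapping.lookup \<beta>" and ?l = "\<lambda>i. lattice_form \<alpha> (simple_root i)"
  let ?G = "if j \<le> m then rmap \<alpha> (m - j) g else 0"
  have "rmap \<alpha> m (acoef \<beta> j * g) = (\<Sum>i\<in>Poly_Mapping.keys \<beta>. rmap \<alpha> m (const (of_int (?b i)) * (gen i j * g)))"
    by (simp add: acoef_def sum_distrib_right const_linear.sum [OF rmap_linear] mult.assoc)
  also have "\<dots> = (\<Sum>i\<in>Poly_Mapping.keys \<beta>. const (of_int (?b i)) * gen i j * rmap \<alpha> m g - of_int (?b i * ?l i) * ?G)"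
    using assms
    by (intro sum.cong refl)
       (simp only: const_linear.scale [OF rmap_linear] rmap_gen_mult, simp add: const_of_int algebra_simps)
  also have "\<dots> = acoef \<beta> j * rmap \<alpha> m g - of_int (\<Sum>i\<in>Poly_Mapping.keys \<beta>. ?b i * ?l i) * ?G"
    by (simp only: sum_subtractf acoef_def sum_distrib_right of_int_sum)
  finally show ?thesis by (simp only: lattice_form_sum_right [of \<alpha> \<beta>])
qed

text \<open>The commutation relation applied to 1. After multiplication by l, the recursion of
  \<open>spoly\<close> gives two sums: by induction the first is l - k times the claimed value, and
  \<open>sum_comm_coeff\<close> makes the second contribute k times it.\<close>

lemma rmap_spoly: "rmap \<alpha> k (spoly \<beta> l) = (if k \<le> l then of_int (comm_coeff (lattice_form \<alpha> \<beta>) k) * spoly \<beta> (l - k) else 0)"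
proof (induction l arbitrary: k rule: less_induct)
  case (less l k)
  let ?m = "lattice_form \<alpha> \<beta>"
  interpret const_linear "rmap \<alpha> i" for i by (rule rmap_linear)
  show ?case
  proof (cases "l = 0")
    case False
    let ?G = "\<lambda>j. if j \<le> k then rmap \<alpha> (k - j) (spoly \<beta> (l - j)) else 0"
    have "of_nat l * rmap \<alpha> k (spoly \<beta> l) = rmap \<alpha> k (of_nat l * spoly \<beta> l)" by (simp add: of_nat)
    also have "\<dots> = (\<Sum>j=1..l. acoef \<beta> j * rmap \<alpha> k (spoly \<beta> (l - j))) - of_int ?m * (\<Sum>j=1..l. ?G j)"
      by (simp add: of_nat_mult_spoly sum rmap_acoef_mult sum_subtractf sum_distrib_left)
    also have "\<dots> = of_nat l * (if k \<le> l then of_int (comm_coeff ?m k) * spoly \<beta> (l - k) else 0)"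
    proof (cases "k \<le> l")
      case True
      have "(\<Sum>j=1..l. acoef \<beta> j * rmap \<alpha> k (spoly \<beta> (l - j))) = (\<Sum>j=1..l. acoef \<beta> j * (if k \<le> l - j then of_int (comm_coeff ?m k) * spoly \<beta> (l - j - k) else 0))"
        using less by (intro sum.cong) auto
      also have "\<dots> = (\<Sum>j=1..l - k. acoef \<beta> j * (of_int (comm_coeff ?m k) * spoly \<beta> (l - k - j)))"
        by (intro sum.mono_neutral_cong_right) (auto simp: add.commute)
      also have "\<dots> = of_int (comm_coeff ?m k) * (of_nat (l - k) * spoly \<beta> (l - k))"
        by (simp add: of_nat_mult_spoly sum_distrib_left mult.left_commute)
      finally have 1: "(\<Sum>j=1..l. acoef \<beta> j * rmap \<alpha> k (spoly \<beta> (l - j))) = of_int (comm_coeff ?m k) * (of_nat (l - k) * spoly \<beta> (l - k))" .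
      have "(\<Sum>j=1..l. ?G j) = (\<Sum>j=1..k. of_int (comm_coeff ?m (k - j)) * spoly \<beta> (l - k))"
        using True less by (intro sum.mono_neutral_cong_right) auto
      then have 2: "of_int ?m * (\<Sum>j=1..l. ?G j) = of_int (?m * (\<Sum>j=1..k. comm_coeff ?m (k - j))) * spoly \<beta> (l - k)"
        by (simp add: sum_distrib_right mult.assoc)
      show ?thesis unfolding 1 2 sum_comm_coeff using True by (simp add: of_nat_diff left_diff_distrib right_diff_distrib mult_ac)
    next
      case False
      then have "(\<Sum>j=1..l. acoef \<beta> j * rmap \<alpha> k (spoly \<beta> (l - j))) = 0" "(\<Sum>j=1..l. ?G j) = 0"
        using less by (auto intro!: sum.neutral)
      then show ?thesis using False by simp
    qed
    finally show ?thesis by (rule of_nat_mult_cancel_symalg [OF False])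
  qed (simp add: rmap_1)
qed

section \<open>The integral form\<close>

lemma group_closure_least:
  assumes "x \<in> group_closure G" "G \<subseteq> T" "0 \<in> T" "\<And>x y. x \<in> T \<Longrightarrow> y \<in> T \<Longrightarrow> x - y \<in> T"
  shows "x \<in> T"
  using assms(1)
proof (induction rule: group_closure.induct)
  case (base s)
  then show ?case using assms(2,3) by auto
next
  case (diff s t)
  then show ?case by (intro assms(4))
qed

lemma group_closure_sum:
  "(\<And>i. i \<in> I \<Longrightarrow> f i \<in> group_closure G) \<Longrightarrow> (\<Sum>i\<in>I. f i) \<in> group_closure G"
  by (induction I rule: infinite_finite_induct) (auto intro: group_closure_add)

text \<open>The generated subring, presented additively by its monomials so that it matches the
  group closure in \<open>VZ\<close>.\<close>

definition gen_subring :: "('i \<Rightarrow> 'a::comm_ring_1) \<Rightarrow> 'i set \<Rightarrow> 'a set" where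
  "gen_subring g I = group_closure {\<Prod>x\<in>#M. g x |M. set_mset M \<subseteq> I}"

lemma gen_subring_prod: "set_mset M \<subseteq> I \<Longrightarrow> (\<Prod>x\<in>#M. g x) \<in> gen_subring g I"
  unfolding gen_subring_def
  by (rule group_closure.base, rule insertI2, rule CollectI, rule exI [of _ M], rule conjI, rule refl)

lemma gen_subring_gen: "x \<in> I \<Longrightarrow> g x \<in> gen_subring g I"
  using gen_subring_prod [of "{#x#}" I g] by simp

lemma gen_subring_0 [simp]: "0 \<in> gen_subring g I"
  unfolding gen_subring_def by (rule zero_in_group_closure)

lemma gen_subring_1 [simp]: "1 \<in> gen_subring g I"
  using gen_subring_prod [of "{#}" I g] by simp

lemma gen_subring_diff: "a \<in> gen_subring g I \<Longrightarrow> b \<in> gen_subring g I \<Longrightarrow> a - b \<in> gen_subring g I"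
  unfolding gen_subring_def by (rule group_closure.diff)

lemma gen_subring_add: "a \<in> gen_subring g I \<Longrightarrow> b \<in> gen_subring g I \<Longrightarrow> a + b \<in> gen_subring g I"
  unfolding gen_subring_def by (rule group_closure_add)

lemma gen_subring_uminus: "a \<in> gen_subring g I \<Longrightarrow> - a \<in> gen_subring g I"
  unfolding gen_subring_def by (subst group_closure_minus_iff)

lemma gen_subring_sum: "(\<And>i. i \<in> rad_ideal \<Longrightarrow> f i \<in> gen_subring g I) \<Longrightarrow> (\<Sum>i\<in>rad_ideal. f i) \<in> gen_subring g I"
  unfolding gen_subring_def by (rule group_closure_sum)

lemma gen_subring_induct [consumes 1, case_names prod zero diff]:
  assumes "a \<in> gen_subring g I" "\<And>M. set_mset M \<subseteq> I \<Longrightarrow> P (\<Prod>x\<in>#M. g x)" "P 0"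
    and "\<And>a b. a \<in> gen_subring g I \<Longrightarrow> b \<in> gen_subring g I \<Longrightarrow> P a \<Longrightarrow> P b \<Longrightarrow> P (a - b)"
  shows "P a"
  using assms(1) unfolding gen_subring_def
proof (induction rule: group_closure.induct)
  case (base s)
  then show ?case using assms(2,3) by auto
next
  case (diff s t)
  then show ?case by (intro assms(4)) (auto simp: gen_subring_def)
qed

lemma gen_subring_mult:
  assumes "a \<in> gen_subring g I" "b \<in> gen_subring g I"
  shows "a * b \<in> gen_subring g I"
  using assms(1)
proof (induction rule: gen_subring_induct)
  case (prod M)
  show ?case using assms(2)
  proof (induction rule: gen_subring_induct)
    case (prod N)
    then show ?case using \<open>set_mset M \<subseteq> I\<close> gen_subring_prod [of "M + N" I g] by simp
  qed (auto simp: right_diff_distrib intro: gen_subring_diff)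
qed (auto simp: left_diff_distrib intro: gen_subring_diff)

lemma gen_subring_of_nat: "of_nat k \<in> gen_subring g I"
  by (induction k) (auto intro: gen_subring_add)

lemma gen_subring_of_int: "of_int k \<in> gen_subring (g :: 'i \<Rightarrow> 'a::comm_ring_1) I"
proof (cases k)
  case (neg n)
  then have "of_int k = - (of_nat (Suc n) :: 'a)" by simp
  then show ?thesis using gen_subring_of_nat gen_subring_uminus by metis
qed (simp add: gen_subring_of_nat)

lemma gen_subring_prod_mem:
  "(\<And>x. x \<in># M \<Longrightarrow> h x \<in> gen_subring g I) \<Longrightarrow> (\<Prod>x\<in>#M. h x) \<in> gen_subring g I"
  by (induction M) (auto intro: gen_subring_mult)

lemma gen_subring_mono:
  assumes "\<And>x. x \<in> I \<Longrightarrow> g x \<in> gen_subring h rad_ideal" "a \<in> gen_subring g I"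
  shows "a \<in> gen_subring h rad_ideal"
  using assms(2)
proof (induction rule: gen_subring_induct)
  case (prod M)
  then show ?case using assms(1) by (intro gen_subring_prod_mem) auto
qed (auto intro: gen_subring_diff)

text \<open>The lattice elements whose vectors s all lie in the ring form a subgroup, by
  \<open>spoly_add\<close> and the division-free recursion \<open>spoly_uminus\<close>.\<close>

lemma spoly_in_gen_subring:
  assumes "\<gamma> \<in> group_closure \<Gamma>" and spoly: "\<And>\<gamma> m. \<gamma> \<in> \<Gamma> \<Longrightarrow> spoly \<gamma> m \<in> gen_subring g I"
  shows "spoly \<gamma> m \<in> gen_subring g I"
proof -
  have add: "spoly (\<alpha> + \<beta>) m \<in> gen_subring g I"
    if "\<And>m. spoly \<alpha> m \<in> gen_subring g I" "\<And>m. spoly \<beta> m \<in> gen_subring g I" for \<alpha> \<beta> m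
    unfolding spoly_add by (intro gen_subring_sum gen_subring_mult that)
  have uminus: "spoly (- \<alpha>) m \<in> gen_subring g I" if "\<And>m. spoly \<alpha> m \<in> gen_subring g I" for \<alpha> m
  proof (induction m rule: less_induct)
    case (less m)
    show ?case
    proof (cases "m = 0")
      case False
      then show ?thesis
        by (subst spoly_uminus) (auto intro!: gen_subring_uminus gen_subring_sum gen_subring_mult that less)
    qed simp
  qed
  have "\<gamma> \<in> {\<gamma>. \<forall>m. spoly \<gamma> m \<in> gen_subring g I}"
    using assms(1)
  proof (rule group_closure_least)
    fix x y assume "x \<in> {\<gamma>. \<forall>m. spoly \<gamma> m \<in> gen_subring g I}" "y \<in> {\<gamma>. \<forall>m. spoly \<gamma> m \<in> gen_subring g I}"
    then show "x - y \<in> {\<gamma>. \<forall>m. spoly \<gamma> m \<in> gen_subring g I}"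
      using add [of x "- y"] uminus [of y] by simp
  qed (auto simp: spoly_zero spoly)
  then show ?thesis by simp
qed

lemma rmap_in_gen_subring:
  assumes "a \<in> gen_subring g I" and rmap: "\<And>x k. x \<in> I \<Longrightarrow> rmap \<alpha> k (g x) \<in> gen_subring g I"
  shows "rmap \<alpha> k a \<in> gen_subring g I"
  using assms(1)
proof (induction arbitrary: k rule: gen_subring_induct)
  case (prod M)
  then show ?case
  proof (induction M arbitrary: k)
    case empty
    then show ?case by (simp add: rmap_1)
  next
    case (add x M)
    then show ?case
      by (auto simp: rmap_mult intro!: gen_subring_sum gen_subring_mult rmap)
  qed
next
  case zero
  then show ?case by (simp add: const_linear.zero [OF rmap_linear])
next
  case (diff a b)
  have "rmap \<alpha> k (a - b) = rmap \<alpha> k a - rmap \<alpha> k b"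
    using const_linear.add [OF rmap_linear, of \<alpha> k "a - b" b] by (simp add: algebra_simps)
  then show ?case using diff by (auto intro: gen_subring_diff)
qed

section \<open>The root lattice and its basis eta, alpha_2, ..., alpha_n\<close>

lemma lookup_eta: "Poly_Mapping.lookup (eta n) k = (if k \<in> {1..n} then int k else 0)"
  by (auto simp: eta_def lookup_sum lookup_single when_def)

lemma root_lattice_uminus: "\<alpha> \<in> root_lattice n \<Longrightarrow> - \<alpha> \<in> root_lattice n"
  by (auto simp: root_lattice_def in_keys_iff)

lemma simple_root_in_root_lattice: "i \<in> {1..n} \<Longrightarrow> simple_root i \<in> root_lattice n"
  by (simp add: root_lattice_def simple_root_def)

lemma eta_in_root_lattice: "eta n \<in> root_lattice n"
  by (auto simp: root_lattice_def in_keys_iff lookup_eta split: if_splits)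

lemma single_in_group_closure:
  assumes "simple_root i \<in> group_closure G"
  shows "Poly_Mapping.single i c \<in> group_closure G"
proof -
  have nat: "Poly_Mapping.single i (int k) \<in> group_closure G" for k
    using assms by (induction k) (auto simp: simple_root_def single_add intro: group_closure_add)
  show ?thesis
  proof (cases c)
    case (neg k)
    have "Poly_Mapping.single i c = - Poly_Mapping.single i (int (Suc k))"
      by (simp add: neg flip: single_uminus)
    then show ?thesis using nat [of "Suc k"] group_closure_minus_iff by metis
  qed (use nat in simp)
qed

lemma root_lattice_subset_group_closure:
  assumes "\<alpha> \<in> root_lattice n" "\<And>i. i \<in> {1..n} \<Longrightarrow> simple_root i \<in> group_closure G"
  shows "\<alpha> \<in> group_closure G"
  by (subst poly_mapping_sum_singles)
     (use assms in \<open>auto intro!: group_closure_sum single_in_group_closure simp: root_lattice_def\<close>)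

text \<open>
  As \<open>eta n\<close> has coefficient 1 at the first simple root, it can replace this root in the basis
  of the lattice. The index 0 stands for \<open>eta n\<close>.
\<close>

definition color :: "nat \<Rightarrow> nat \<Rightarrow> lattice" where
  "color n i = (if i = 0 then eta n else simple_root i)"

definition colors :: "nat \<Rightarrow> nat set" where
  "colors n = insert 0 {2..n}"

lemma color_in_root_lattice: "i \<in> colors n \<Longrightarrow> color n i \<in> root_lattice n"
  by (auto simp: color_def colors_def eta_in_root_lattice intro: simple_root_in_root_lattice)

lemma root_lattice_subset_colors:
  assumes "\<alpha> \<in> root_lattice n"
  shows "\<alpha> \<in> group_closure (color n ` colors n)"
  using assms
proof (rule root_lattice_subset_group_closure)
  let ?G = "group_closure (color n ` colors n)"
  have ge2: "simple_root i \<in> ?G" if "i \<in> {2..n}" for i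
  proof -
    have "simple_root i = color n i" using that by (simp add: color_def)
    then show ?thesis using that by (auto simp: colors_def intro!: group_closure.base)
  qed
  fix i assume i: "i \<in> {1..n}"
  show "simple_root i \<in> ?G"
  proof (cases "i = 1")
    case True
    have "{1..n} = insert 1 {2..n}" using i by auto
    then have "eta n = simple_root 1 + (\<Sum>i=2..n. Poly_Mapping.single i (int i))"
      unfolding eta_def by (simp add: simple_root_def)
    then have "simple_root 1 = eta n - (\<Sum>i=2..n. Poly_Mapping.single i (int i))" by simp
    moreover have "eta n \<in> ?G" by (auto simp: colors_def color_def intro!: group_closure.base)
    ultimately show ?thesis
      using True ge2 by (auto intro!: group_closure.diff group_closure_sum single_in_group_closure)
  qed (use i ge2 in auto)
qed

definition gcolor :: "nat \<Rightarrow> nat \<times> nat \<Rightarrow> symalg" where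
  "gcolor n = (\<lambda>(i, m). spoly (color n i) m)"

definition gsimple :: "nat \<times> nat \<Rightarrow> symalg" where
  "gsimple = (\<lambda>(i, m). spoly (simple_root i) m)"

text \<open>Integral form of the symmetric algebra: \<open>VZ n\<close> consists of the finite sums
  of terms with coefficient in \<open>SA n\<close> at lattice elements of
  \<open>root_lattice n\<close>.\<close>

definition SA :: "nat \<Rightarrow> symalg set" where
  "SA n = gen_subring gsimple ({1..n} \<times> {1..})"

lemma spoly_in_SA: "\<alpha> \<in> root_lattice n \<Longrightarrow> spoly \<alpha> m \<in> SA n"
  unfolding SA_def
proof (rule spoly_in_gen_subring)
  assume "\<alpha> \<in> root_lattice n"
  then show "\<alpha> \<in> group_closure (simple_root ` {1..n})"
    by (rule root_lattice_subset_group_closure) (auto intro: group_closure.base)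
  show "spoly \<gamma> m \<in> gen_subring gsimple ({1..n} \<times> {1..})" if "\<gamma> \<in> simple_root ` {1..n}" for \<gamma> m
    using that gen_subring_gen [of "(_, m)" "{1..n} \<times> {1..}" gsimple]
    by (cases "m = 0") (auto simp: gsimple_def)
qed

text \<open>Both families come from generating sets of the same lattice, so each is integral over
  the other in the sense of \<open>spoly_in_gen_subring\<close>. This makes the s_(eta,m) part of a
  set of ring generators.\<close>

lemma SA_eq_gcolor: "SA n = gen_subring (gcolor n) (colors n \<times> {1..})"
proof (intro equalityI subsetI)
  fix a assume "a \<in> SA n"
  moreover have spoly: "spoly \<alpha> m \<in> gen_subring (gcolor n) (colors n \<times> {1..})" if "\<alpha> \<in> root_lattice n" for \<alpha> m
    using root_lattice_subset_colors [OF that]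
  proof (rule spoly_in_gen_subring)
    fix \<gamma> m assume "\<gamma> \<in> color n ` colors n"
    then show "spoly \<gamma> m \<in> gen_subring (gcolor n) (colors n \<times> {1..})"
      using gen_subring_gen [of "(_, m)" "colors n \<times> {1..}" "gcolor n"]
      by (cases "m = 0") (auto simp: gcolor_def)
  qed
  ultimately show "a \<in> gen_subring (gcolor n) (colors n \<times> {1..})"
    unfolding SA_def
  proof (elim gen_subring_mono [rotated])
    fix x :: "nat \<times> nat"
    assume x: "x \<in> {1..n} \<times> {1..}"
    then have "simple_root (fst x) \<in> root_lattice n" by (intro simple_root_in_root_lattice) auto
    then show "gsimple x \<in> gen_subring (gcolor n) (colors n \<times> {1..})"
      using spoly by (simp add: gsimple_def case_prod_beta)
  qed
next
  fix a assume "a \<in> gen_subring (gcolor n) (colors n \<times> {1..})"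
  moreover have "gcolor n x \<in> gen_subring gsimple ({1..n} \<times> {1..})" if "x \<in> colors n \<times> {1..}" for x
    using that spoly_in_SA [OF color_in_root_lattice] by (auto simp: gcolor_def SA_def)
  ultimately show "a \<in> SA n" unfolding SA_def by (rule gen_subring_mono [rotated])
qed

lemmas SA_0 = gen_subring_0 [of gsimple "{1..n} \<times> {1..}", folded SA_def] for n
lemmas SA_1 = gen_subring_1 [of gsimple "{1..n} \<times> {1..}", folded SA_def] for n
lemmas SA_diff = gen_subring_diff [of _ gsimple "{1..n} \<times> {1..}", folded SA_def] for n
lemmas SA_add = gen_subring_add [of _ gsimple "{1..n} \<times> {1..}", folded SA_def] for n
lemmas SA_mult = gen_subring_mult [of _ gsimple "{1..n} \<times> {1..}", folded SA_def] for n
lemmas SA_of_nat = gen_subring_of_nat [of _ gsimple "{1..n} \<times> {1..}", folded SA_def] for n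
lemmas SA_of_int = gen_subring_of_int [of _ gsimple "{1..n} \<times> {1..}", folded SA_def] for n
lemmas SA_sum = gen_subring_sum [of _ _ gsimple "{1..n} \<times> {1..}", folded SA_def] for n
lemmas SA_prod = gen_subring_prod_mem [of _ _ gsimple "{1..n} \<times> {1..}", folded SA_def] for n

lemma rmap_in_SA: "a \<in> SA n \<Longrightarrow> rmap \<alpha> k a \<in> SA n"
proof -
  have "rmap \<alpha> k (gsimple x) \<in> SA n" if "x \<in> {1..n} \<times> {1..}" for x k
  proof -
    have "simple_root (fst x) \<in> root_lattice n"
      using that by (intro simple_root_in_root_lattice) auto
    then have "of_int c * spoly (simple_root (fst x)) j \<in> SA n" for c j
      by (intro SA_mult SA_of_int spoly_in_SA)
    then show ?thesis by (simp add: gsimple_def case_prod_beta rmap_spoly SA_0)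
  qed
  then show "a \<in> SA n \<Longrightarrow> rmap \<alpha> k a \<in> SA n"
    unfolding SA_def by (rule rmap_in_gen_subring [rotated])
qed

section \<open>The operators s and r on the integral form of V_L\<close>

lemma s_op_eq: "s_op \<alpha> m v = Poly_Mapping.single 0 (spoly \<alpha> m) * v"
proof -
  have "exp_coeff (\<lambda>j f. const (1 / of_nat j) * creation \<alpha> j f) m = (*) (spoly \<alpha> m)"
    by (rule ext) (rule exp_coeff_creation)
  then show ?thesis by (simp add: s_op_def flip: mult_map_scale_conv_mult)
qed

lemma r_op_eq: "r_op \<alpha> m = Poly_Mapping.map (rmap \<alpha> m)"
  by (simp add: r_op_def rmap_def)

lemma s_op_single: "s_op \<alpha> m (Poly_Mapping.single \<beta> f) = Poly_Mapping.single \<beta> (spoly \<alpha> m * f)"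
  by (simp add: s_op_eq mult_single)

lemma r_op_single: "r_op \<alpha> m (Poly_Mapping.single \<beta> f) = Poly_Mapping.single \<beta> (rmap \<alpha> m f)"
  by (simp add: r_op_eq const_linear.zero [OF rmap_linear])

lemma s_op_add: "s_op \<alpha> m (u + v) = s_op \<alpha> m u + s_op \<alpha> m v"
  by (simp add: s_op_eq distrib_left)

lemma r_op_add: "r_op \<alpha> m (u + v) = r_op \<alpha> m u + r_op \<alpha> m v"
  by (rule poly_mapping_eqI)
     (auto simp: r_op_eq Poly_Mapping.map.rep_eq lookup_add when_def
       const_linear.zero [OF rmap_linear] const_linear.add [OF rmap_linear] simp flip: const_linear.add [OF rmap_linear])

lemma s_word_s_op:
  "s_word s_op w (Poly_Mapping.single \<beta> f) = Poly_Mapping.single \<beta> ((\<Prod>x\<in>#mset w. gsimple x) * f)"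
  by (induction w) (auto simp: s_word_def s_op_single gsimple_def mult.assoc)

lemma s_word_iota: "s_word s_op w (iota \<beta>) = Poly_Mapping.single \<beta> (\<Prod>x\<in>#mset w. gsimple x)"
  by (simp add: iota_def s_word_s_op)

lemma group_closure_single:
  assumes "\<alpha> \<in> A" "a \<in> group_closure G"
  shows "Poly_Mapping.single \<alpha> a \<in> group_closure {Poly_Mapping.single \<alpha> a |\<alpha> a. \<alpha> \<in> A \<and> a \<in> G}"
  using assms(2)
proof (induction rule: group_closure.induct)
  case (base s)
  then show ?case using assms(1) by (auto intro!: group_closure.base)
qed (auto simp: single_diff intro: group_closure.diff)

text \<open>The operators s are multiplications and commute, so a word matters only as the multiset
  of its letters.\<close>

lemma VZ_eq: "VZ n = group_closure {Poly_Mapping.single \<alpha> a |\<alpha> a.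
    \<alpha> \<in> root_lattice n \<and> a \<in> {\<Prod>x\<in>#M. gsimple x |M. set_mset M \<subseteq> {1..n} \<times> {1..}}}"
proof -
  have "{s_word s_op w (iota \<alpha>) |w \<alpha>. set w \<subseteq> {1..n} \<times> {1..} \<and> \<alpha> \<in> root_lattice n} =
      {Poly_Mapping.single \<alpha> a |\<alpha> a. \<alpha> \<in> root_lattice n \<and>
        a \<in> {\<Prod>x\<in>#M. gsimple x |M. set_mset M \<subseteq> {1..n} \<times> {1..}}}"
    unfolding s_word_iota
  proof (intro equalityI subsetI; elim CollectE exE conjE)
    fix x w \<alpha>
    assume "x = Poly_Mapping.single \<alpha> (\<Prod>x\<in>#mset w. gsimple x)"
      "set w \<subseteq> {1..n} \<times> {1..}" "\<alpha> \<in> root_lattice n"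
    then show "x \<in> {Poly_Mapping.single \<alpha> a |\<alpha> a. \<alpha> \<in> root_lattice n \<and>
        a \<in> {\<Prod>x\<in>#M. gsimple x |M. set_mset M \<subseteq> {1..n} \<times> {1..}}}"
      by (intro CollectI exI conjI) (assumption, assumption, rule refl, simp)
  next
    fix x \<alpha> a M
    assume *: "x = Poly_Mapping.single \<alpha> a" "\<alpha> \<in> root_lattice n"
      "a = (\<Prod>x\<in>#M. gsimple x)" "set_mset M \<subseteq> {1..n} \<times> {1..}"
    obtain w where "mset w = M" using ex_mset by blast
    with * have "x = Poly_Mapping.single \<alpha> (\<Prod>x\<in>#mset w. gsimple x)" "set w \<subseteq> {1..n} \<times> {1..}"
      by auto
    with * show "x \<in> {Poly_Mapping.single \<beta> (\<Prod>x\<in>#mset w. gsimple x) |w \<beta>.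
        set w \<subseteq> {1..n} \<times> {1..} \<and> \<beta> \<in> root_lattice n}"
      by (intro CollectI exI conjI) assumption+
  qed
  then show ?thesis unfolding VZ_def by (rule arg_cong)
qed

lemma single_in_VZ: "\<alpha> \<in> root_lattice n \<Longrightarrow> a \<in> SA n \<Longrightarrow> Poly_Mapping.single \<alpha> a \<in> VZ n"
  unfolding VZ_eq SA_def gen_subring_def by (rule group_closure_single)

lemma VZ_0 [simp]: "0 \<in> VZ n" unfolding VZ_def by (rule zero_in_group_closure)
lemma VZ_diff: "u \<in> VZ n \<Longrightarrow> v \<in> VZ n \<Longrightarrow> u - v \<in> VZ n" unfolding VZ_def by (rule group_closure.diff)
lemma VZ_induct [consumes 1, case_names single zero diff]:
  assumes "v \<in> VZ n"
    and "\<And>\<alpha> M. \<alpha> \<in> root_lattice n \<Longrightarrow> set_mset M \<subseteq> {1..n} \<times> {1..} \<Longrightarrow> P (Poly_Mapping.single \<alpha> (\<Prod>x\<in>#M. gsimple x))"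
    and "P 0"
    and "\<And>u v. u \<in> VZ n \<Longrightarrow> v \<in> VZ n \<Longrightarrow> P u \<Longrightarrow> P v \<Longrightarrow> P (u - v)"
  shows "P v"
  using assms(1) unfolding VZ_eq
proof (induction rule: group_closure.induct)
  case (base s)
  then show ?case using assms(2,3) by auto
next
  case (diff s t)
  then show ?case by (intro assms(4)) (auto simp: VZ_eq)
qed

lemma VZ_induct_SA [consumes 1, case_names single zero diff]:
  assumes "v \<in> VZ n"
    and "\<And>\<alpha> a. \<alpha> \<in> root_lattice n \<Longrightarrow> a \<in> SA n \<Longrightarrow> P (Poly_Mapping.single \<alpha> a)"
    and "P 0"
    and "\<And>u v. u \<in> VZ n \<Longrightarrow> v \<in> VZ n \<Longrightarrow> P u \<Longrightarrow> P v \<Longrightarrow> P (u - v)"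
  shows "P v"
  using assms(1)
proof (induction rule: VZ_induct)
  case (single \<alpha> M)
  show ?case
    by (rule assms(2)) (use single gen_subring_prod in \<open>auto simp: SA_def\<close>)
next
  case zero
  show ?case by (rule assms(3))
next
  case (diff u v)
  then show ?case by (intro assms(4))
qed

lemma s_op_diff: "s_op \<alpha> m (u - v) = s_op \<alpha> m u - s_op \<alpha> m v"
  by (simp add: s_op_eq right_diff_distrib)

lemma r_op_diff: "r_op \<alpha> m (u - v) = r_op \<alpha> m u - r_op \<alpha> m v"
  using r_op_add [of \<alpha> m "u - v" v] by simp

lemma s_op_in_VZ: "v \<in> VZ n \<Longrightarrow> \<alpha> \<in> root_lattice n \<Longrightarrow> s_op \<alpha> m v \<in> VZ n"
  by (induction rule: VZ_induct_SA)
     (auto simp: s_op_single s_op_diff intro!: single_in_VZ SA_mult spoly_in_SA VZ_diff, simp add: s_op_eq)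

lemma r_op_in_VZ: "v \<in> VZ n \<Longrightarrow> r_op \<alpha> m v \<in> VZ n"
  by (induction rule: VZ_induct_SA)
     (auto simp: r_op_single r_op_diff intro!: single_in_VZ rmap_in_SA VZ_diff, use r_op_diff [of \<alpha> m 0 0] in simp)

section \<open>Extension of scalars\<close>

locale add_subgroup =
  fixes A :: "'v::ab_group_add set"
  assumes zero_mem: "0 \<in> A"
    and diff_mem: "u \<in> A \<Longrightarrow> v \<in> A \<Longrightarrow> u - v \<in> A"
begin

lemma uminus_mem: "v \<in> A \<Longrightarrow> - v \<in> A"
  using diff_mem [OF zero_mem, of v] by simp

lemma add_mem: "u \<in> A \<Longrightarrow> v \<in> A \<Longrightarrow> u + v \<in> A"
  using diff_mem [of u "- v"] uminus_mem [of v] by simp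

lemma keys_diff_subset:
  "Poly_Mapping.keys x \<subseteq> X \<Longrightarrow> Poly_Mapping.keys y \<subseteq> X \<Longrightarrow> Poly_Mapping.keys (x - y) \<subseteq> X"
  for x y :: "'c \<Rightarrow>\<^sub>0 int"
  using keys_diff [of x y] by blast

lemma tensor_rels_subset: "(tensor_rels A :: (('v \<times> 'f::field) \<Rightarrow>\<^sub>0 int) set) \<subseteq> carrier (tensor_free A)"
proof
  fix x :: "'v \<times> 'f \<Rightarrow>\<^sub>0 int"
  assume "x \<in> tensor_rels A"
  then have "Poly_Mapping.keys x \<subseteq> A \<times> UNIV"
    unfolding tensor_rels_def
    by (elim UnE CollectE exE conjE; simp only:; intro keys_diff_subset) (auto simp: keys_frag_of add_mem)
  then show "x \<in> carrier (tensor_free A)" by (simp add: tensor_free_def)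
qed

lemma comm_group_free: "comm_group (tensor_free A :: (('v \<times> 'f::field) \<Rightarrow>\<^sub>0 int) monoid)"
  unfolding tensor_free_def by (rule abelian_free_Abelian_group)

lemma subgroup_null: "subgroup (tensor_null A) (tensor_free A :: (('v \<times> 'f::field) \<Rightarrow>\<^sub>0 int) monoid)"
  unfolding tensor_null_def
  by (intro group.generate_is_subgroup comm_group.axioms comm_group_free tensor_rels_subset)

lemma normal_null: "tensor_null A \<lhd> (tensor_free A :: (('v \<times> 'f::field) \<Rightarrow>\<^sub>0 int) monoid)"
  by (intro comm_group.subgroup_imp_normal comm_group_free subgroup_null)

lemma comm_group_tensor: "comm_group (tensor A :: ('v, 'f::field) tens monoid)"
  unfolding tensor_def by (intro comm_group.abelian_FactGroup comm_group_free subgroup_null)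

definition coset :: "(('v \<times> 'f::field) \<Rightarrow>\<^sub>0 int) \<Rightarrow> ('v, 'f) tens" where
  "coset x = tensor_null A #>\<^bsub>tensor_free A\<^esub> x"

lemma coset_eq: "coset x = (\<lambda>h. h + x) ` tensor_null A"
  by (auto simp: coset_def r_coset_def tensor_free_def)

lemma null_zero: "0 \<in> tensor_null A"
  using subgroup.one_closed [OF subgroup_null] by (simp add: tensor_free_def)

lemma null_add: "x \<in> tensor_null A \<Longrightarrow> y \<in> tensor_null A \<Longrightarrow> x + y \<in> tensor_null A"
  using subgroup.m_closed [OF subgroup_null, of x y] by (simp add: tensor_free_def)

lemma null_keys: "x \<in> tensor_null A \<Longrightarrow> Poly_Mapping.keys x \<subseteq> A \<times> UNIV"
  using subgroup.mem_carrier [OF subgroup_null, of x] by (simp add: tensor_free_def)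

lemma null_uminus: "x \<in> tensor_null A \<Longrightarrow> - x \<in> tensor_null A"
  using subgroup.m_inv_closed [OF subgroup_null, of x] null_keys [of x] by (simp add: tensor_free_def)

lemma null_induct [consumes 1, case_names zero rel add uminus]:
  assumes "x \<in> tensor_null A" "P 0" "\<And>x. x \<in> tensor_rels A \<Longrightarrow> P x"
    "\<And>x y. P x \<Longrightarrow> P y \<Longrightarrow> P (x + y)" "\<And>x. P x \<Longrightarrow> P (- x)"
  shows "P x"
  using assms(1) unfolding tensor_null_def
proof (induction rule: generate.induct)
  case one
  then show ?case using assms(2) by (simp add: tensor_free_def)
next
  case (incl h)
  then show ?case by (rule assms(3))
next
  case (inv h)
  then show ?case
    using assms(3,5) tensor_rels_subset by (auto simp: tensor_free_def subset_iff)
next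
  case (eng h1 h2)
  then show ?case using assms(4) by (simp add: tensor_free_def)
qed

lemma coset_eqI: "x - y \<in> tensor_null A \<Longrightarrow> coset x = coset y"
proof -
  have sub: "coset x \<subseteq> coset y" if "x - y \<in> tensor_null A" for x y
  proof
    fix z assume "z \<in> coset x"
    then obtain h where "h \<in> tensor_null A" "z = h + x" by (auto simp: coset_eq)
    then have "h + (x - y) \<in> tensor_null A" "z = (h + (x - y)) + y"
      using null_add that by simp_all
    then show "z \<in> coset y" unfolding coset_eq by blast
  qed
  assume "x - y \<in> tensor_null A"
  then show ?thesis using sub [of x y] sub [of y x] null_uminus [of "x - y"] by simp
qed

lemma tensor_carrier: "X \<in> carrier (tensor A) \<longleftrightarrow> (\<exists>x. Poly_Mapping.keys x \<subseteq> A \<times> UNIV \<and> X = coset x)"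
proof -
  have "X \<in> carrier (tensor A) \<longleftrightarrow> X \<in> coset ` carrier (tensor_free A)"
    by (simp add: tensor_def carrier_FactGroup coset_def [abs_def])
  then show ?thesis unfolding image_iff tensor_free_def by (simp add: Bex_def)
qed

lemma coset_carrier: "Poly_Mapping.keys x \<subseteq> A \<times> UNIV \<Longrightarrow> coset x \<in> carrier (tensor A)"
  unfolding tensor_carrier by blast

lemma coset_mult:
  "Poly_Mapping.keys x \<subseteq> A \<times> UNIV \<Longrightarrow> Poly_Mapping.keys y \<subseteq> A \<times> UNIV \<Longrightarrow>
   coset x \<otimes>\<^bsub>tensor A\<^esub> coset y = coset (x + y)"
  using normal.rcos_sum [OF normal_null, of x y] by (simp add: tensor_def coset_def tensor_free_def)

lemma coset_zero: "coset 0 = \<one>\<^bsub>tensor A\<^esub>"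
  by (simp add: tensor_def coset_eq)

lemma pure_eq_coset: "pure_tensor A v c = coset (frag_of (v, c))"
  by (simp add: pure_tensor_def coset_def)

lemma pure_carrier: "v \<in> A \<Longrightarrow> pure_tensor A v c \<in> carrier (tensor A)"
  unfolding pure_eq_coset by (rule coset_carrier) (simp add: keys_frag_of)

lemma pure_add_left:
  assumes "u \<in> A" "v \<in> A"
  shows "pure_tensor A (u + v) c = pure_tensor A u c \<otimes>\<^bsub>tensor A\<^esub> pure_tensor A v c"
proof -
  have "frag_of (u + v, c) - (frag_of (u, c) + frag_of (v, c)) \<in> tensor_rels A"
    unfolding tensor_rels_def diff_diff_eq [symmetric] using assms by blast
  then have "frag_of (u + v, c) - (frag_of (u, c) + frag_of (v, c)) \<in> tensor_null A"
    unfolding tensor_null_def by (rule generate.incl)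
  then show ?thesis
    using assms by (simp add: pure_eq_coset coset_mult keys_frag_of coset_eqI)
qed

lemma pure_add_right:
  assumes "v \<in> A"
  shows "pure_tensor A v (c + d) = pure_tensor A v c \<otimes>\<^bsub>tensor A\<^esub> pure_tensor A v d"
proof -
  have "frag_of (v, c + d) - (frag_of (v, c) + frag_of (v, d)) \<in> tensor_rels A"
    unfolding tensor_rels_def diff_diff_eq [symmetric] using assms by blast
  then have "frag_of (v, c + d) - (frag_of (v, c) + frag_of (v, d)) \<in> tensor_null A"
    unfolding tensor_null_def by (rule generate.incl)
  then show ?thesis
    using assms by (simp add: pure_eq_coset coset_mult keys_frag_of coset_eqI)
qed

lemma group_tensor: "group (tensor A :: ('v, 'f::field) tens monoid)"
  using comm_group_tensor comm_group.axioms(2) by blast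

lemma pure_zero_right: "v \<in> A \<Longrightarrow> pure_tensor A v (0 :: 'f::field) = \<one>\<^bsub>tensor A\<^esub>"
  using pure_add_right [of v 0 "0 :: 'f"] group.l_cancel_one' [OF group_tensor] pure_carrier
  by (metis add_0)

lemma pure_zero_left: "pure_tensor A 0 (c :: 'f::field) = \<one>\<^bsub>tensor A\<^esub>"
  using pure_add_left [OF zero_mem zero_mem, of c] group.l_cancel_one' [OF group_tensor]
    pure_carrier [OF zero_mem] by (metis add_0)

lemma pure_uminus_left: "v \<in> A \<Longrightarrow> pure_tensor A (- v) (c :: 'f::field) = inv\<^bsub>tensor A\<^esub> pure_tensor A v c"
  using pure_add_left [of "- v" v c] pure_zero_left [of c]
    group.inv_equality [OF group_tensor _ pure_carrier pure_carrier] uminus_mem [of v]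
  by (metis add.left_inverse)

lemma pure_diff_left:
  "u \<in> A \<Longrightarrow> v \<in> A \<Longrightarrow> pure_tensor A (u - v) (c :: 'f::field) =
   pure_tensor A u c \<otimes>\<^bsub>tensor A\<^esub> inv\<^bsub>tensor A\<^esub> pure_tensor A v c"
  using pure_add_left [of u "- v" c] by (simp add: uminus_mem pure_uminus_left)

text \<open>With k the characteristic, the scalar on the right is 0: this is how multiples of p
  disappear in the tensor product.\<close>

lemma pure_of_nat: "v \<in> A \<Longrightarrow> pure_tensor A ((\<Sum>i<k. v) :: 'v) (c :: 'f::field) = pure_tensor A v (of_nat k * c)"
proof (induction k)
  case (Suc k)
  have "(\<Sum>i<k. v) \<in> A" by (induction k) (auto simp: Suc.prems intro: add_mem zero_mem)
  then show ?case
    using Suc by (simp add: pure_add_left distrib_right pure_add_right comm_monoid.m_comm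
      [OF comm_group.axioms(1) [OF comm_group_tensor]] pure_carrier)
qed (simp add: pure_zero_left pure_zero_right)

lemma tensor_induct [consumes 1, case_names one pure mult]:
  fixes X :: "('v, 'f::field) tens"
  assumes "X \<in> carrier (tensor A)"
    and one: "P \<one>\<^bsub>tensor A\<^esub>"
    and pure: "\<And>v c. v \<in> A \<Longrightarrow> P (pure_tensor A v c)"
    and mult: "\<And>X Y. X \<in> carrier (tensor A) \<Longrightarrow> Y \<in> carrier (tensor A) \<Longrightarrow> P X \<Longrightarrow> P Y \<Longrightarrow> P (X \<otimes>\<^bsub>tensor A\<^esub> Y)"
  shows "P X"
proof -
  have color_step: "P (coset (x + y))" if "Poly_Mapping.keys x \<subseteq> A \<times> UNIV" "Poly_Mapping.keys y \<subseteq> A \<times> UNIV"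
    "P (coset x)" "P (coset y)" for x y
    using mult [of "coset x" "coset y"] that by (simp add: coset_mult coset_carrier)
  obtain x where x: "Poly_Mapping.keys x \<subseteq> A \<times> UNIV" "X = coset x"
    using assms(1) tensor_carrier by blast
  \<comment> \<open>The induction principle for free abelian groups proceeds by differences, so the
    claim is carried for x and -x together.\<close>
  have "P (coset x) \<and> P (coset (- x))"
    using x(1)
  proof (rule free_Abelian_group_induct)
    show "P (coset 0) \<and> P (coset (- 0))" using one by (simp add: coset_zero)
  next
    fix x y :: "'v \<times> 'f \<Rightarrow>\<^sub>0 int"
    assume *: "Poly_Mapping.keys x \<subseteq> A \<times> UNIV" "Poly_Mapping.keys y \<subseteq> A \<times> UNIV"
      "P (coset x) \<and> P (coset (- x))" "P (coset y) \<and> P (coset (- y))"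
    then show "P (coset (x - y)) \<and> P (coset (- (x - y)))"
      using color_step [of x "- y"] color_step [of "- x" y] by simp
  next
    fix a assume a: "a \<in> A \<times> (UNIV :: 'f set)"
    then obtain v c where vc: "a = (v, c)" "v \<in> A" by auto
    have "coset (frag_of (v, c)) \<otimes>\<^bsub>tensor A\<^esub> coset (- frag_of (v, c)) = \<one>\<^bsub>tensor A\<^esub>"
      using vc by (subst coset_mult) (auto simp: keys_frag_of coset_zero)
    moreover have "coset (- frag_of (v, c)) \<in> carrier (tensor A)"
      using vc by (intro coset_carrier) (simp add: keys_frag_of)
    ultimately have "coset (- frag_of (v, c)) = pure_tensor A (- v) c"
      using vc pure_carrier [of v c] by (metis pure_uminus_left pure_eq_coset group.inv_equality [OF group_tensor]
        comm_monoid.m_comm [OF comm_group.axioms(1) [OF comm_group_tensor]])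
    then show "P (coset (frag_of a)) \<and> P (coset (- frag_of a))"
      using pure [of v c] pure [of "- v" c] vc uminus_mem by (simp add: pure_eq_coset)
  qed
  then show ?thesis using x by simp
qed

text \<open>The relations go to null elements, hence so does the whole null subgroup, and the union
  in \<open>tensor_induced\<close> runs over equal cosets.\<close>

lemma induced_coset:
  fixes \<phi> :: "'v \<times> 'f::field \<Rightarrow> 'v \<times> 'f"
  assumes rel: "\<And>x. x \<in> tensor_rels A \<Longrightarrow> frag_extend (\<lambda>y. frag_of (\<phi> y)) x \<in> tensor_null A"
  shows "tensor_induced A \<phi> (coset x) = coset (frag_extend (\<lambda>y. frag_of (\<phi> y)) x)"
proof -
  let ?F = "frag_extend (\<lambda>y. frag_of (\<phi> y))"
  have null: "?F h \<in> tensor_null A" if "h \<in> tensor_null A" for h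
    using that by (induction rule: null_induct)
      (auto simp: frag_extend_add frag_extend_minus null_zero null_add null_uminus rel)
  have "coset (?F y) = coset (?F x)" if "y \<in> coset x" for y
    using that null by (auto simp: coset_eq [of x] frag_extend_add intro!: coset_eqI)
  then have "(\<Union>y\<in>coset x. coset (?F y)) = (\<Union>y\<in>coset x. coset (?F x))"
    by (rule SUP_cong [OF refl])
  moreover have "x \<in> coset x" using null_zero by (force simp: coset_eq)
  ultimately have "(\<Union>y\<in>coset x. coset (?F y)) = coset (?F x)" by blast
  then show ?thesis by (simp only: tensor_induced_def coset_def)
qed

lemma induced_pure:
  fixes \<phi> :: "'v \<times> 'f::field \<Rightarrow> 'v \<times> 'f"
  assumes "\<And>x. x \<in> tensor_rels A \<Longrightarrow> frag_extend (\<lambda>y. frag_of (\<phi> y)) x \<in> tensor_null A"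
  shows "tensor_induced A \<phi> (pure_tensor A v c) = pure_tensor A (fst (\<phi> (v, c))) (snd (\<phi> (v, c)))"
  using assms by (simp add: pure_eq_coset induced_coset)

lemma induced_hom:
  fixes \<phi> :: "'v \<times> 'f::field \<Rightarrow> 'v \<times> 'f"
  assumes rel: "\<And>x. x \<in> tensor_rels A \<Longrightarrow> frag_extend (\<lambda>y. frag_of (\<phi> y)) x \<in> tensor_null A"
    and closed: "\<And>v c. v \<in> A \<Longrightarrow> fst (\<phi> (v, c)) \<in> A"
  shows "tensor_induced A \<phi> \<in> hom (tensor A) (tensor A)"
proof -
  let ?F = "frag_extend (\<lambda>y. frag_of (\<phi> y))"
  have keys: "Poly_Mapping.keys (?F x) \<subseteq> A \<times> UNIV" if "Poly_Mapping.keys x \<subseteq> A \<times> UNIV" for x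
  proof
    fix z assume "z \<in> Poly_Mapping.keys (?F x)"
    then have "z \<in> (\<Union>y\<in>Poly_Mapping.keys x. Poly_Mapping.keys (frag_of (\<phi> y)))"
      by (rule subsetD [OF keys_frag_extend])
    then obtain y where y: "y \<in> Poly_Mapping.keys x" "z = \<phi> y"
      by (auto simp: keys_frag_of)
    then have "fst y \<in> A" using that by auto
    then show "z \<in> A \<times> UNIV" using closed [of "fst y" "snd y"] y by (simp add: mem_Times_iff)
  qed
  show ?thesis
  proof (rule homI)
    fix X :: "('v, 'f) tens" assume "X \<in> carrier (tensor A)"
    then obtain x where x: "Poly_Mapping.keys x \<subseteq> A \<times> UNIV" "X = coset x"
      using tensor_carrier by blast
    then show "tensor_induced A \<phi> X \<in> carrier (tensor A)"
      by (simp only: induced_coset [OF rel] coset_carrier keys)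
    fix Y :: "('v, 'f) tens" assume "Y \<in> carrier (tensor A)"
    then obtain y where y: "Poly_Mapping.keys y \<subseteq> A \<times> UNIV" "Y = coset y"
      using tensor_carrier by blast
    show "tensor_induced A \<phi> (X \<otimes>\<^bsub>tensor A\<^esub> Y) =
        tensor_induced A \<phi> X \<otimes>\<^bsub>tensor A\<^esub> tensor_induced A \<phi> Y"
      using x y by (simp only: coset_mult induced_coset [OF rel] keys frag_extend_add)
  qed
qed

lemma scale_rel:
  assumes "x \<in> tensor_rels A"
  shows "frag_extend (\<lambda>y. frag_of (case y of (v, d) \<Rightarrow> (v, c * d))) x \<in> tensor_null A"
proof -
  have "frag_extend (\<lambda>y. frag_of (case y of (v, d) \<Rightarrow> (v, c * d))) x \<in> tensor_rels A"
    using assms unfolding tensor_rels_def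
    by (auto simp: frag_extend_diff distrib_left) blast+
  then show ?thesis unfolding tensor_null_def by (rule generate.incl)
qed

lemma scale_pure: "tensor_scale A c (pure_tensor A v d) = pure_tensor A v (c * d)"
  unfolding tensor_scale_def by (subst induced_pure [OF scale_rel]) simp_all

lemma map_rel:
  assumes "x \<in> tensor_rels A" and T: "\<And>v. v \<in> A \<Longrightarrow> T v \<in> A" "\<And>u v. T (u + v) = T u + T v"
  shows "frag_extend (\<lambda>y. frag_of (case y of (v, d) \<Rightarrow> (T v, d))) x \<in> tensor_null A"
proof -
  have "frag_extend (\<lambda>y. frag_of (case y of (v, d) \<Rightarrow> (T v, d))) x \<in> tensor_rels A"
    using assms unfolding tensor_rels_def
    by (auto simp: frag_extend_diff distrib_left) blast+
  then show ?thesis unfolding tensor_null_def by (rule generate.incl)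
qed

lemma map_pure:
  assumes T: "\<And>v. v \<in> A \<Longrightarrow> T v \<in> A" "\<And>u v. T (u + v) = T u + T v"
  shows "tensor_map A T (pure_tensor A v d) = pure_tensor A (T v) d"
  unfolding tensor_map_def by (subst induced_pure [OF map_rel [OF _ T]]) simp_all

lemma map_hom:
  assumes T: "\<And>v. v \<in> A \<Longrightarrow> T v \<in> A" "\<And>u v. T (u + v) = T u + T v"
  shows "tensor_map A T \<in> hom (tensor A) (tensor A)"
  unfolding tensor_map_def by (rule induced_hom [OF map_rel [OF _ T]]) (simp_all add: T)

end

section \<open>Values of the lattice form\<close>

lemma lattice_form_commute: "lattice_form \<alpha> \<beta> = lattice_form \<beta> \<alpha>"
  unfolding lattice_form_def
  by (subst sum.swap) (auto intro!: sum.cong simp: cartan_def mult_ac)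

lemma lattice_form_root_lattice:
  assumes "\<alpha> \<in> root_lattice n" "j \<in> {1..n}"
  shows "lattice_form \<alpha> (simple_root j) = 2 * Poly_Mapping.lookup \<alpha> j -
    Poly_Mapping.lookup \<alpha> (j - 1) - Poly_Mapping.lookup \<alpha> (j + 1)"
proof -
  obtain j' where j: "j = Suc j'" using assms(2) by (cases j) auto
  \<comment> \<open>The range includes 0 and n + 1, where \<open>\<alpha>\<close> has coefficient 0,
    so that the two ends of the diagram follow the general formula.\<close>
  have "lattice_form \<alpha> (simple_root j) = (\<Sum>i\<in>{0..n+1}. Poly_Mapping.lookup \<alpha> i * cartan i j)"
    using assms by (intro lattice_form_simple_root) (auto simp: root_lattice_def)
  also have "\<dots> = (\<Sum>i\<in>{j', j' + 1, j' + 2}. Poly_Mapping.lookup \<alpha> i * cartan i j)"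
    using assms by (intro sum.mono_neutral_right) (auto simp: cartan_def j)
  finally show ?thesis by (simp add: j cartan_def)
qed

text \<open>The coefficients of \<open>eta n\<close> are linear in the index, so their second
  difference vanishes except at the end n, where it is 2 n - (n - 1) = n + 1.\<close>

lemma lattice_form_eta_right:
  assumes "i \<in> {1..n}"
  shows "lattice_form (simple_root i) (eta n) = (if i = n then int n + 1 else 0)"
  using assms unfolding lattice_form_commute [of "simple_root i"]
  by (subst lattice_form_root_lattice [OF eta_in_root_lattice]) (auto simp: lookup_eta of_nat_diff)

text \<open>\<open>eta n\<close> is n + 1 times the fundamental weight dual to alpha_n, so only the
  last coefficient counts.\<close>

lemma lattice_form_eta:
  assumes "\<alpha> \<in> root_lattice n"
  shows "lattice_form \<alpha> (eta n) = Poly_Mapping.lookup \<alpha> n * (int n + 1)"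
proof -
  have keys: "Poly_Mapping.keys \<alpha> \<subseteq> {1..n}" using assms by (simp add: root_lattice_def)
  have "lattice_form \<alpha> (eta n) = (\<Sum>i\<in>Poly_Mapping.keys \<alpha>. Poly_Mapping.lookup \<alpha> i * (if i = n then int n + 1 else 0))"
    unfolding lattice_form_commute [of \<alpha>] lattice_form_sum_right [of _ \<alpha>]
    using keys by (intro sum.cong refl) (simp add: lattice_form_commute [of "eta n"] lattice_form_eta_right subset_iff)
  also have "\<dots> = Poly_Mapping.lookup \<alpha> n * (int n + 1)"
    by (auto simp: in_keys_iff if_distrib [of "\<lambda>x. _ * x"] sum.delta' cong: if_cong)
  finally show ?thesis .
qed

text \<open>The coefficients min(k - i, 0) are piecewise linear in k with a single kink at i, so the
  second difference is 1 at i and 0 at the other indices from 2 to n. The pairing with alpha_1 is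
  not 0, but alpha_1 is not a colour; the vanishing coefficient at n gives orthogonality to
  eta.\<close>

definition dual_root :: "nat \<Rightarrow> lattice" where
  "dual_root i = (\<Sum>k=1..<i. Poly_Mapping.single k (int k - int i))"

lemma lookup_dual_root:
  "Poly_Mapping.lookup (dual_root i) k = (if k \<in> {1..<i} then int k - int i else 0)"
  by (auto simp: dual_root_def lookup_sum lookup_single when_def)

lemma dual_root_in_root_lattice: "i \<le> n \<Longrightarrow> dual_root i \<in> root_lattice n"
  by (auto simp: root_lattice_def in_keys_iff lookup_dual_root split: if_splits)

lemma lattice_form_dual_root:
  assumes "i \<in> {2..n}" "j \<in> {2..n}"
  shows "lattice_form (dual_root i) (simple_root j) = (if i = j then 1 else 0)"
  using assms by (subst lattice_form_root_lattice [OF dual_root_in_root_lattice, of _ n])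
    (auto simp: lookup_dual_root of_nat_diff)

lemma lattice_form_dual_root_eta: "i \<le> n \<Longrightarrow> lattice_form (dual_root i) (eta n) = 0"
  by (simp add: lattice_form_eta dual_root_in_root_lattice lookup_dual_root)

text \<open>A multiple of the mirror image of \<open>eta n\<close> under the diagram automorphism.\<close>

definition mirror_eta :: "nat \<Rightarrow> nat \<Rightarrow> lattice" where
  "mirror_eta n c = (\<Sum>k=1..n. Poly_Mapping.single k (int c * (int n + 1 - int k)))"

lemma lookup_mirror_eta:
  "Poly_Mapping.lookup (mirror_eta n c) k = (if k \<in> {1..n} then int c * (int n + 1 - int k) else 0)"
  by (auto simp: mirror_eta_def lookup_sum lookup_single when_def)

lemma mirror_eta_in_root_lattice: "mirror_eta n c \<in> root_lattice n"
  by (auto simp: root_lattice_def in_keys_iff lookup_mirror_eta split: if_splits)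

lemma lattice_form_mirror_eta:
  assumes "j \<in> {2..n}"
  shows "lattice_form (mirror_eta n c) (simple_root j) = 0"
proof -
  have "j = n \<or> j + 1 \<le> n" using assms by auto
  then show ?thesis
    using assms by (subst lattice_form_root_lattice [OF mirror_eta_in_root_lattice])
      (auto simp: lookup_mirror_eta of_nat_diff algebra_simps)
qed

lemma lattice_form_mirror_eta_eta:
  "n \<ge> 1 \<Longrightarrow> lattice_form (mirror_eta n c) (eta n) = int (c * (n + 1))"
  by (simp add: lattice_form_eta mirror_eta_in_root_lattice lookup_mirror_eta algebra_simps)

section \<open>Binomial coefficients modulo \<open>p\<close>\<close>

text \<open>Moves the coefficients into polynomials, where Frobenius is available once the
  characteristic is p.\<close>

lemma of_int_comm_coeff: "of_int (comm_coeff (int m) k) = coeff ([:1, - 1:] ^ m) k"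
proof (induction m arbitrary: k)
  case 0
  then show ?case by (cases k) (auto simp: comm_coeff_def)
next
  case (Suc m)
  show ?case
  proof (cases k)
    case 0
    then show ?thesis by (simp add: coeff_0_power)
  next
    case k: (Suc k')
    have "comm_coeff (int (Suc m)) (Suc k') = comm_coeff (int m) (Suc k') - comm_coeff (int m) k'"
      by (simp add: comm_coeff_def nat_add_distrib algebra_simps)
    then have "of_int (comm_coeff (int (Suc m)) (Suc k')) = (of_int (comm_coeff (int m) (Suc k')) - of_int (comm_coeff (int m) k') :: 'a)"
      by (simp only: of_int_diff)
    then show ?thesis by (simp add: k Suc)
  qed
qed

context
  fixes p :: nat and ty :: "'f::field itself"
  assumes prime: "prime p" and odd: "p > 2" and char: "CHAR('f) = p"
begin

lemma dvd_iff_of_int: "int p dvd c \<longleftrightarrow> of_int c = (0 :: 'f)"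
  using of_int_eq_0_iff_char_dvd [of c, where 'a = 'f] char by simp

lemma one_minus_X_power: "[:1, - 1:] ^ (p ^ r) = (1 - monom 1 (p ^ r) :: 'f poly)"
proof -
  \<comment> \<open>Frobenius yields (-1)^(p^r) in front of z^(p^r); this fixes its sign.\<close>
  have "odd p" using prime odd by (rule prime_odd_nat)
  then have "(- 1 :: 'f) ^ p ^ r = - 1" by simp
  moreover have "[:1, - 1:] = 1 + monom (- 1 :: 'f) 1"
    by (simp add: monom_altdef one_pCons)
  moreover have "(1 + monom (- 1 :: 'f) 1) ^ (p ^ r) = 1 ^ (p ^ r) + monom (- 1) 1 ^ (p ^ r)"
    using prime char freshmans_dream' [where 'a = "'f poly" and n = r and m = "p ^ r"] by simp
  ultimately show ?thesis by (simp add: monom_power minus_monom)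
qed

lemma coeff_one_minus_monom_power:
  assumes "q > 0" "\<not> q dvd k"
  shows "coeff ((1 - monom (1 :: 'f) q) ^ m) k = 0"
  using assms(2)
proof (induction m arbitrary: k)
  case (Suc m)
  then show ?case
    by (simp add: left_diff_distrib coeff_monom_mult dvd_minus_self)
qed (auto intro: Nat.gr0I)

lemma coeff_one_minus_monom_power_low:
  assumes "k < q"
  shows "coeff ((1 - monom (1 :: 'f) q) ^ m) k = (if k = 0 then 1 else 0)"
  by (induction m) (use assms in \<open>auto simp: left_diff_distrib coeff_monom_mult coeff_1\<close>)

lemma dvd_comm_coeff:
  assumes "\<not> p ^ r dvd k"
  shows "int p dvd comm_coeff (int (p ^ r * m)) k"
  unfolding dvd_iff_of_int of_int_comm_coeff
  by (subst power_mult) (simp add: one_minus_X_power coeff_one_minus_monom_power assms prime prime_gt_0_nat)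

text \<open>Modulo p the series is (1 - z^(p^r)) (1 - z^(p^(N+r)))^e, and the second factor is 1 in
  degrees below p^(N+r).\<close>

lemma dvd_comm_coeff_low:
  assumes "k < p ^ (N + r)"
  shows "int p dvd comm_coeff (int (p ^ r + p ^ (N + r) * e)) k - (if k = 0 then 1 else if k = p ^ r then - 1 else 0)"
proof -
  have pos: "p ^ r > 0" using prime prime_gt_0_nat by simp
  have "of_int (comm_coeff (int (p ^ r + p ^ (N + r) * e)) k) =
      coeff ((1 - monom (1 :: 'f) (p ^ r)) * (1 - monom 1 (p ^ (N + r))) ^ e) k" (is "_ = coeff (_ * ?P) k")
    unfolding of_int_comm_coeff power_add [of _ "p ^ r"] power_mult one_minus_X_power ..
  also have "\<dots> = coeff ?P k - (if k < p ^ r then 0 else coeff ?P (k - p ^ r))"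
    by (simp add: left_diff_distrib coeff_monom_mult)
  also have "\<dots> = (if k = 0 then 1 else if k = p ^ r then - 1 else (0 :: 'f))"
    using assms pos prime_gt_0_nat [OF prime] by (auto simp: coeff_one_minus_monom_power_low)
  finally have "of_int (comm_coeff (int (p ^ r + p ^ (N + r) * e)) k) =
      (of_int :: int \<Rightarrow> 'f) (if k = 0 then 1 else if k = p ^ r then - 1 else 0 :: int)"
    by (simp only: if_distrib [of of_int] of_int_0 of_int_1 of_int_minus)
  then show ?thesis unfolding dvd_iff_of_int by (simp only: of_int_diff right_minus_eq)
qed

end

lemma comm_coeff_of_0: "comm_coeff 0 k = (if k = 0 then 1 else 0)"
  by (cases k) (auto simp: comm_coeff_def)

lemma comm_coeff_of_1: "comm_coeff 1 k = (if k = 0 then 1 else if k = 1 then - 1 else 0)"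
  by (auto simp: comm_coeff_def binomial_eq_0)

section \<open>Lowering monomials\<close>

definition color_step :: "nat \<Rightarrow> nat \<Rightarrow> nat" where
  "color_step q i = (if i = 0 then q else 1)"

text \<open>
  For \<open>q = p\<^sup>r\<close> these are the generators \<open>s\<^bsub>\<alpha>,m\<^esub>\<close> that are not killed modulo \<open>I\<^sub>L\<close>: in colour 0 the
  second component counts multiples of \<open>q\<close>.
\<close>

definition gmon :: "nat \<Rightarrow> nat \<Rightarrow> nat \<times> nat \<Rightarrow> symalg" where
  "gmon n q = (\<lambda>(i, m). spoly (color n i) (color_step q i * m))"

definition color_count :: "nat \<Rightarrow> (nat \<times> nat) multiset \<Rightarrow> nat" where
  "color_count i M = size (filter_mset (\<lambda>x. fst x = i) M)"

definition weight :: "(nat \<times> nat) multiset \<Rightarrow> nat" where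
  "weight M = (\<Sum>x\<in>#M. snd x)"

definition lower1 :: "nat \<Rightarrow> nat \<times> nat \<Rightarrow> nat \<times> nat" where
  "lower1 i x = (if fst x = i then (i, snd x - 1) else x)"

definition lower :: "nat \<Rightarrow> (nat \<times> nat) multiset \<Rightarrow> (nat \<times> nat) multiset" where
  "lower i M = filter_mset (\<lambda>x. snd x > 0) (image_mset (lower1 i) M)"

text \<open>Undoes \<open>lower\<close> once the number k of factors of colour i is known: factors
  of index 1 disappear under lowering, and k tells how many to restore. For partitions this puts
  back the first column of the diagram.\<close>

definition raise :: "nat \<Rightarrow> nat \<Rightarrow> (nat \<times> nat) multiset \<Rightarrow> (nat \<times> nat) multiset" where
  "raise i k M = image_mset (\<lambda>x. if fst x = i then (i, snd x + 1) else x) M + replicate_mset (k - color_count i M) (i, 1)"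

lemma color_count_empty [simp]: "color_count i {#} = 0"
  and color_count_add [simp]: "color_count i (add_mset x M) = (if fst x = i then Suc (color_count i M) else color_count i M)"
  by (simp_all add: color_count_def)

lemma lower_empty [simp]: "lower i {#} = {#}"
  and lower_add [simp]: "lower i (add_mset x M) =
    (if snd (lower1 i x) > 0 then add_mset (lower1 i x) (lower i M) else lower i M)"
  by (simp_all add: lower_def)

lemma color_count_lower_le: "color_count i (lower i M) \<le> color_count i M"
  by (induction M) (auto simp: lower1_def)

lemma raise_lower:
  assumes "set_mset M \<subseteq> UNIV \<times> {1..}"
  shows "raise i (color_count i M) (lower i M) = M"
  using assms
proof (induction M)
  case empty
  then show ?case by (simp add: raise_def)
next
  case (add x M)
  obtain j m where x: "x = (j, m)" "m \<ge> 1" using add.prems by (cases x) auto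
  have IH: "raise i (color_count i M) (lower i M) = M" using add by simp
  \<comment> \<open>Subtraction is truncated, so the bound on the count is what allows the successor
    to be moved out.\<close>
  have *: "Suc (color_count i M) - color_count i (lower i M) = Suc (color_count i M - color_count i (lower i M))"
    using color_count_lower_le [of i M] by simp
  consider "j \<noteq> i" | "j = i" "m = 1" | "j = i" "m > 1" using x by fastforce
  then show ?case
  proof cases
    case 1
    then have "raise i (color_count i (add_mset x M)) (lower i (add_mset x M)) =
        add_mset x (raise i (color_count i M) (lower i M))"
      using x by (simp add: raise_def lower1_def)
    then show ?thesis by (simp add: IH)
  next
    case 2
    then have "raise i (color_count i (add_mset x M)) (lower i (add_mset x M)) =
        add_mset x (raise i (color_count i M) (lower i M))"
      using x by (simp add: raise_def lower1_def *)
    then show ?thesis by (simp add: IH)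
  next
    case 3
    then have "raise i (color_count i (add_mset x M)) (lower i (add_mset x M)) =
        add_mset x (raise i (color_count i M) (lower i M))"
      using x by (simp add: raise_def lower1_def)
    then show ?thesis by (simp add: IH)
  qed
qed

text \<open>All indices are positive, so each factor of colour i loses exactly one, including those
  that disappear. The weight is the measure of the later induction.\<close>

lemma weight_lower:
  "set_mset M \<subseteq> UNIV \<times> {1..} \<Longrightarrow> weight (lower i M) + color_count i M = weight M"
  by (induction M) (auto simp: weight_def lower1_def)

lemma set_lower:
  assumes "set_mset M \<subseteq> C \<times> {1..}"
  shows "set_mset (lower i M) \<subseteq> C \<times> {1..}"
  using assms by (induction M) (auto simp: lower1_def)

lemma snd_le_weight: "x \<in># M \<Longrightarrow> snd x \<le> weight M"
  by (induction M) (auto simp: weight_def)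

text \<open>Supplies a colour that can be lowered in any nonempty monomial.\<close>

lemma color_count_eq_0_imp: "(\<And>i. i \<in> C \<Longrightarrow> color_count i M = 0) \<Longrightarrow> set_mset M \<subseteq> C \<times> X \<Longrightarrow> M = {#}"
proof (cases M)
  case (add x N)
  assume "\<And>i. i \<in> C \<Longrightarrow> color_count i M = 0" "set_mset M \<subseteq> C \<times> X"
  moreover from this have "fst x \<in> C" using add by auto
  ultimately show ?thesis using add by (metis color_count_add nat.distinct(1))
qed

text \<open>The quotient by p has to be integral: in the complex algebra itself p is invertible and
  the relation would say nothing.\<close>

definition pcong :: "nat \<Rightarrow> nat \<Rightarrow> symalg \<Rightarrow> symalg \<Rightarrow> bool" where
  "pcong n p f g \<longleftrightarrow> (\<exists>a\<in>SA n. f - g = of_nat p * a)"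

lemma pcong_refl: "pcong n p f f"
  unfolding pcong_def using SA_0 by force

text \<open>F G - F' G' = (F - F') G + F' (G - G'), so the cofactors whose integrality matters are G
  and F'.\<close>

lemma pcong_mult_sum:
  assumes F: "\<And>k. pcong n p (F $ k) (F' $ k)" "\<And>k. F' $ k \<in> SA n"
    and G: "\<And>k. pcong n p (G $ k) (G' $ k)" "\<And>k. G $ k \<in> SA n"
  shows "pcong n p ((F * G) $ k) ((F' * G') $ k)"
proof -
  obtain f where f: "f k \<in> SA n" "F $ k - F' $ k = of_nat p * f k" for k
    using F(1) unfolding pcong_def by metis
  obtain g where g: "g k \<in> SA n" "G $ k - G' $ k = of_nat p * g k" for k
    using G(1) unfolding pcong_def by metis
  have "F * G - F' * G' = fps_const (of_nat p) * (Abs_fps f * G + F' * Abs_fps g)"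
  proof -
    have "F - F' = fps_const (of_nat p) * Abs_fps f" "G - G' = fps_const (of_nat p) * Abs_fps g"
      by (simp_all add: fps_eq_iff f g)
    moreover have "F * G - F' * G' = (F - F') * G + F' * (G - G')" by (simp add: algebra_simps)
    ultimately show ?thesis by (simp add: distrib_left mult_ac)
  qed
  then have "(F * G) $ k - (F' * G') $ k = of_nat p * (Abs_fps f * G + F' * Abs_fps g) $ k"
    by (simp add: fps_eq_iff)
  moreover have "(Abs_fps f * G + F' * Abs_fps g) $ k \<in> SA n"
    unfolding fps_add_nth fps_mult_nth fps_nth_Abs_fps by (intro SA_add SA_sum SA_mult f g F G)
  ultimately show ?thesis unfolding pcong_def by blast
qed

lemma pcong_prod:
  assumes "\<And>x k. x \<in># M \<Longrightarrow> pcong n p (F x $ k) (F' x $ k)"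
    and "\<And>x k. x \<in># M \<Longrightarrow> F x $ k \<in> SA n" "\<And>x k. x \<in># M \<Longrightarrow> F' x $ k \<in> SA n"
  shows "pcong n p ((\<Prod>x\<in>#M. F x) $ k) ((\<Prod>x\<in>#M. F' x) $ k) \<and> (\<Prod>x\<in>#M. F x) $ k \<in> SA n"
  using assms
proof (induction M arbitrary: k)
  case empty
  then show ?case by (simp add: pcong_refl SA_0 SA_1)
next
  case (add x M)
  have "pcong n p ((F x * (\<Prod>x\<in>#M. F x)) $ k) ((F' x * (\<Prod>x\<in>#M. F' x)) $ k)"
    by (rule pcong_mult_sum) (use add in auto)
  moreover have "(F x * (\<Prod>x\<in>#M. F x)) $ k \<in> SA n"
    unfolding fps_mult_nth by (intro SA_sum SA_mult) (use add in auto)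
  ultimately show ?case by simp
qed

text \<open>
  The image of \<open>gmon n q x\<close> under \<open>\<Sum>k. r\<^bsub>\<beta>,k\<^esub> x\<^sup>k\<close> modulo \<open>p\<close>, for a root \<open>\<beta>\<close> that separates the
  colour \<open>i\<close> from the others.
\<close>

definition lowering_series :: "nat \<Rightarrow> nat \<Rightarrow> nat \<Rightarrow> nat \<times> nat \<Rightarrow> symalg fps" where
  "lowering_series n q i x = (if fst x = i
     then fps_const (gmon n q x) - fps_X ^ color_step q i * fps_const (gmon n q (lower1 i x))
     else fps_const (gmon n q x))"

text \<open>Each factor of colour i has degree t = \<open>color_step q i\<close> with leading
  coefficient minus the lowered generator, and the other factors are constants. So the top degree is
  t times the count, with the lowered monomial up to sign as coefficient.\<close>

lemma prod_lowering_series: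
  assumes "q > 0"
  shows "(\<forall>k > color_step q i * color_count i M. (\<Prod>x\<in>#M. lowering_series n q i x) $ k = 0) \<and>
    (\<Prod>x\<in>#M. lowering_series n q i x) $ (color_step q i * color_count i M) =
      (- 1) ^ color_count i M * (\<Prod>x\<in>#lower i M. gmon n q x)"
proof (induction M)
  case (add x M)
  let ?P = "\<Prod>x\<in>#M. lowering_series n q i x" and ?t = "color_step q i"
  have IH: "\<And>k. k > ?t * color_count i M \<Longrightarrow> ?P $ k = 0"
    "?P $ (?t * color_count i M) = (- 1) ^ color_count i M * (\<Prod>x\<in>#lower i M. gmon n q x)"
    using add.IH by auto
  have t: "?t > 0" using assms by (simp add: color_step_def)
  show ?case
  proof (cases "fst x = i")
    case True
    \<comment> \<open>A generator lowered to index 0 equals 1, so dropping it from the multiset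
      leaves the product unchanged.\<close>
    have lower: "(\<Prod>x\<in>#lower i (add_mset x M). gmon n q x) = gmon n q (lower1 i x) * (\<Prod>x\<in>#lower i M. gmon n q x)"
      by (auto simp: gmon_def case_prod_beta)
    have lowering_series: "lowering_series n q i x = fps_const (gmon n q x) - fps_X ^ ?t * fps_const (gmon n q (lower1 i x))"
      using True by (simp add: lowering_series_def)
    have nth: "(lowering_series n q i x * ?P) $ k = gmon n q x * ?P $ k -
        gmon n q (lower1 i x) * (if k < ?t then 0 else ?P $ (k - ?t))" for k
      unfolding lowering_series by (simp add: left_diff_distrib fps_X_power_mult_nth mult.assoc)
    have "(lowering_series n q i x * ?P) $ k = 0" if "k > ?t * color_count i (add_mset x M)" for k
      using that True by (simp add: nth IH)
    moreover have "(lowering_series n q i x * ?P) $ (?t * color_count i (add_mset x M)) =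
        (- 1) ^ color_count i (add_mset x M) * (\<Prod>x\<in>#lower i (add_mset x M). gmon n q x)"
    proof -
      have "?P $ (?t * color_count i (add_mset x M)) = 0"
        using True t by (intro IH(1)) simp
      moreover have "?t * color_count i (add_mset x M) - ?t = ?t * color_count i M" "\<not> ?t * color_count i (add_mset x M) < ?t"
        using True by simp_all
      ultimately show ?thesis unfolding nth lower using True by (simp only: IH(2) color_count_add if_True if_False) simp
    qed
    ultimately show ?thesis by simp
  next
    case False
    have "lowering_series n q i x * ?P = fps_const (gmon n q x) * ?P" using False by (simp add: lowering_series_def)
    moreover have "(\<Prod>x\<in>#lower i (add_mset x M). gmon n q x) = gmon n q x * (\<Prod>x\<in>#lower i M. gmon n q x)"
      using False by (auto simp: lower1_def gmon_def case_prod_beta)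
    ultimately show ?thesis using False by (simp add: IH mult.left_commute)
  qed
qed simp

lemma SA_uminus: "a \<in> SA n \<Longrightarrow> - a \<in> SA n"
  using SA_diff [OF SA_0, of a n] by simp

lemma gmon_in_SA: "fst x \<in> colors n \<Longrightarrow> gmon n q x \<in> SA n"
  by (simp add: gmon_def case_prod_beta spoly_in_SA color_in_root_lattice)

lemma Rfps_prod: "Rfps \<beta> (\<Prod>x\<in>#M. f x) = (\<Prod>x\<in>#M. Rfps \<beta> (f x))"
  by (induction M) (simp_all add: Rfps_mult)

text \<open>
  Modulo \<open>p\<close> and in the degrees that matter for monomials of weight at most \<open>W\<close>, the commutation
  factor \<open>(1 - z)\<^sup>m\<close> of \<open>\<beta>\<close> with colour \<open>j\<close> is 1 for \<open>j \<noteq> i\<close> and \<open>1 - z\<^sup>t\<close> for \<open>j = i\<close>.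
\<close>

definition separates :: "nat \<Rightarrow> nat \<Rightarrow> nat \<Rightarrow> nat \<Rightarrow> nat \<Rightarrow> lattice \<Rightarrow> bool" where
  "separates n p q i W \<beta> \<longleftrightarrow> (\<forall>j\<in>colors n. \<forall>k\<le>color_step q j * W.
     int p dvd comm_coeff (lattice_form \<beta> (color n j)) k - (if k = 0 then 1 else if j = i \<and> k = color_step q i then - 1 else 0))"

text \<open>The exact factor from \<open>rmap_spoly\<close> is compared with 1 or 1 - z^t
  coefficient by coefficient; m \<le> W keeps the relevant k in the range controlled by
  \<open>separates\<close>.\<close>

lemma pcong_rmap_gmon:
  assumes sep: "separates n p q i W \<beta>" and q: "q > 0"
    and j: "j \<in> colors n" and m: "1 \<le> m" "m \<le> W"
  shows "pcong n p (Rfps \<beta> (gmon n q (j, m)) $ k) (lowering_series n q i (j, m) $ k)"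
proof -
  let ?spoly = "\<lambda>k. spoly (color n j) (color_step q j * m - k)"
  let ?e = "if k = 0 then 1 else if j = i \<and> k = color_step q i then - 1 else 0 :: int"
  have t: "color_step q i > 0" using q by (simp add: color_step_def)
  have nth: "(fps_X ^ t * fps_const c) $ k = (if k = t then c else 0)" for t and c :: symalg
    by (auto simp: fps_X_power_mult_nth)
  have lowering_series: "lowering_series n q i (j, m) $ k = of_int ?e * ?spoly k"
  proof (cases "j = i")
    case True
    have "lowering_series n q i (j, m) = fps_const (?spoly 0) - fps_X ^ color_step q i * fps_const (?spoly (color_step q i))"
      using True by (simp add: lowering_series_def gmon_def lower1_def diff_mult_distrib2)
    then have "lowering_series n q i (j, m) $ k = (if k = 0 then ?spoly 0 else 0) - (if k = color_step q i then ?spoly (color_step q i) else 0)"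
      by (simp add: nth)
    then show ?thesis using True t by simp
  next
    case False
    then have "lowering_series n q i (j, m) $ k = (if k = 0 then ?spoly 0 else 0)"
      by (simp add: lowering_series_def gmon_def)
    then show ?thesis using False by simp
  qed
  show ?thesis
  proof (cases "k \<le> color_step q j * m")
    case True
    have "k \<le> color_step q j * W" using True m(2) by (meson le_trans mult_le_mono2)
    then have "int p dvd comm_coeff (lattice_form \<beta> (color n j)) k - ?e"
      using sep j unfolding separates_def by blast
    then obtain c where c: "comm_coeff (lattice_form \<beta> (color n j)) k - ?e = int p * c" by (rule dvdE)
    have "Rfps \<beta> (gmon n q (j, m)) $ k = of_int (comm_coeff (lattice_form \<beta> (color n j)) k) * ?spoly k"
      using True by (simp add: gmon_def rmap_spoly)
    then have "Rfps \<beta> (gmon n q (j, m)) $ k - lowering_series n q i (j, m) $ k =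
        of_int (comm_coeff (lattice_form \<beta> (color n j)) k - ?e) * ?spoly k"
      unfolding lowering_series by (simp only: of_int_diff left_diff_distrib)
    also have "\<dots> = of_nat p * (of_int c * ?spoly k)"
      unfolding c by (simp add: mult.assoc)
    finally show ?thesis
      unfolding pcong_def
      by (intro bexI [of _ "of_int c * ?spoly k"] SA_mult SA_of_int spoly_in_SA color_in_root_lattice j)
  next
    \<comment> \<open>Beyond the index of the generator both sides vanish; as m \<ge> 1, the
      exceptional k = \<open>color_step q i\<close> of colour i is not in this range.\<close>
    case False
    have "k \<noteq> 0" using False by simp
    moreover have "\<not> (j = i \<and> k = color_step q i)" using False m(1) by auto
    ultimately have "lowering_series n q i (j, m) $ k = 0" unfolding lowering_series by (simp only: if_False of_int_0 mult_zero_left)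
    moreover have "Rfps \<beta> (gmon n q (j, m)) $ k = 0" using False by (simp add: gmon_def rmap_spoly)
    ultimately show ?thesis by (simp add: pcong_refl)
  qed
qed

lemma pcong_rmap_prod:
  assumes sep: "separates n p q i W \<beta>" and q: "q > 0" and i: "i \<in> colors n"
    and M: "set_mset M \<subseteq> colors n \<times> {1..}" "weight M \<le> W"
  shows "color_count i M < k \<Longrightarrow> pcong n p (rmap \<beta> (color_step q i * k) (\<Prod>x\<in>#M. gmon n q x)) 0"
    and "pcong n p (rmap \<beta> (color_step q i * color_count i M) (\<Prod>x\<in>#M. gmon n q x))
      ((- 1) ^ color_count i M * (\<Prod>x\<in>#lower i M. gmon n q x))"
proof -
  have eq: "rmap \<beta> k (\<Prod>x\<in>#M. gmon n q x) = (\<Prod>x\<in>#M. Rfps \<beta> (gmon n q x)) $ k" for k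
    by (simp flip: Rfps_prod)
  have cong: "pcong n p (rmap \<beta> k (\<Prod>x\<in>#M. gmon n q x)) ((\<Prod>x\<in>#M. lowering_series n q i x) $ k)" for k
    unfolding eq
  proof (rule conjunct1 [OF pcong_prod])
    fix x k assume x: "x \<in># M"
    then have fst: "fst x \<in> colors n" and snd: "1 \<le> snd x" "snd x \<le> W"
      using M snd_le_weight [OF x] by auto
    show "pcong n p (Rfps \<beta> (gmon n q x) $ k) (lowering_series n q i x $ k)"
      using pcong_rmap_gmon [OF sep q fst snd] by simp
    show "Rfps \<beta> (gmon n q x) $ k \<in> SA n"
      using fst by (simp add: rmap_in_SA gmon_in_SA)
    have "gmon n q x \<in> SA n" "gmon n q (lower1 i x) \<in> SA n"
      using fst by (auto simp: lower1_def intro!: gmon_in_SA i)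
    then show "lowering_series n q i x $ k \<in> SA n"
      by (auto simp: lowering_series_def fps_X_power_mult_nth intro!: SA_diff SA_uminus SA_0)
  qed
  have t: "color_step q i > 0" using q by (simp add: color_step_def)
  show "color_count i M < k \<Longrightarrow> pcong n p (rmap \<beta> (color_step q i * k) (\<Prod>x\<in>#M. gmon n q x)) 0"
    using cong [of "color_step q i * k"] prod_lowering_series [OF q, of i M n] t by simp
  show "pcong n p (rmap \<beta> (color_step q i * color_count i M) (\<Prod>x\<in>#M. gmon n q x))
      ((- 1) ^ color_count i M * (\<Prod>x\<in>#lower i M. gmon n q x))"
    using cong [of "color_step q i * color_count i M"] prod_lowering_series [OF q, of i M n] by simp
qed

text \<open>For i \<ge> 2 the dual root has pairings exactly 0 and 1 with the colours. For colour 0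
  the multiple c of the mirrored eta is orthogonal to alpha_2, ..., alpha_n and pairs with eta to c
  a p^r, which an inverse c of a modulo p^N makes congruent to p^r modulo p^(N+r).\<close>

lemma ex_separates:
  assumes p: "prime p" "p > 2" "CHAR('f::field) = p" and n: "n \<ge> 1" "n + 1 = a * p ^ r" "coprime a p"
    and i: "i \<in> colors n"
  shows "\<exists>\<beta>\<in>root_lattice n. separates n p (p ^ r) i W \<beta>"
proof (cases "i = 0")
  case False
  then have i2: "i \<in> {2..n}" using i by (simp add: colors_def)
  have "lattice_form (dual_root i) (color n j) = (if j = i then 1 else 0)" if "j \<in> colors n" for j
    using that i2 by (auto simp: colors_def color_def lattice_form_dual_root lattice_form_dual_root_eta)
  then have "separates n p (p ^ r) i W (dual_root i)"
    using False by (auto simp: separates_def comm_coeff_of_0 comm_coeff_of_1 color_step_def)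
  then show ?thesis using dual_root_in_root_lattice [of i n] i2 by auto
next
  case True
  \<comment> \<open>Chosen so that p^N exceeds W, which puts all degrees up to p^r W below p^(N+r);
    the successor also gives p^N > 1, so that the congruence reads as remainder 1.\<close>
  define N where "N = Suc W"
  have N: "W < p ^ N"
  proof -
    have "W < 2 ^ W" by (rule less_exp)
    also have "\<dots> \<le> p ^ W" using p(2) by (intro power_mono) auto
    also have "\<dots> \<le> p ^ N" using p(2) unfolding N_def by (intro power_increasing) auto
    finally show ?thesis .
  qed
  obtain c where c: "[a * c = 1] (mod p ^ N)"
    using cong_solve_coprime_nat [of a "p ^ N"] n(3) by auto
  have "p ^ N > 1" using p(2) unfolding N_def by (intro one_less_power) auto
  then have ac: "a * c = 1 + p ^ N * (a * c div p ^ N)"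
    using c unfolding cong_def by (metis add.commute mod_less mult_div_mod_eq)
  have "c * (n + 1) = p ^ r + p ^ (N + r) * (a * c div p ^ N)"
    unfolding n(2) by (subst mult.assoc [symmetric], subst mult.commute [of c], subst ac)
      (simp add: algebra_simps power_add)
  then have eta: "lattice_form (mirror_eta n c) (eta n) = int (p ^ r + p ^ (N + r) * (a * c div p ^ N))"
    using lattice_form_mirror_eta_eta [OF n(1)] by metis
  have "separates n p (p ^ r) i W (mirror_eta n c)"
    unfolding separates_def
  proof (intro ballI allI impI)
    fix j k assume j: "j \<in> colors n" and k: "k \<le> color_step (p ^ r) j * W"
    show "int p dvd comm_coeff (lattice_form (mirror_eta n c) (color n j)) k -
        (if k = 0 then 1 else if j = i \<and> k = color_step (p ^ r) i then - 1 else 0)"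
    proof (cases "j = 0")
      case True
      have "k \<le> p ^ r * W" using k True by (simp add: color_step_def)
      also have "p ^ r * W < p ^ r * p ^ N" using N p(2) by simp
      also have "\<dots> = p ^ (N + r)" by (simp add: power_add)
      finally have "k < p ^ (N + r)" .
      then show ?thesis
        using dvd_comm_coeff_low [OF p, of k N r "a * c div p ^ N"]
        by (simp only: True \<open>i = 0\<close> color_def color_step_def eta if_True simp_thms)
    next
      case False
      then have "lattice_form (mirror_eta n c) (color n j) = 0"
        using j by (simp add: colors_def color_def lattice_form_mirror_eta)
      then show ?thesis using False \<open>i = 0\<close> by (simp add: comm_coeff_of_0)
    qed
  qed
  then show ?thesis using mirror_eta_in_root_lattice by blast
qed

section \<open>The form and the operators on pure tensors\<close>

interpretation VZ: add_subgroup "VZ n" for n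
  by unfold_locales (auto intro: VZ_diff)

locale VF_form =
  fixes n :: nat and B :: "(voa, 'f::field) tens \<Rightarrow> (voa, 'f) tens \<Rightarrow> 'f"
  assumes form: "is_VF_form n B"
begin

abbreviation V :: "(voa, 'f) tens monoid" where "V \<equiv> tensor (VZ n)"
abbreviation pure :: "voa \<Rightarrow> 'f \<Rightarrow> (voa, 'f) tens" where "pure \<equiv> pure_tensor (VZ n)"

sublocale V: comm_group V
  by (rule VZ.comm_group_tensor)

lemma sF_pure: "\<alpha> \<in> root_lattice n \<Longrightarrow> sF n \<alpha> m (pure v c) = pure (s_op \<alpha> m v) c"
  unfolding sF_def by (rule VZ.map_pure) (auto simp: s_op_add intro: s_op_in_VZ)

lemma rF_pure: "rF n \<alpha> m (pure v c) = pure (r_op \<alpha> m v) c"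
  unfolding rF_def by (rule VZ.map_pure) (auto simp: r_op_add intro: r_op_in_VZ)

lemma sF_closed: "\<alpha> \<in> root_lattice n \<Longrightarrow> X \<in> carrier V \<Longrightarrow> sF n \<alpha> m X \<in> carrier V"
  unfolding sF_def by (rule hom_in_carrier [OF VZ.map_hom]) (auto simp: s_op_add intro: s_op_in_VZ)

lemma rF_hom: "rF n \<alpha> m \<in> hom V V"
  unfolding rF_def by (rule VZ.map_hom) (auto simp: r_op_add intro: r_op_in_VZ)

lemma rF_closed: "X \<in> carrier V \<Longrightarrow> rF n \<alpha> m X \<in> carrier V"
  by (rule hom_in_carrier [OF rF_hom])

lemma B_sym: "X \<in> carrier V \<Longrightarrow> Y \<in> carrier V \<Longrightarrow> B X Y = B Y X"
  and B_mult: "X \<in> carrier V \<Longrightarrow> Y \<in> carrier V \<Longrightarrow> Z \<in> carrier V \<Longrightarrow> B (X \<otimes>\<^bsub>V\<^esub> Y) Z = B X Z + B Y Z"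
  and B_scale: "X \<in> carrier V \<Longrightarrow> Y \<in> carrier V \<Longrightarrow> B (tensor_scale (VZ n) c X) Y = c * B X Y"
  and B_iota: "\<alpha> \<in> root_lattice n \<Longrightarrow> \<beta> \<in> root_lattice n \<Longrightarrow>
    B (iotaF n \<alpha>) (iotaF n \<beta>) = (if \<alpha> = - \<beta> then 1 else 0)"
  and B_adjoint: "X \<in> carrier V \<Longrightarrow> Y \<in> carrier V \<Longrightarrow> \<alpha> \<in> root_lattice n \<Longrightarrow>
    B (sF n \<alpha> m X) Y = B X (rF n \<alpha> m Y)"
  using form unfolding is_VF_form_def symmetric_bilinear_def VF_def by blast+

lemma B_adjoint': 
  assumes "X \<in> carrier V" "Y \<in> carrier V" "\<alpha> \<in> root_lattice n"
  shows "B X (sF n \<alpha> m Y) = B (rF n \<alpha> m X) Y"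
  using assms by (metis B_adjoint B_sym rF_closed sF_closed)

lemma B_one: "Z \<in> carrier V \<Longrightarrow> B \<one>\<^bsub>V\<^esub> Z = 0"
  using B_mult [of "\<one>\<^bsub>V\<^esub>" "\<one>\<^bsub>V\<^esub>" Z]
  by (metis V.one_closed V.r_one add_cancel_left_right)

lemma B_inv: "X \<in> carrier V \<Longrightarrow> Z \<in> carrier V \<Longrightarrow> B (inv\<^bsub>V\<^esub> X) Z = - B X Z"
  using B_mult [of "inv\<^bsub>V\<^esub> X" X Z] B_one by (simp add: eq_neg_iff_add_eq_0)

lemma B_one_right: "Z \<in> carrier V \<Longrightarrow> B Z \<one>\<^bsub>V\<^esub> = 0"
  using B_one [of Z] B_sym [of Z "\<one>\<^bsub>V\<^esub>"] by simp

lemma B_pure: "v \<in> VZ n \<Longrightarrow> Z \<in> carrier V \<Longrightarrow> B (pure v c) Z = c * B (pure v 1) Z"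
  using B_scale [of "pure v 1" Z c] by (simp add: VZ.scale_pure VZ.pure_carrier)

lemma B_pure_right: "v \<in> VZ n \<Longrightarrow> Z \<in> carrier V \<Longrightarrow> B Z (pure v c) = c * B Z (pure v 1)"
  using B_pure [of v Z c] B_sym by (simp add: VZ.pure_carrier)

lemma pure_of_nat_mult:
  assumes "v \<in> VZ n"
  shows "pure (of_nat k * v) c = pure v (of_nat k * c)"
  using VZ.pure_of_nat [OF assms, of k c] by simp

text \<open>Bridge from integral congruences to V_(L,F): the difference is p times an integral
  vector, and p becomes 0 on the scalar side.\<close>

lemma pure_pcong:
  assumes "pcong n CHAR('f) f g" "g \<in> SA n" "\<alpha> \<in> root_lattice n"
  shows "pure (Poly_Mapping.single \<alpha> f) c = pure (Poly_Mapping.single \<alpha> g) c"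
proof -
  obtain a where a: "a \<in> SA n" "f - g = of_nat CHAR('f) * a" using assms(1) by (auto simp: pcong_def)
  have v: "Poly_Mapping.single \<alpha> a \<in> VZ n" "Poly_Mapping.single \<alpha> g \<in> VZ n"
    using a assms single_in_VZ by auto
  have of_nat: "of_nat k * Poly_Mapping.single \<alpha> a = Poly_Mapping.single \<alpha> (of_nat k * a)" for k
    by (induction k) (simp_all add: distrib_right single_add)
  have "f = g + of_nat CHAR('f) * a" using a by (simp add: algebra_simps)
  then have "Poly_Mapping.single \<alpha> f = Poly_Mapping.single \<alpha> g + of_nat CHAR('f) * Poly_Mapping.single \<alpha> a"
    by (simp only: of_nat single_add)
  moreover have "of_nat CHAR('f) * Poly_Mapping.single \<alpha> a \<in> VZ n"
    unfolding of_nat using a assms by (intro single_in_VZ SA_mult SA_of_nat)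
  ultimately show ?thesis
    using v by (simp add: VZ.pure_add_left pure_of_nat_mult VZ.pure_zero_right VZ.pure_carrier)
qed

section \<open>The inclusion of \<open>I\<^sub>L\<close> in the radical\<close>

text \<open>Integral counterpart of I_L. Multiples of the characteristic are included because the
  operators r preserve the span of the other generators only modulo p.\<close>

definition rad_ideal :: "nat \<Rightarrow> symalg set" where
  "rad_ideal q = group_closure ({a * spoly (eta n) m |a m. a \<in> SA n \<and> \<not> q dvd m} \<union>
     {of_nat CHAR('f) * a |a. a \<in> SA n})"

lemma rad_ideal_eta: "a \<in> SA n \<Longrightarrow> \<not> q dvd m \<Longrightarrow> a * spoly (eta n) m \<in> rad_ideal q"
  unfolding rad_ideal_def by (rule group_closure.base, rule insertI2, rule UnI1) blast

lemma rad_ideal_char: "a \<in> SA n \<Longrightarrow> of_nat CHAR('f) * a \<in> rad_ideal q"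
  unfolding rad_ideal_def by (rule group_closure.base, rule insertI2, rule UnI2) blast

lemma rad_ideal_sum: "(\<And>x. x \<in> I \<Longrightarrow> f x \<in> rad_ideal q) \<Longrightarrow> (\<Sum>x\<in>I. f x) \<in> rad_ideal q"
  unfolding rad_ideal_def by (rule group_closure_sum)

lemma rad_ideal_zero: "0 \<in> rad_ideal q"
  unfolding rad_ideal_def by (rule zero_in_group_closure)

lemma rad_ideal_diff: "f \<in> rad_ideal q \<Longrightarrow> g \<in> rad_ideal q \<Longrightarrow> f - g \<in> rad_ideal q"
  unfolding rad_ideal_def by (rule group_closure.diff)

lemma rad_ideal_induct [consumes 1, case_names eta char zero diff]:
  assumes "f \<in> rad_ideal q" "\<And>a m. a \<in> SA n \<Longrightarrow> \<not> q dvd m \<Longrightarrow> P (a * spoly (eta n) m)"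
    "\<And>a. a \<in> SA n \<Longrightarrow> P (of_nat CHAR('f) * a)" "P 0"
    "\<And>f g. f \<in> rad_ideal q \<Longrightarrow> g \<in> rad_ideal q \<Longrightarrow> P f \<Longrightarrow> P g \<Longrightarrow> P (f - g)"
  shows "P f"
  using assms(1) unfolding rad_ideal_def
proof (induction rule: group_closure.induct)
  case (base s)
  then show ?case
    by (elim insertE UnE CollectE exE conjE) (simp_all add: assms(2,3,4))
next
  case (diff s t)
  then show ?case by (intro assms(5)) (auto simp: rad_ideal_def)
qed

lemma rad_ideal_subset_SA: "f \<in> rad_ideal q \<Longrightarrow> f \<in> SA n"
  by (induction rule: rad_ideal_induct)
     (auto intro: SA_0 SA_diff SA_mult SA_of_nat spoly_in_SA eta_in_root_lattice)

text \<open>When r lowers s_(eta,m) by l, either q divides l, and then q still does not divide m -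
  l, or the coefficient is a multiple of the characteristic.\<close>

lemma rmap_rad_ideal:
  assumes "f \<in> rad_ideal q" and dvd: "\<And>k. \<not> q dvd k \<Longrightarrow> int CHAR('f) dvd comm_coeff (lattice_form \<alpha> (eta n)) k"
  shows "rmap \<alpha> k f \<in> rad_ideal q"
  using assms(1)
proof (induction rule: rad_ideal_induct)
  case (eta a m)
  show ?case
    unfolding rmap_mult
  proof (intro rad_ideal_sum)
    fix j
    let ?l = "k - j" and ?c = "comm_coeff (lattice_form \<alpha> (eta n)) (k - j)"
    have a: "rmap \<alpha> j a \<in> SA n" using eta rmap_in_SA by blast
    consider "\<not> ?l \<le> m" | "?l \<le> m" "q dvd ?l" | "?l \<le> m" "\<not> q dvd ?l" by blast
    then show "rmap \<alpha> j a * rmap \<alpha> ?l (spoly (eta n) m) \<in> rad_ideal q"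
    proof cases
      case 1
      then show ?thesis by (simp add: rmap_spoly rad_ideal_zero)
    next
      case 2
      then have "\<not> q dvd m - ?l" using eta by (meson dvd_diffD)
      then have "(rmap \<alpha> j a * of_int ?c) * spoly (eta n) (m - ?l) \<in> rad_ideal q"
        by (intro rad_ideal_eta SA_mult SA_of_int a)
      then show ?thesis using 2 by (simp add: rmap_spoly mult.assoc)
    next
      case 3
      then obtain c where c: "?c = int CHAR('f) * c" using dvd by (meson dvdE)
      have "of_nat CHAR('f) * (rmap \<alpha> j a * (of_int c * spoly (eta n) (m - ?l))) \<in> rad_ideal q"
        by (intro rad_ideal_char SA_mult SA_of_int a spoly_in_SA eta_in_root_lattice)
      then show ?thesis using 3 by (simp add: rmap_spoly c mult_ac)
    qed
  qed
next
  case (char a)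
  then show ?case
    by (simp add: const_linear.of_nat [OF rmap_linear] rad_ideal_char rmap_in_SA)
next
  case zero
  then show ?case by (simp add: const_linear.zero [OF rmap_linear] rad_ideal_zero)
next
  case (diff f g)
  have "rmap \<alpha> k (f - g) = rmap \<alpha> k f - rmap \<alpha> k g"
    using const_linear.add [OF rmap_linear, of \<alpha> k "f - g" g] by (simp add: algebra_simps)
  then show ?case using diff rad_ideal_diff by simp
qed

text \<open>Adjointness moves s_(eta,m) onto iota(e_beta), where r_(eta,m) vanishes because m >
  0.\<close>

lemma B_rad_ideal_iota:
  assumes "f \<in> rad_ideal q" "\<alpha> \<in> root_lattice n" "\<beta> \<in> root_lattice n"
  shows "B (pure (Poly_Mapping.single \<alpha> f) 1) (pure (Poly_Mapping.single \<beta> 1) 1) = 0"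
proof -
  have Z: "pure (Poly_Mapping.single \<beta> 1) 1 \<in> carrier V"
    using assms by (intro VZ.pure_carrier single_in_VZ SA_1)
  show ?thesis
    using assms(1)
  proof (induction rule: rad_ideal_induct)
    case (eta a m)
    have "m \<noteq> 0" using eta by (metis dvd_0_right)
    have v: "pure (Poly_Mapping.single \<alpha> a) 1 \<in> carrier V"
      using eta assms by (intro VZ.pure_carrier single_in_VZ)
    have "pure (Poly_Mapping.single \<alpha> (a * spoly (eta n) m)) 1 = sF n (eta n) m (pure (Poly_Mapping.single \<alpha> a) 1)"
      by (simp add: sF_pure eta_in_root_lattice s_op_single mult.commute)
    moreover have "rF n (eta n) m (pure (Poly_Mapping.single \<beta> 1) 1) = \<one>\<^bsub>V\<^esub>"
      using \<open>m \<noteq> 0\<close> by (simp add: rF_pure r_op_single rmap_1 VZ.pure_zero_left)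
    ultimately show ?case
      using v Z by (simp add: B_adjoint eta_in_root_lattice B_one_right)
  next
    case (char a)
    have "pcong n CHAR('f) (of_nat CHAR('f) * a) 0" using char by (auto simp: pcong_def)
    then have "pure (Poly_Mapping.single \<alpha> (of_nat CHAR('f) * a)) 1 = pure (Poly_Mapping.single \<alpha> 0) 1"
      by (rule pure_pcong) (use assms SA_0 in auto)
    then show ?case using Z by (simp add: VZ.pure_zero_left B_one)
  next
    case zero
    show ?case using Z by (simp add: VZ.pure_zero_left B_one)
  next
    case (diff f g)
    then have "Poly_Mapping.single \<alpha> f \<in> VZ n" "Poly_Mapping.single \<alpha> g \<in> VZ n"
      using assms rad_ideal_subset_SA single_in_VZ by blast+
    then show ?case
      using diff Z by (simp add: single_diff VZ.pure_diff_left B_mult B_inv VZ.pure_carrier)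
  qed
qed

text \<open>The letters of a word in the second argument are moved one by one to the first as
  operators r, under which the ideal is stable. Hence f is arbitrary in the induction on the
  word.\<close>

lemma B_rad_ideal:
  assumes dvd: "\<And>i k. i \<in> {1..n} \<Longrightarrow> \<not> q dvd k \<Longrightarrow> int CHAR('f) dvd comm_coeff (lattice_form (simple_root i) (eta n)) k"
    and f: "f \<in> rad_ideal q" and \<alpha>: "\<alpha> \<in> root_lattice n" and u: "u \<in> carrier V"
  shows "B (pure (Poly_Mapping.single \<alpha> f) c) u = 0"
proof -
  have X: "Poly_Mapping.single \<alpha> f \<in> VZ n" if "f \<in> rad_ideal q" for f
    using that \<alpha> rad_ideal_subset_SA single_in_VZ by blast
  have words: "B (pure (Poly_Mapping.single \<alpha> f) 1) (pure (Poly_Mapping.single \<beta> (\<Prod>x\<in>#M. gsimple x)) 1) = 0"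
    if "f \<in> rad_ideal q" "\<beta> \<in> root_lattice n" "set_mset M \<subseteq> {1..n} \<times> {1..}" for f \<beta> M
    using that
  proof (induction M arbitrary: f)
    case empty
    then show ?case using B_rad_ideal_iota \<alpha> by simp
  next
    case (add x M)
    obtain i m where x: "x = (i, m)" "i \<in> {1..n}" using add.prems by (cases x) auto
    let ?Y = "pure (Poly_Mapping.single \<beta> (\<Prod>x\<in>#M. gsimple x)) 1"
    have i: "simple_root i \<in> root_lattice n" using x simple_root_in_root_lattice by blast
    have Y: "?Y \<in> carrier V"
      using add.prems by (intro VZ.pure_carrier single_in_VZ)
        (auto simp: SA_def intro!: gen_subring_prod)
    have "pure (Poly_Mapping.single \<beta> (\<Prod>x\<in>#add_mset x M. gsimple x)) 1 = sF n (simple_root i) m ?Y"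
      using i by (simp add: sF_pure s_op_single x gsimple_def)
    then have "B (pure (Poly_Mapping.single \<alpha> f) 1) (pure (Poly_Mapping.single \<beta> (\<Prod>x\<in>#add_mset x M. gsimple x)) 1) =
        B (pure (Poly_Mapping.single \<alpha> (rmap (simple_root i) m f)) 1) ?Y"
      using i Y add.prems X by (simp add: B_adjoint' VZ.pure_carrier rF_pure r_op_single)
    also have "\<dots> = 0"
      using add.prems dvd x(2) by (intro add.IH rmap_rad_ideal) auto
    finally show ?case .
  qed
  have pure_right: "B (pure (Poly_Mapping.single \<alpha> f) 1) (pure v 1) = 0" if "v \<in> VZ n" for v
    using that
  proof (induction rule: VZ_induct)
    case (single \<beta> M)
    then show ?case using words f by blast
  next
    case zero
    then show ?case using X f by (simp add: VZ.pure_zero_left B_one_right VZ.pure_carrier)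
  next
    case (diff u v)
    then show ?case
      using X f B_mult B_inv B_sym
      by (simp add: VZ.pure_diff_left VZ.pure_carrier B_sym [of "pure (Poly_Mapping.single \<alpha> f) 1"] B_mult B_inv)
  qed
  have "B (pure (Poly_Mapping.single \<alpha> f) 1) u = 0"
    using u
  proof (induction rule: VZ.tensor_induct)
    case one
    then show ?case using X f by (simp add: B_one_right VZ.pure_carrier)
  next
    case (pure v c)
    then show ?case using X f B_pure_right [of v _ c] pure_right by (simp add: VZ.pure_carrier)
  next
    case (mult U W)
    then show ?case
      using X f by (simp add: VZ.pure_carrier B_sym [of "pure (Poly_Mapping.single \<alpha> f) 1"] B_mult)
  qed
  then show ?thesis unfolding B_pure [OF X [OF f] u, of c] by simp
qed

text \<open>Scalars are absorbed into the second tensor factor and words into multisets, so that the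
  span becomes the subgroup generated by explicit pure tensors.\<close>

lemma IL_eq:
  "IL n p r = generate V {pure (Poly_Mapping.single \<alpha> ((\<Prod>x\<in>#M. gsimple x) * spoly (eta n) m)) c |\<alpha> M m c.
     \<alpha> \<in> root_lattice n \<and> set_mset M \<subseteq> {1..n} \<times> {1..} \<and> m \<ge> 1 \<and> \<not> p ^ r dvd m}" (is "_ = generate V ?G")
proof -
  have s_word: "s_word (sF n) w (pure v c) = pure (s_word s_op w v) c" if "set w \<subseteq> {1..n} \<times> {1..}" for w v c
    using that by (induction w) (auto simp: s_word_def sF_pure simple_root_in_root_lattice)
  have word: "s_word (sF n) w (sF n (eta n) m (iotaF n \<alpha>)) =
      pure (Poly_Mapping.single \<alpha> ((\<Prod>x\<in>#mset w. gsimple x) * spoly (eta n) m)) 1"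
    if "set w \<subseteq> {1..n} \<times> {1..}" for w m \<alpha>
    using that by (simp add: iotaF_def iota_def sF_pure eta_in_root_lattice s_op_single s_word s_word_s_op)
  have "{tensor_scale (VZ n) c X |c X. X \<in> {s_word (sF n) w (sF n (eta n) m (iotaF n \<alpha>)) |w m \<alpha>.
      set w \<subseteq> {1..n} \<times> {1..} \<and> m \<ge> 1 \<and> \<not> p ^ r dvd m \<and> \<alpha> \<in> root_lattice n}} = ?G" (is "?L = _")
  proof (intro equalityI subsetI; elim CollectE exE conjE)
    fix Y X :: "(voa, 'f) tens" and c w m \<alpha>
    assume *: "set w \<subseteq> {1..n} \<times> {1..}" "m \<ge> 1" "\<not> p ^ r dvd m" "\<alpha> \<in> root_lattice n"
      and Y: "Y = tensor_scale (VZ n) c X" "X = s_word (sF n) w (sF n (eta n) m (iotaF n \<alpha>))"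
    have "Y = pure (Poly_Mapping.single \<alpha> ((\<Prod>x\<in>#mset w. gsimple x) * spoly (eta n) m)) c"
      using * by (simp add: Y word VZ.scale_pure)
    moreover have "set_mset (mset w) \<subseteq> {1..n} \<times> {1..}" using * by simp
    ultimately show "Y \<in> ?G" using * by (intro CollectI exI conjI)
  next
    fix Y :: "(voa, 'f) tens" and \<alpha> M m c
    assume *: "set_mset M \<subseteq> {1..n} \<times> {1..}" "m \<ge> 1" "\<not> p ^ r dvd m" "\<alpha> \<in> root_lattice n"
      and Y: "Y = pure (Poly_Mapping.single \<alpha> ((\<Prod>x\<in>#M. gsimple x) * spoly (eta n) m)) c"
    obtain w where w: "mset w = M" using ex_mset by blast
    then have w': "set w \<subseteq> {1..n} \<times> {1..}" using * by auto
    then have "Y = tensor_scale (VZ n) c (s_word (sF n) w (sF n (eta n) m (iotaF n \<alpha>)))"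
      by (simp add: Y word VZ.scale_pure w)
    then show "Y \<in> ?L" using w' * by (intro CollectI exI conjI) (assumption | rule refl)+
  qed
  then show ?thesis unfolding IL_def tensor_span_def by simp
qed

lemma prod_gsimple_in_SA: "set_mset M \<subseteq> {1..n} \<times> {1..} \<Longrightarrow> (\<Prod>x\<in>#M. gsimple x) \<in> SA n"
  unfolding SA_def by (rule gen_subring_prod)

lemma subgroup_IL: "subgroup (IL n p r) V"
  unfolding IL_eq
proof (rule V.generate_is_subgroup, rule subsetI)
  fix X assume "X \<in> {pure (Poly_Mapping.single \<alpha> ((\<Prod>x\<in>#M. gsimple x) * spoly (eta n) m)) c |\<alpha> M m c.
     \<alpha> \<in> root_lattice n \<and> set_mset M \<subseteq> {1..n} \<times> {1..} \<and> m \<ge> 1 \<and> \<not> p ^ r dvd m}"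
  then obtain \<alpha> M m c where "X = pure (Poly_Mapping.single \<alpha> ((\<Prod>x\<in>#M. gsimple x) * spoly (eta n) m)) c"
    "\<alpha> \<in> root_lattice n" "set_mset M \<subseteq> {1..n} \<times> {1..}" by blast
  then show "X \<in> carrier V"
    by (simp only:) (intro VZ.pure_carrier single_in_VZ SA_mult prod_gsimple_in_SA spoly_in_SA eta_in_root_lattice)
qed

lemma IL_mult: "X \<in> IL n p r \<Longrightarrow> Y \<in> IL n p r \<Longrightarrow> X \<otimes>\<^bsub>V\<^esub> Y \<in> IL n p r"
  by (rule subgroup.m_closed [OF subgroup_IL])

lemma pure_in_IL:
  assumes "a \<in> SA n" "\<alpha> \<in> root_lattice n" "\<not> p ^ r dvd m"
  shows "pure (Poly_Mapping.single \<alpha> (a * spoly (eta n) m)) c \<in> IL n p r"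
  using assms(1) unfolding SA_def
proof (induction rule: gen_subring_induct)
  case (prod M)
  \<comment> \<open>Index 0 is excluded because p^r divides 0.\<close>
  have "m \<ge> 1" using assms(3) by (metis dvd_0_right less_one not_less)
  then show ?case
    unfolding IL_eq using prod assms by (intro generate.incl) blast
next
  case zero
  show ?case using subgroup.one_closed [OF subgroup_IL] by (simp add: VZ.pure_zero_left)
next
  case (diff a b)
  have "Poly_Mapping.single \<alpha> (d * spoly (eta n) m) \<in> VZ n" if "d \<in> SA n" for d
    using that assms by (intro single_in_VZ SA_mult spoly_in_SA eta_in_root_lattice)
  from this [OF diff.hyps(1) [folded SA_def]] this [OF diff.hyps(2) [folded SA_def]]
  have "Poly_Mapping.single \<alpha> (a * spoly (eta n) m) \<in> VZ n" "Poly_Mapping.single \<alpha> (b * spoly (eta n) m) \<in> VZ n" .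
  then show ?case
    using diff.IH by (simp add: left_diff_distrib single_diff VZ.pure_diff_left IL_mult
      subgroup.m_inv_closed [OF subgroup_IL])
qed

lemma IL_subset_Rad:
  assumes dvd: "\<And>i k. i \<in> {1..n} \<Longrightarrow> \<not> p ^ r dvd k \<Longrightarrow> int CHAR('f) dvd comm_coeff (lattice_form (simple_root i) (eta n)) k"
  shows "IL n p r \<subseteq> Rad n B"
proof
  fix X :: "(voa, 'f) tens"
  assume X: "X \<in> IL n p r"
  then have carrier: "X \<in> carrier V" by (rule subgroup.mem_carrier [OF subgroup_IL])
  have "X \<in> carrier V \<and> (\<forall>u\<in>carrier V. B X u = 0)"
    using X unfolding IL_eq
  proof (induction rule: generate.induct)
    case one
    then show ?case using B_one by simp
  next
    case (incl h)
    then obtain \<alpha> M m c where h: "h = pure (Poly_Mapping.single \<alpha> ((\<Prod>x\<in>#M. gsimple x) * spoly (eta n) m)) c"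
      "\<alpha> \<in> root_lattice n" "set_mset M \<subseteq> {1..n} \<times> {1..}" "\<not> p ^ r dvd m" by blast
    have rad_ideal: "(\<Prod>x\<in>#M. gsimple x) * spoly (eta n) m \<in> rad_ideal (p ^ r)"
      using h by (intro rad_ideal_eta prod_gsimple_in_SA)
    then have "h \<in> carrier V" unfolding h(1) using h(2) by (intro VZ.pure_carrier single_in_VZ rad_ideal_subset_SA)
    then show ?case using B_rad_ideal [OF dvd rad_ideal h(2)] h(1) by blast
  next
    case (inv h)
    then obtain \<alpha> M m c where h: "h = pure (Poly_Mapping.single \<alpha> ((\<Prod>x\<in>#M. gsimple x) * spoly (eta n) m)) c"
      "\<alpha> \<in> root_lattice n" "set_mset M \<subseteq> {1..n} \<times> {1..}" "\<not> p ^ r dvd m" by blast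
    have rad_ideal: "(\<Prod>x\<in>#M. gsimple x) * spoly (eta n) m \<in> rad_ideal (p ^ r)"
      using h by (intro rad_ideal_eta prod_gsimple_in_SA)
    then have "h \<in> carrier V" unfolding h(1) using h(2) by (intro VZ.pure_carrier single_in_VZ rad_ideal_subset_SA)
    moreover have "\<forall>u\<in>carrier V. B h u = 0" using B_rad_ideal [OF dvd rad_ideal h(2)] h(1) by blast
    ultimately show ?case by (simp add: B_inv)
  next
    case (eng X Y)
    then show ?case by (simp add: B_mult)
  qed
  then show "X \<in> Rad n B" by (simp add: Rad_def VF_def)
qed

end

section \<open>Nondegeneracy modulo \<open>I\<^sub>L\<close>\<close>

context VF_form
begin

lemma hom_finprod:
  assumes h: "h \<in> hom V V" and g: "g \<in> T \<rightarrow> carrier V" and "finite T"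
  shows "h (finprod V g T) = finprod V (\<lambda>x. h (g x)) T"
  using assms(3) g
proof (induction T)
  case empty
  have "group_hom V V h" using h by (intro group_hom.intro group_hom_axioms.intro V.is_group)
  then show ?case by (simp add: group_hom.hom_one)
next
  case (insert x T)
  then have "g \<in> T \<rightarrow> carrier V" "g x \<in> carrier V" "(\<lambda>x. h (g x)) \<in> T \<rightarrow> carrier V" "h (g x) \<in> carrier V"
    using hom_in_carrier [OF h] by auto
  then show ?case using insert by (simp add: hom_mult [OF h])
qed

lemma B_finprod:
  assumes "g \<in> T \<rightarrow> carrier V" "finite T" "u \<in> carrier V"
  shows "B (finprod V g T) u = (\<Sum>x\<in>T. B (g x) u)"
  using assms(2,1)
proof (induction T)
  case (insert x T)
  then show ?case using assms(3) by (simp add: B_mult Pi_iff)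
qed (simp add: B_one assms)

lemma pure_uminus:
  assumes "v \<in> VZ n"
  shows "pure (- v) c = pure v (- c)"
proof -
  have "pure v (- c) \<otimes>\<^bsub>V\<^esub> pure v c = \<one>\<^bsub>V\<^esub>"
    using VZ.pure_add_right [OF assms, of "- c" c] by (simp add: VZ.pure_zero_right assms)
  then have "inv\<^bsub>V\<^esub> pure v c = pure v (- c)"
    using assms by (intro V.inv_equality VZ.pure_carrier)
  then show ?thesis using VZ.pure_uminus_left [OF assms, of c] by simp
qed

lemma pure_sign:
  assumes "a \<in> SA n" "\<alpha> \<in> root_lattice n"
  shows "pure (Poly_Mapping.single \<alpha> ((- 1) ^ k * a)) c = pure (Poly_Mapping.single \<alpha> a) ((- 1) ^ k * c)"
  using pure_uminus [OF single_in_VZ [OF assms(2,1)], of c]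
  by (cases "even k") (simp_all add: single_uminus)

definition indices :: "((nat \<times> nat) multiset \<times> lattice) set" where
  "indices = {M. set_mset M \<subseteq> colors n \<times> {1..}} \<times> root_lattice n"

definition vec :: "nat \<Rightarrow> (nat \<times> nat) multiset \<times> lattice \<Rightarrow> voa" where
  "vec q x = Poly_Mapping.single (snd x) (\<Prod>y\<in>#fst x. gmon n q y)"

text \<open>Coefficients belong to indices rather than vectors, so combinations make sense before
  the vectors \<open>vec q x\<close> are known to be independent.\<close>

definition ev :: "nat \<Rightarrow> ((nat \<times> nat) multiset \<times> lattice) set \<Rightarrow> ((nat \<times> nat) multiset \<times> lattice \<Rightarrow> 'f) \<Rightarrow> (voa, 'f) tens" where
  "ev q T f = finprod V (\<lambda>x. pure (vec q x) (f x)) T"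

lemma prod_gmon_in_SA: "set_mset M \<subseteq> colors n \<times> {1..} \<Longrightarrow> (\<Prod>y\<in>#M. gmon n q y) \<in> SA n"
  by (intro SA_prod gmon_in_SA) auto

lemma vec_in_VZ: "x \<in> indices \<Longrightarrow> vec q x \<in> VZ n"
  unfolding vec_def indices_def by (intro single_in_VZ prod_gmon_in_SA) auto

lemma pure_vec_carrier: "T \<subseteq> indices \<Longrightarrow> (\<lambda>x. pure (vec q x) (f x)) \<in> T \<rightarrow> carrier V"
  by (auto intro!: VZ.pure_carrier vec_in_VZ)

lemma ev_closed: "T \<subseteq> indices \<Longrightarrow> ev q T f \<in> carrier V"
  unfolding ev_def by (intro V.finprod_closed pure_vec_carrier)

lemma ev_cong: "T \<subseteq> indices \<Longrightarrow> (\<And>x. x \<in> T \<Longrightarrow> f x = g x) \<Longrightarrow> ev q T f = ev q T g"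
  unfolding ev_def by (rule V.finprod_cong' [OF refl pure_vec_carrier]) simp_all

lemma ev_restrict:
  assumes "finite T" "T \<subseteq> indices" "U \<subseteq> T" "\<And>x. x \<in> T - U \<Longrightarrow> f x = 0"
  shows "ev q T f = ev q U f"
  unfolding ev_def
proof (rule V.finprod_mono_neutral_cong_right)
  show "pure (vec q x) (f x) = \<one>\<^bsub>V\<^esub>" if "x \<in> T - U" for x
  proof -
    have "vec q x \<in> VZ n" using that assms(2) by (intro vec_in_VZ) auto
    then show ?thesis by (simp add: assms(4) [OF that] VZ.pure_zero_right)
  qed
qed (use assms pure_vec_carrier in auto)

text \<open>As f has no zeros on T, the set T is the exact support, and the induction passes from T
  to the image under lowering of its part with maximal count. In particular the vectors
  \<open>vec (p ^ r) x\<close> are linearly independent modulo the radical.\<close>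

lemma nondegenerate:
  assumes p: "prime p" "p > 2" "CHAR('f) = p" and n: "n \<ge> 1" "n + 1 = a * p ^ r" "coprime a p"
    and "finite T" "T \<subseteq> indices" "T \<noteq> {}" "\<And>x. x \<in> T \<Longrightarrow> f x \<noteq> 0" "\<And>x. x \<in> T \<Longrightarrow> weight (fst x) \<le> W"
  shows "\<exists>u\<in>carrier V. B (ev (p ^ r) T f) u \<noteq> 0"
  using assms(7-)
proof (induction W arbitrary: T f rule: less_induct)
  case (less W)
  define q where "q = p ^ r"
  have q: "q > 0" using p(2) by (simp add: q_def)
  note T = less.prems
  show ?case
  proof (cases "\<forall>x\<in>T. fst x = {#}")
    case True
    obtain x0 where x0: "x0 \<in> T" using T by blast
    \<comment> \<open>iota(e_alpha) pairs nontrivially only with iota(e_(-alpha)), so this vector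
      reads off the coefficient at \<open>x0\<close>.\<close>
    let ?u = "iotaF n (- snd x0) :: (voa, 'f) tens"
    have snd: "snd x \<in> root_lattice n" if "x \<in> T" for x
      using subsetD [OF T(2) that] by (simp add: indices_def mem_Times_iff)
    have pure_vec: "vec q x = iota (snd x)" if "x \<in> T" for x
      using that True by (simp add: vec_def iota_def)
    have u: "?u \<in> carrier V"
      unfolding iotaF_def iota_def using snd [OF x0]
      by (intro VZ.pure_carrier single_in_VZ SA_1 root_lattice_uminus)
    have "B (ev q T f) ?u = (\<Sum>x\<in>T. B (pure (vec q x) (f x)) ?u)"
      unfolding ev_def using T u by (intro B_finprod pure_vec_carrier)
    also have "\<dots> = (\<Sum>x\<in>T. if x = x0 then f x else 0)"
    proof (rule sum.cong [OF refl])
      fix x assume x: "x \<in> T"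
      have "B (pure (vec q x) (f x)) ?u = f x * B (iotaF n (snd x)) ?u"
        using B_pure [OF vec_in_VZ u, of x q "f x"] x T(2) by (auto simp: pure_vec iotaF_def)
      also have "\<dots> = (if x = x0 then f x else 0)"
        using B_iota [OF snd [OF x] root_lattice_uminus [OF snd [OF x0]]] True x x0
        by (auto simp: prod_eq_iff)
      finally show "B (pure (vec q x) (f x)) ?u = (if x = x0 then f x else 0)" .
    qed
    also have "\<dots> = f x0" using T(1) x0 by simp
    finally have "B (ev (p ^ r) T f) ?u \<noteq> 0" using T(4) [OF x0] by (simp add: q_def)
    then show ?thesis using u by (rule bexI)
  next
    case False
    then obtain x1 where x1: "x1 \<in> T" "fst x1 \<noteq> {#}" by blast
    have M: "set_mset (fst x) \<subseteq> colors n \<times> {1..}" "snd x \<in> root_lattice n" if "x \<in> T" for x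
      using subsetD [OF T(2) that] by (simp_all add: indices_def mem_Times_iff)
    obtain i where i: "i \<in> colors n" "color_count i (fst x1) \<noteq> 0"
      using color_count_eq_0_imp [OF _ M(1) [OF x1(1)]] x1(2) by blast
    define k where "k = Max ((\<lambda>x. color_count i (fst x)) ` T)"
    have k_ge: "color_count i (fst x) \<le> k" if "x \<in> T" for x
      unfolding k_def using that T(1) by (intro Max_ge) auto
    have k: "k > 0" using k_ge [OF x1(1)] i(2) by simp
    define U where "U = {x \<in> T. color_count i (fst x) = k}"
    have "k \<in> (\<lambda>x. color_count i (fst x)) ` T" unfolding k_def using T(1,3) by (intro Max_in) auto
    then have "U \<noteq> {}" by (auto simp: U_def)
    have U: "finite U" "U \<subseteq> T" using T(1) by (auto simp: U_def)
    define \<phi> where "\<phi> x = (lower i (fst x), snd x)" for x :: "(nat \<times> nat) multiset \<times> lattice"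
    have \<phi>_indices: "\<phi> x \<in> indices" if "x \<in> T" for x
      using M [OF that] set_lower [of "fst x" "colors n" i] by (simp add: \<phi>_def indices_def)
    have inj: "inj_on \<phi> U"
    proof (rule inj_onI)
      fix x y assume xy: "x \<in> U" "y \<in> U" "\<phi> x = \<phi> y"
      have "raise i k (lower i (fst z)) = fst z" if "z \<in> U" for z
        using that raise_lower [of "fst z" i] M [of z] by (auto simp: U_def)
      then show "x = y" using xy by (metis \<phi>_def prod.collapse prod.inject)
    qed
    obtain \<beta> where \<beta>: "\<beta> \<in> root_lattice n" "separates n p q i W \<beta>"
      using ex_separates [OF p n i(1)] unfolding q_def by blast
    \<comment> \<open>Coefficients transported along \<open>\<phi>\<close>, which is injective on U;
      the sign collects one factor -1 from each of the k lowered generators.\<close>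
    let ?f' = "\<lambda>y. (- 1) ^ k * f (inv_into U \<phi> y)"
    have "rF n \<beta> (color_step q i * k) (ev q T f) = finprod V (\<lambda>x. rF n \<beta> (color_step q i * k) (pure (vec q x) (f x))) T"
      unfolding ev_def using T by (intro hom_finprod rF_hom pure_vec_carrier)
    also have "\<dots> = finprod V (\<lambda>x. pure (vec q (\<phi> x)) ((- 1) ^ k * f x)) U"
    proof (rule V.finprod_mono_neutral_cong_right)
      show "finite T" "U \<subseteq> T" using T U by auto
      show "(\<lambda>x. rF n \<beta> (color_step q i * k) (pure (vec q x) (f x))) \<in> T \<rightarrow> carrier V"
        using T pure_vec_carrier rF_closed by blast
      fix x assume x: "x \<in> T - U"
      have "pcong n CHAR('f) (rmap \<beta> (color_step q i * k) (\<Prod>y\<in>#fst x. gmon n q y)) 0"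
        unfolding p(3) using x k_ge [of x] M [of x] T(5)
        by (intro pcong_rmap_prod(1) [OF \<beta>(2) q i(1)]) (auto simp: U_def)
      then have "pure (Poly_Mapping.single (snd x) (rmap \<beta> (color_step q i * k) (\<Prod>y\<in>#fst x. gmon n q y))) (f x) =
          pure (Poly_Mapping.single (snd x) 0) (f x)"
        by (rule pure_pcong) (use x M SA_0 in auto)
      then show "rF n \<beta> (color_step q i * k) (pure (vec q x) (f x)) = \<one>\<^bsub>V\<^esub>"
        by (simp add: rF_pure vec_def r_op_single VZ.pure_zero_left)
    next
      fix x assume x: "x \<in> U"
      then have xT: "x \<in> T" and color_count: "color_count i (fst x) = k" by (auto simp: U_def)
      have "set_mset (lower i (fst x)) \<subseteq> colors n \<times> {1..}" using set_lower [OF M(1) [OF xT]] .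
      then have SA: "(\<Prod>y\<in>#lower i (fst x). gmon n q y) \<in> SA n" by (rule prod_gmon_in_SA)
      have "pcong n CHAR('f) (rmap \<beta> (color_step q i * k) (\<Prod>y\<in>#fst x. gmon n q y))
          ((- 1) ^ k * (\<Prod>y\<in>#lower i (fst x). gmon n q y))"
        unfolding p(3) color_count [symmetric]
        by (intro pcong_rmap_prod(2) [OF \<beta>(2) q i(1)] M xT T(5))
      then have "pure (Poly_Mapping.single (snd x) (rmap \<beta> (color_step q i * k) (\<Prod>y\<in>#fst x. gmon n q y))) (f x) =
          pure (Poly_Mapping.single (snd x) ((- 1) ^ k * (\<Prod>y\<in>#lower i (fst x). gmon n q y))) (f x)"
        by (rule pure_pcong) (use M [OF xT] SA in \<open>auto intro!: SA_mult simp: uminus_power_if SA_1 SA_uminus\<close>)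
      then show "rF n \<beta> (color_step q i * k) (pure (vec q x) (f x)) = pure (vec q (\<phi> x)) ((- 1) ^ k * f x)"
        using pure_sign [OF SA M(2) [OF xT]] by (simp add: rF_pure vec_def r_op_single \<phi>_def)
    qed
    also have "\<dots> = finprod V (\<lambda>x. pure (vec q (\<phi> x)) (?f' (\<phi> x))) U"
      using inj \<phi>_indices U by (intro V.finprod_cong') (auto intro!: VZ.pure_carrier vec_in_VZ)
    also have "\<dots> = ev q (\<phi> ` U) ?f'"
      unfolding ev_def using U \<phi>_indices
      by (intro V.finprod_reindex [symmetric] pure_vec_carrier inj) auto
    finally have rF: "rF n \<beta> (color_step q i * k) (ev q T f) = ev q (\<phi> ` U) ?f'" .
    have weight: "weight (lower i (fst x)) + k \<le> W" if "x \<in> U" for x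
      using that weight_lower [of "fst x" i] M [of x] T(5) [of x] by (fastforce simp: U_def)
    \<comment> \<open>An element of U shows k \<le> W, so W is positive and the bound really
      drops.\<close>
    have "W - k < W" using weight \<open>U \<noteq> {}\<close> k by fastforce
    then have "\<exists>u\<in>carrier V. B (ev (p ^ r) (\<phi> ` U) ?f') u \<noteq> 0"
    proof (rule less.IH)
      show "?f' y \<noteq> 0" if "y \<in> \<phi> ` U" for y
        using that inj T(4) U(2) by (auto simp: uminus_power_if)
      show "weight (fst y) \<le> W - k" if "y \<in> \<phi> ` U" for y
        using that weight by (fastforce simp: \<phi>_def)
    qed (use U \<open>U \<noteq> {}\<close> \<phi>_indices in auto)
    then obtain u where u: "u \<in> carrier V" "B (ev q (\<phi> ` U) ?f') u \<noteq> 0" unfolding q_def by blast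
    \<comment> \<open>If u detects the lowered combination, then by adjointness s_(beta, t k) u
      detects the original one.\<close>
    have "B (ev q T f) (sF n \<beta> (color_step q i * k) u) = B (ev q (\<phi> ` U) ?f') u"
      using u ev_closed T(2) \<beta>(1) by (simp add: B_adjoint' rF)
    then show ?thesis using u sF_closed [OF \<beta>(1) u(1)] unfolding q_def by metis
  qed
qed

section \<open>Reduction modulo \<open>I\<^sub>L\<close>\<close>

definition reducible :: "nat \<Rightarrow> nat \<Rightarrow> (voa, 'f) tens \<Rightarrow> bool" where
  "reducible p r X \<longleftrightarrow> (\<exists>T f Y. finite T \<and> T \<subseteq> indices \<and> Y \<in> IL n p r \<and> X = ev (p ^ r) T f \<otimes>\<^bsub>V\<^esub> Y)"

lemma reducibleI:
  "finite T \<Longrightarrow> T \<subseteq> indices \<Longrightarrow> Y \<in> IL n p r \<Longrightarrow> X = ev (p ^ r) T f \<otimes>\<^bsub>V\<^esub> Y \<Longrightarrow> reducible p r X"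
  unfolding reducible_def by (intro exI conjI)

lemma IL_closed: "Y \<in> IL n p r \<Longrightarrow> Y \<in> carrier V"
  by (rule subgroup.mem_carrier [OF subgroup_IL])

lemma reducible_IL:
  assumes "Y \<in> IL n p r"
  shows "reducible p r Y"
proof -
  have "Y = ev (p ^ r) {} (\<lambda>_. 0) \<otimes>\<^bsub>V\<^esub> Y" using IL_closed [OF assms] by (simp add: ev_def)
  then show ?thesis by (rule reducibleI [OF _ _ assms, rotated 2]) simp_all
qed

lemma reducible_one: "reducible p r \<one>\<^bsub>V\<^esub>"
  by (intro reducible_IL subgroup.one_closed [OF subgroup_IL])

lemma reducible_mult:
  assumes "reducible p r X" "reducible p r X'"
  shows "reducible p r (X \<otimes>\<^bsub>V\<^esub> X')"
proof -
  obtain T f Y where T: "finite T" "T \<subseteq> indices" "Y \<in> IL n p r" "X = ev (p ^ r) T f \<otimes>\<^bsub>V\<^esub> Y"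
    using assms(1) unfolding reducible_def by blast
  obtain T' f' Y' where T': "finite T'" "T' \<subseteq> indices" "Y' \<in> IL n p r" "X' = ev (p ^ r) T' f' \<otimes>\<^bsub>V\<^esub> Y'"
    using assms(2) unfolding reducible_def by blast
  \<comment> \<open>Extension by zero to a common index set, on which coefficients can be added
    index by index.\<close>
  define g where "g x = (if x \<in> T then f x else 0)" for x
  define g' where "g' x = (if x \<in> T' then f' x else 0)" for x
  let ?U = "T \<union> T'" and ?ev = "ev (p ^ r)"
  have U: "finite ?U" "?U \<subseteq> indices" using T T' by auto
  have "?ev T f = ?ev T g" by (rule ev_cong [OF T(2)]) (simp add: g_def)
  moreover have "?ev T' f' = ?ev T' g'" by (rule ev_cong [OF T'(2)]) (simp add: g'_def)
  moreover have "?ev ?U g = ?ev T g"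
    by (rule ev_restrict [OF U]) (auto simp: g_def)
  moreover have "?ev ?U g' = ?ev T' g'"
    by (rule ev_restrict [OF U]) (auto simp: g'_def)
  moreover have "?ev ?U (\<lambda>x. g x + g' x) = ?ev ?U g \<otimes>\<^bsub>V\<^esub> ?ev ?U g'"
  proof -
    have "?ev ?U (\<lambda>x. g x + g' x) =
        finprod V (\<lambda>x. pure (vec (p ^ r) x) (g x) \<otimes>\<^bsub>V\<^esub> pure (vec (p ^ r) x) (g' x)) ?U"
      unfolding ev_def using U
      by (intro V.finprod_cong' refl) (auto intro!: VZ.pure_carrier vec_in_VZ VZ.pure_add_right)
    also have "\<dots> = ?ev ?U g \<otimes>\<^bsub>V\<^esub> ?ev ?U g'"
      unfolding ev_def using U by (intro V.finprod_multf pure_vec_carrier)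
    finally show ?thesis .
  qed
  ultimately have "X \<otimes>\<^bsub>V\<^esub> X' = ?ev ?U (\<lambda>x. g x + g' x) \<otimes>\<^bsub>V\<^esub> (Y \<otimes>\<^bsub>V\<^esub> Y')"
    using T T' IL_closed ev_closed by (simp add: V.m_ac)
  then show ?thesis by (rule reducibleI [OF U IL_mult [OF T(3) T'(3)]])
qed

text \<open>Either some factor s_(eta,m) has p^r not dividing m, and the monomial lies in I_L, or
  all indices in colour 0 are multiples of p^r and the monomial is one of the
  \<open>vec (p ^ r) x\<close>.\<close>

lemma prod_gcolor_reducible:
  assumes M: "set_mset M \<subseteq> colors n \<times> {1..}" and \<alpha>: "\<alpha> \<in> root_lattice n" and p: "p > 0"
  shows "reducible p r (pure (Poly_Mapping.single \<alpha> (\<Prod>x\<in>#M. gcolor n x)) c)"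
proof (cases "\<exists>m. (0, m) \<in># M \<and> \<not> p ^ r dvd m")
  case True
  then obtain m N where m: "M = add_mset (0, m) N" "\<not> p ^ r dvd m" by (meson multi_member_split)
  have "(\<Prod>x\<in>#N. gcolor n x) \<in> SA n"
    unfolding SA_eq_gcolor using M m by (intro gen_subring_prod) auto
  then have "pure (Poly_Mapping.single \<alpha> ((\<Prod>x\<in>#N. gcolor n x) * spoly (eta n) m)) c \<in> IL n p r"
    using \<alpha> m by (intro pure_in_IL)
  then show ?thesis
    using reducible_IL by (simp add: m gcolor_def color_def mult.commute)
next
  case False
  let ?q = "p ^ r"
  \<comment> \<open>Passes to the convention of \<open>gmon\<close>, which counts multiples of p^r
    in colour 0; indices in the other colours are divided by 1.\<close>
  define h where "h x = (fst x, snd x div color_step ?q (fst x))" for x :: "nat \<times> nat"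
  have h: "gmon n ?q (h x) = gcolor n x" "h x \<in> colors n \<times> {1..}" if "x \<in># M" for x
  proof -
    have dvd: "color_step ?q (fst x) dvd snd x" using that False by (cases x) (auto simp: color_step_def)
    then show "gmon n ?q (h x) = gcolor n x"
      by (simp add: gmon_def h_def gcolor_def case_prod_beta)
    have "fst x \<in> colors n" "snd x \<ge> 1" using that M by auto
    moreover have "snd x div color_step ?q (fst x) \<noteq> 0"
      using dvd \<open>snd x \<ge> 1\<close> p by (auto simp: dvd_def color_step_def)
    ultimately show "h x \<in> colors n \<times> {1..}" by (simp add: h_def)
  qed
  define x0 where "x0 = (image_mset h M, \<alpha>)"
  have "set_mset (image_mset h M) \<subseteq> colors n \<times> {1..}"
    unfolding set_image_mset by (rule image_subsetI) (rule h(2))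
  then have x0: "{x0} \<subseteq> indices" using \<alpha> by (simp add: x0_def indices_def)
  have "(\<Prod>x\<in>#image_mset h M. gmon n ?q x) = (\<Prod>x\<in>#M. gcolor n x)"
    unfolding image_mset.compositionality using h(1)
    by (intro arg_cong [of _ _ prod_mset] image_mset_cong) simp
  then have "pure (Poly_Mapping.single \<alpha> (\<Prod>x\<in>#M. gcolor n x)) c = ev ?q {x0} (\<lambda>_. c) \<otimes>\<^bsub>V\<^esub> \<one>\<^bsub>V\<^esub>"
    using pure_vec_carrier [OF x0, of ?q "\<lambda>_. c"] by (simp add: ev_def vec_def x0_def)
  then show ?thesis by (rule reducibleI [OF _ x0 subgroup.one_closed [OF subgroup_IL], rotated]) simp
qed

lemma reducible_carrier:
  assumes "X \<in> carrier V" "p > 0"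
  shows "reducible p r X"
  using assms(1)
proof (induction rule: VZ.tensor_induct)
  case one
  show ?case by (rule reducible_one)
next
  case (mult X Y)
  then show ?case by (intro reducible_mult)
next
  case (pure v c)
  \<comment> \<open>The hypotheses range over all scalars because -v tensor c is rewritten as v
    tensor -c.\<close>
  have reducible_diff: "reducible p r (pure (u - v) c)"
    if "u \<in> VZ n" "v \<in> VZ n" "\<And>c. reducible p r (pure u c)" "\<And>c. reducible p r (pure v c)" for u v c
  proof -
    have "pure (u - v) c = pure u c \<otimes>\<^bsub>V\<^esub> pure v (- c)"
      using that VZ.pure_diff_left [of u n v c] VZ.pure_uminus_left [of v n c] pure_uminus [of v c] by simp
    then show ?thesis using reducible_mult that by simp
  qed
  from pure show ?case
  proof (induction arbitrary: c rule: VZ_induct_SA)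
    case (single \<alpha> a)
    from single(2) show ?case
      unfolding SA_eq_gcolor
    proof (induction arbitrary: c rule: gen_subring_induct)
      case (prod M)
      then show ?case using single assms(2) by (intro prod_gcolor_reducible)
    next
      case zero
      show ?case by (simp add: VZ.pure_zero_left reducible_one)
    next
      case (diff a b)
      then show ?case
        unfolding single_diff using single
        by (intro reducible_diff)
          (auto intro!: single_in_VZ simp: SA_eq_gcolor)
    qed
  next
    case zero
    show ?case by (simp add: VZ.pure_zero_left reducible_one)
  next
    case (diff u v)
    then show ?case
      by (intro reducible_diff)
  qed
qed

text \<open>A radical vector is a combination plus an element of I_L. As I_L lies in the radical, so
  does the combination, and \<open>nondegenerate\<close> then forces its support to be
  empty.\<close>

lemma Rad_subset_IL:
  assumes p: "prime p" "p > 2" "CHAR('f) = p" and n: "n \<ge> 1" "n + 1 = a * p ^ r" "coprime a p"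
    and IL: "IL n p r \<subseteq> Rad n B"
  shows "Rad n B \<subseteq> IL n p r"
proof
  fix X assume X: "X \<in> Rad n B"
  then have carrier: "X \<in> carrier V" and B_X: "\<And>u. u \<in> carrier V \<Longrightarrow> B X u = 0"
    by (simp_all add: Rad_def VF_def)
  obtain T f Y where T: "finite T" "T \<subseteq> indices" "Y \<in> IL n p r" "X = ev (p ^ r) T f \<otimes>\<^bsub>V\<^esub> Y"
    using reducible_carrier [OF carrier, of p r] p(2) unfolding reducible_def by auto
  define U where "U = {x \<in> T. f x \<noteq> 0}"
  have U: "finite U" "U \<subseteq> indices" "\<And>x. x \<in> U \<Longrightarrow> f x \<noteq> 0" using T by (auto simp: U_def)
  have XU: "X = ev (p ^ r) U f \<otimes>\<^bsub>V\<^esub> Y"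
    unfolding T(4) by (subst ev_restrict [of T U]) (use T in \<open>auto simp: U_def\<close>)
  have B_Y: "B Y u = 0" if "u \<in> carrier V" for u
    using T(3) IL that by (auto simp: Rad_def VF_def)
  have zero: "B (ev (p ^ r) U f) u = 0" if "u \<in> carrier V" for u
    using B_X [OF that] B_Y [OF that] that ev_closed [OF U(2)] IL_closed [OF T(3)]
    by (simp add: XU B_mult)
  \<comment> \<open>Any common bound on the weights serves as W; the total weight is one.\<close>
  have weight: "weight (fst x) \<le> (\<Sum>x\<in>U. weight (fst x))" if "x \<in> U" for x
    using that U(1) by (intro member_le_sum) auto
  have "U = {}"
  proof (rule ccontr)
    assume "U \<noteq> {}"
    from nondegenerate [OF p n U(1,2) this U(3) weight]
    obtain u where "u \<in> carrier V" "B (ev (p ^ r) U f) u \<noteq> 0" by (rule bexE)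
    then show False using zero by simp
  qed
  then have "X = Y" using XU IL_closed [OF T(3)] by (simp add: ev_def)
  then show "X \<in> IL n p r" using T(3) by simp
qed

end

theorem theorem4p9:
  fixes p n a r :: nat
    and B :: "(voa, 'f::alg_closed_field) tens \<Rightarrow> (voa, 'f) tens \<Rightarrow> 'f"
  assumes "prime p" and "p > 2" and "CHAR('f) = p"
    and "n \<ge> 1" and "p dvd n + 1"
    and "n + 1 = a * p ^ r" and "a > 0" and "r > 0" and "coprime a p"
    and "is_VF_form n B"
  shows "Rad n B = IL n p r"
proof -
  interpret VF_form n B by unfold_locales (rule assms)
  \<comment> \<open>Among the simple roots only alpha_n pairs nontrivially with eta, with value n +
    1 = p^r a. For the others the commutation factor is 1, and k = 0 is excluded because p^r divides
    0.\<close>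
  have "int CHAR('f) dvd comm_coeff (lattice_form (simple_root i) (eta n)) k"
    if "i \<in> {1..n}" "\<not> p ^ r dvd k" for i k
  proof (cases "i = n")
    case True
    have "int n + 1 = int (p ^ r * a)" using assms(6) by (metis mult.commute of_nat_1 of_nat_add)
    then show ?thesis
      using dvd_comm_coeff [OF assms(1-3) that(2), of a] that True assms(3) by (simp only: lattice_form_eta_right simp_thms if_True)
  next
    case False
    have "k \<noteq> 0" using that(2) by (metis dvd_0_right)
    then show ?thesis using that False by (simp add: lattice_form_eta_right comm_coeff_of_0)
  qed
  then have "IL n p r \<subseteq> Rad n B" by (rule IL_subset_Rad)
  with Rad_subset_IL [OF assms(1-4,6,9)] show ?thesis by blast
qed

end
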